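(* Let $p$ be an odd prime and let $\mathcal{F}$ be a fusion system on a finite $p$-group $P$. Let $\mathfrak{Q}$ be a non-empty collection of non-trivial subgroups of $P$ with the following property: if $Q \in \mathfrak{Q}$ and $\phi : Q \to R$ is an $\mathcal{F}$-morphism (with $R \le P$), then $R \in \mathfrak{Q}$. Set $$\mathfrak{N} = \{ \mathcal{N}_{\mathcal{F}}(R) \mid 1 < R \leq P,\ R \text{ fully } \mathcal{F}\text{-normalised and } N_P(R) \in \mathfrak{Q} \}.$$ Assume that each element of $\mathfrak{N}$ is constrained and $p$-stable. Then $\mathfrak{N}$ has a unique maximal element (with respect to inclusion of fusion systems).
   Context: All fusion systems are saturated fusion systems in the usual sense; maps are written on the right. A subgroup $Q\le P$ is fully $\mathcal{F}$-normalised if $|N_P(Q)| \ge |N_P(Q\phi)|$ for every $\mathcal{F}$-morphism $\phi$ with domain $Q$. For a fully $\mathcal{F}$-normalised subgroup $Q$, the normaliser $\mathcal{N}_{\mathcal{F}}(Q)$ is the subsystem of $\mathcal{F}$ on $N_P(Q)$ whose morphisms $R\to T$ ($R,T\le N_P(Q)$) are those $\phi\in \mathrm{Hom}_{\mathcal{F}}(R,T)$ that extend to an $\mathcal{F}$-morphism $\tilde\phi: RQ\to TQ$ restricting to an automorphism of $Q$. $Q$ is normal in $\mathcal{F}$ if $\mathcal{F}=\mathcal{N}_{\mathcal{F}}(Q)$, and $O_p(\mathcal{F})$ is the largest subgroup of $P$ normal in $\mathcal{F}$. $\mathcal{F}$ is constrained if $C_P(O_p(\mathcal{F}))\subseteq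 O_p(\mathcal{F})$. $\mathcal{F}$ is $p$-stable if for every fully $\mathcal{F}$-normalised subgroup $Q$ of $P$, whenever $\chi\in\mathrm{Aut}_{\mathcal{F}}(Q)$ satisfies $(a^{-1})^{\chi}\, a\, (a^{-1})^{\chi}\, a^{\chi^2}=1$ for all $a\in Q$, then $\chi\in O_p(\mathrm{Aut}_{\mathcal{F}}(Q))$. *)

theory Defs
  imports "HOL-Algebra.Algebra"
begin

text \<open>
  Morphisms are extensional functions, so that two morphisms with the same domain are equal iff
  they agree there. Functions are applied on the left, so the image of \<open>x\<close> under \<open>\<phi>\<close>, written
  \<open>x\<phi>\<close> in right-hand notation, is \<open>\<phi> x\<close>, and \<open>\<phi>\<psi>\<close> is \<open>compose Q \<psi> \<phi>\<close>. Accordingly, conjugation by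
  \<open>g\<close> is the map sending \<open>x\<close> to \<open>inv g \<otimes> x \<otimes> g\<close>.
\<close>

subsection \<open>Groups\<close>

definition finite_p_group :: "nat \<Rightarrow> 'a monoid \<Rightarrow> bool" where
  "finite_p_group p G \<longleftrightarrow> group G \<and> (\<exists>n. order G = p ^ n)"

definition centraliser :: "'a monoid \<Rightarrow> 'a set \<Rightarrow> 'a set" where
  "centraliser G H = {g \<in> carrier G. \<forall>h\<in>H. g \<otimes>\<^bsub>G\<^esub> h = h \<otimes>\<^bsub>G\<^esub> g}"

definition p_core :: "nat \<Rightarrow> 'a monoid \<Rightarrow> 'a set" where
  "p_core p G = (GREATEST N. N \<lhd> G \<and> (\<exists>n. card N = p ^ n))"

definition sylow_subgroup :: "nat \<Rightarrow> 'a set \<Rightarrow> 'a monoid \<Rightarrow> bool" where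
  "sylow_subgroup p H G \<longleftrightarrow> subgroup H G \<and> card H = p ^ multiplicity p (order G)"

definition conj_hom :: "'a monoid \<Rightarrow> 'a set \<Rightarrow> 'a set \<Rightarrow> ('a \<Rightarrow> 'a) set" where
  "conj_hom P Q R = {\<phi>. \<exists>g\<in>carrier P. \<phi> = (\<lambda>x\<in>Q. inv\<^bsub>P\<^esub> g \<otimes>\<^bsub>P\<^esub> x \<otimes>\<^bsub>P\<^esub> g) \<and> \<phi> ` Q \<subseteq> R}"


subsection \<open>Fusion systems\<close>

text \<open>
  \<open>mor F Q R\<close> is the set of \<open>F\<close>-morphisms from \<open>Q\<close> to \<open>R\<close>; it is required to be empty unless \<open>Q\<close> and
  \<open>R\<close> are subgroups of the underlying group, so that equality of fusion systems is equality of
  records.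
\<close>

record 'a fusion =
  grp :: "'a monoid"
  mor :: "'a set \<Rightarrow> 'a set \<Rightarrow> ('a \<Rightarrow> 'a) set"

definition fusion_category :: "'a fusion \<Rightarrow> bool" where
  "fusion_category F \<longleftrightarrow>
     (\<forall>Q R. mor F Q R \<noteq> {} \<longrightarrow> subgroup Q (grp F) \<and> subgroup R (grp F)) \<and>
     (\<forall>Q R. subgroup Q (grp F) \<and> subgroup R (grp F) \<longrightarrow> conj_hom (grp F) Q R \<subseteq> mor F Q R) \<and>
     (\<forall>Q R. \<forall>\<phi>\<in>mor F Q R. \<phi> \<in> extensional Q \<and> inj_on \<phi> Q \<and>
        \<phi> \<in> hom (grp F\<lparr>carrier := Q\<rparr>) (grp F\<lparr>carrier := R\<rparr>)) \<and>
     (\<forall>Q R T. \<forall>\<phi>\<in>mor F Q R. \<forall>\<psi>\<in>mor F R T. compose Q \<psi> \<phi> \<in> mor F Q T) \<and>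
     (\<forall>Q R. \<forall>\<phi>\<in>mor F Q R.
        \<phi> \<in> mor F Q (\<phi> ` Q) \<and> restrict (inv_into Q \<phi>) (\<phi> ` Q) \<in> mor F (\<phi> ` Q) Q)"

text \<open>
  The product in \<open>BijGroup\<close> is composition of left maps, so this is the opposite of \<open>Aut\<^sub>F(Q)\<close>
  under composition of right maps; the two have the same subgroups, Sylow subgroups and \<open>p\<close>-core.
\<close>

definition fusion_aut :: "'a fusion \<Rightarrow> 'a set \<Rightarrow> ('a \<Rightarrow> 'a) monoid" where
  "fusion_aut F Q = (BijGroup Q)\<lparr>carrier := mor F Q Q\<rparr>"

definition fully_normalised :: "'a fusion \<Rightarrow> 'a set \<Rightarrow> bool" where
  "fully_normalised F Q \<longleftrightarrow> subgroup Q (grp F) \<and>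
     (\<forall>R. \<forall>\<phi>\<in>mor F Q R. card (normalizer (grp F) (\<phi> ` Q)) \<le> card (normalizer (grp F) Q))"

definition fully_centralised :: "'a fusion \<Rightarrow> 'a set \<Rightarrow> bool" where
  "fully_centralised F Q \<longleftrightarrow> subgroup Q (grp F) \<and>
     (\<forall>R. \<forall>\<phi>\<in>mor F Q R. card (centraliser (grp F) (\<phi> ` Q)) \<le> card (centraliser (grp F) Q))"

text \<open>
  \<open>N\<^sub>\<phi>\<close>, the set of all \<open>g \<in> N\<^sub>P(Q)\<close> such that the conjugate by \<open>\<phi>\<close> of the automorphism of \<open>Q\<close>
  induced by \<open>g\<close> is induced by an element of \<open>P\<close>.
\<close>

definition extension_domain :: "'a monoid \<Rightarrow> 'a set \<Rightarrow> ('a \<Rightarrow> 'a) \<Rightarrow> 'a set" where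
  "extension_domain P Q \<phi> = {g \<in> normalizer P Q.
     (\<lambda>y\<in>\<phi> ` Q. \<phi> (inv\<^bsub>P\<^esub> g \<otimes>\<^bsub>P\<^esub> inv_into Q \<phi> y \<otimes>\<^bsub>P\<^esub> g)) \<in> conj_hom P (\<phi> ` Q) (\<phi> ` Q)}"

text \<open>Saturation in the sense of Broto, Levi and Oliver.\<close>

definition saturated :: "nat \<Rightarrow> 'a fusion \<Rightarrow> bool" where
  "saturated p F \<longleftrightarrow>
     (\<forall>Q. fully_normalised F Q \<longrightarrow>
        fully_centralised F Q \<and> sylow_subgroup p (conj_hom (grp F) Q Q) (fusion_aut F Q)) \<and>
     (\<forall>Q. \<forall>\<phi>\<in>mor F Q (carrier (grp F)). fully_centralised F (\<phi> ` Q) \<longrightarrow>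
        (\<exists>\<psi>\<in>mor F (extension_domain (grp F) Q \<phi>) (carrier (grp F)). restrict \<psi> Q = \<phi>))"

definition saturated_fusion_system :: "nat \<Rightarrow> 'a monoid \<Rightarrow> 'a fusion \<Rightarrow> bool" where
  "saturated_fusion_system p P F \<longleftrightarrow>
     grp F = P \<and> finite_p_group p P \<and> fusion_category F \<and> saturated p F"

definition fusion_normaliser :: "'a fusion \<Rightarrow> 'a set \<Rightarrow> 'a fusion" where
  "fusion_normaliser F Q =
     (let P = grp F; N = P\<lparr>carrier := normalizer P Q\<rparr>
      in \<lparr>grp = N,
          mor = (\<lambda>R T. {\<phi> \<in> mor F R T. subgroup R N \<and> subgroup T N \<and>
            (\<exists>\<psi>\<in>mor F (R <#>\<^bsub>P\<^esub> Q) (T <#>\<^bsub>P\<^esub> Q).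
               restrict \<psi> R = \<phi> \<and> restrict \<psi> Q \<in> auto (P\<lparr>carrier := Q\<rparr>))})\<rparr>)"

definition fusion_normal :: "'a fusion \<Rightarrow> 'a set \<Rightarrow> bool" where
  "fusion_normal F Q \<longleftrightarrow> fully_normalised F Q \<and> F = fusion_normaliser F Q"

definition fusion_core :: "'a fusion \<Rightarrow> 'a set" where
  "fusion_core F = (GREATEST Q. fusion_normal F Q)"

definition constrained :: "'a fusion \<Rightarrow> bool" where
  "constrained F \<longleftrightarrow> centraliser (grp F) (fusion_core F) \<subseteq> fusion_core F"

definition p_stable :: "nat \<Rightarrow> 'a fusion \<Rightarrow> bool" where
  "p_stable p F \<longleftrightarrow>
     (\<forall>Q. fully_normalised F Q \<longrightarrow>
        (\<forall>\<chi>\<in>mor F Q Q.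
           (\<forall>a\<in>Q. \<chi> (inv\<^bsub>grp F\<^esub> a) \<otimes>\<^bsub>grp F\<^esub> a \<otimes>\<^bsub>grp F\<^esub> \<chi> (inv\<^bsub>grp F\<^esub> a) \<otimes>\<^bsub>grp F\<^esub> \<chi> (\<chi> a)
              = \<one>\<^bsub>grp F\<^esub>) \<longrightarrow>
           \<chi> \<in> p_core p (fusion_aut F Q)))"

definition fusion_subsystem :: "'a fusion \<Rightarrow> 'a fusion \<Rightarrow> bool" where
  "fusion_subsystem E F \<longleftrightarrow>
     subgroup (carrier (grp E)) (grp F) \<and> grp E = grp F\<lparr>carrier := carrier (grp E)\<rparr> \<and>
     (\<forall>Q R. mor E Q R \<subseteq> mor F Q R)"

end

theory Submission
  imports Defs
begin

text \<open>
  For a \<open>p\<close>-group \<open>T\<close> let \<open>D\<^sup>*(T)\<close> be the largest normal subgroup \<open>A\<close> of \<open>T\<close> such that every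
  \<open>x \<in> T\<close> with \<open>[A, x, x] = 1\<close> centralises \<open>A\<close> (Glauberman and Solomon). It is abelian,
  characteristic, and contains \<open>Z(T)\<close>. In a constrained and \<open>p\<close>-stable normaliser system \<open>E\<close> on \<open>S\<close> it
  plays the role of \<open>Z(J(S))\<close>: \<open>p\<close>-stability puts abelian normal subgroups of \<open>S\<close> into \<open>O\<^sub>p(E)\<close>, and,
  applied to the subgroup \<open>V\<close> generated by the images of \<open>D\<^sup>*(S)\<close> under \<open>Aut\<^sub>E(O\<^sub>p(E))\<close>, shows that
  \<open>V\<close> has the defining property of \<open>D\<^sup>*(S)\<close>, so that \<open>V = D\<^sup>*(S)\<close> is normal in \<open>E\<close>.
  The maximal element is the normaliser of \<open>D\<^sup>*(P)\<close>. Every other member \<open>N\<^sub>F(R)\<close> lies in it, by downward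
  induction on \<open>|N\<^sub>P(R)|\<close>: unless \<open>N\<^sub>P(R) = P\<close>, the subgroup \<open>D\<^sup>*(N\<^sub>P(R))\<close> is normalised by a larger
  subgroup of \<open>P\<close>, and \<open>N\<^sub>F(R)\<close> is conjugate into the normaliser of a fully normalised conjugate of it.
\<close>

section \<open>Finite groups\<close>

text \<open>The word in \<open>p_stable\<close>, taken at conjugation by \<open>x\<close>, is
  trivial as soon as \<open>[a, x, x] = 1\<close>; the condition defining D* is therefore about
  exactly the elements to which the hypothesis applies. The obstacle is that the argument assumes
  neither saturation of a normaliser system \<open>E\<close> nor a finite group realising it. Maps
  can be extended only by the axioms for \<open>F\<close>, and an extension may leave
  \<open>E\<close> or disagree with the map it should continue. Two devices repair this. Since
  \<open>R\<close> is fully normalised, a morphism of \<open>F\<close> that moves \<open>R\<close>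
  can be followed by one, defined on the normaliser of the image of \<open>R\<close>, that leads
  back into \<open>E\<close>. And if \<open>Q\<close> contains its centraliser, two maps that agree
  on \<open>Q\<close> differ by conjugation with an element of \<open>Q\<close>. In the induction,
  the morphism to a fully normalised conjugate is an arbitrary morphism of \<open>F\<close>, so the
  claim on normaliser systems is proved together with a claim on all morphisms defined on large
  members of \<open>QQ\<close>.\<close>

lemma card_fixed_points_mod_prime:
  fixes G (structure)
  assumes G: "group G" "order G = p ^ n" and p: "Factorial_Ring.prime p" and fin: "finite E"
    and one: "\<And>x. x \<in> E \<Longrightarrow> act \<one>\<^bsub>G\<^esub> x = x"
    and mult: "\<And>g h x. g \<in> carrier G \<Longrightarrow> h \<in> carrier G \<Longrightarrow> x \<in> E \<Longrightarrow>
      act (g \<otimes>\<^bsub>G\<^esub> h) x = act g (act h x)"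
    and closed: "\<And>g x. g \<in> carrier G \<Longrightarrow> x \<in> E \<Longrightarrow> act g x \<in> E"
  shows "card {x \<in> E. \<forall>g\<in>carrier G. act g x = x} mod p = card E mod p"
proof -
  interpret group G by fact
  let ?\<phi> = "\<lambda>g. \<lambda>x\<in>E. act g x"
  have bij: "?\<phi> g \<in> Bij E" if g: "g \<in> carrier G" for g
  proof -
    have "bij_betw (act g) E E"
      by (rule bij_betw_byWitness[where f' = "act (inv g)"])
        (use g in \<open>auto simp: closed mult[symmetric] one\<close>)
    then have "bij_betw (?\<phi> g) E E" using bij_betw_cong[of E "?\<phi> g" "act g" E] by simp
    then show ?thesis by (simp add: Bij_def)
  qed
  interpret A: group_action G E ?\<phi>
  proof (rule group_action.intro, unfold group_hom_def group_hom_axioms_def, intro conjI)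
    show "group G" by (rule is_group)
    show "group (BijGroup E)" by (rule group_BijGroup)
    show "?\<phi> \<in> hom G (BijGroup E)"
    proof (rule homI)
      fix g h assume gh: "g \<in> carrier G" "h \<in> carrier G"
      show "?\<phi> (g \<otimes> h) = ?\<phi> g \<otimes>\<^bsub>BijGroup E\<^esub> ?\<phi> h"
        using gh bij[OF gh(1)] bij[OF gh(2)]
        by (auto simp: BijGroup_def compose_def closed mult fun_eq_iff)
    qed (use bij in \<open>simp add: BijGroup_def\<close>)
  qed
  let ?F = "{x \<in> E. \<forall>g\<in>carrier G. act g x = x}"
  let ?C = "{orbit G ?\<phi> x | x. x \<in> E - ?F}"
  have orb: "orbit G ?\<phi> x = (\<lambda>g. act g x) ` carrier G" if "x \<in> E" for x
    using that by (auto simp: orbit_def)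
  have sub: "orbit G ?\<phi> x \<subseteq> E - ?F" if x: "x \<in> E - ?F" for x
  proof
    fix y assume "y \<in> orbit G ?\<phi> x"
    then obtain g where g: "g \<in> carrier G" "y = act g x" using x orb by auto
    have "y \<notin> ?F"
    proof
      assume y: "y \<in> ?F"
      then have "act (inv g) y = y" using g by auto
      moreover have "act (inv g) y = x" using g x by (auto simp: mult[symmetric] one)
      ultimately show False using y x by auto
    qed
    then show "y \<in> E - ?F" using g x closed by auto
  qed
  have Un: "\<Union>?C = E - ?F"
  proof
    show "\<Union>?C \<subseteq> E - ?F" using sub by blast
    show "E - ?F \<subseteq> \<Union>?C" using A.orbit_refl by blast
  qed
  \<comment> \<open>The points that are moved form a union of orbits whose lengths are powers of
    \<open>p\<close> with positive exponent.\<close>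
  have "p dvd card (\<Union>?C)"
  proof (rule dvd_partition)
    show "finite (\<Union>?C)" unfolding Un using fin by auto
    show "\<forall>c\<in>?C. p dvd card c"
    proof
      fix c assume "c \<in> ?C"
      then obtain x where c: "c = orbit G ?\<phi> x" and x: "x \<in> E" and nf: "x \<notin> ?F" by blast
      have "card (orbit G ?\<phi> x) dvd p ^ n"
        using A.orbit_stabilizer_theorem[OF x] G(2) by (metis dvd_triv_left)
      then obtain i where i: "card (orbit G ?\<phi> x) = p ^ i"
        using p by (auto simp: divides_primepow_nat)
      have "i \<noteq> 0"
      proof
        assume "i = 0"
        then have "card (orbit G ?\<phi> x) = 1" using i by simp
        then obtain y where y: "orbit G ?\<phi> x = {y}" by (meson card_1_singletonE)
        have "x \<in> orbit G ?\<phi> x" using A.orbit_refl x by blast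
        then have "orbit G ?\<phi> x = {x}" using y by simp
        then have "act g x = x" if "g \<in> carrier G" for g using orb[OF x] that by auto
        then show False using nf x by auto
      qed
      then show "p dvd card c" using i c by auto
    qed
    show "\<forall>c1\<in>?C. \<forall>c2\<in>?C. c1 \<noteq> c2 \<longrightarrow> c1 \<inter> c2 = {}"
    proof (intro ballI impI)
      fix c1 c2 assume "c1 \<in> ?C" "c2 \<in> ?C" "c1 \<noteq> c2"
      moreover from this have "c1 \<in> orbits G E ?\<phi>" "c2 \<in> orbits G E ?\<phi>" by (auto simp: orbits_def)
      ultimately show "c1 \<inter> c2 = {}" using A.disjoint_union by blast
    qed
  qed
  then have "p dvd card (E - ?F)" unfolding Un .
  moreover have "card E = card ?F + card (E - ?F)"
    using fin by (subst card_Diff_subset) (auto simp: card_mono)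
  ultimately show ?thesis by (auto elim!: dvdE)
qed

text \<open>Counting fixed points is set up for left actions, which is why \<open>h\<close>
  multiplies on the right by \<open>inv h\<close>. By \<open>fixed_rcoset_conj\<close>, a fixed
  coset \<open>T #> g\<close> means that \<open>g\<close> conjugates \<open>H\<close> into
  \<open>T\<close>.\<close>

lemma (in group) card_fixed_rcosets_mod_prime:
  assumes p: "Factorial_Ring.prime p" and fin: "finite (carrier G)"
    and T: "subgroup T G" and H: "subgroup H G" "card H = p ^ n"
  shows "card {C \<in> rcosets T. \<forall>h\<in>H. C #> inv h = C} mod p = card (rcosets T) mod p"
proof -
  have "card {C \<in> rcosets T. \<forall>h\<in>carrier (G\<lparr>carrier := H\<rparr>). C #> inv h = C} mod p
      = card (rcosets T) mod p"
  proof (rule card_fixed_points_mod_prime)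
    show "group (G\<lparr>carrier := H\<rparr>)" by (simp add: H(1) subgroup_imp_group)
    show "order (G\<lparr>carrier := H\<rparr>) = p ^ n" by (simp add: H order_def)
    show "finite (rcosets T)" using fin T by (meson finite_Pow_iff finite_subset rcosets_subset_PowG)
    fix x assume x: "x \<in> rcosets T"
    then have xG: "x \<subseteq> carrier G" using rcosets_part_G T by blast
    show "x #> inv \<one>\<^bsub>G\<lparr>carrier := H\<rparr>\<^esub> = x" using xG by (simp add: coset_mult_one)
    fix g assume g: "g \<in> carrier (G\<lparr>carrier := H\<rparr>)"
    then have gG: "g \<in> carrier G" using H subgroup.mem_carrier by auto
    show "x #> inv g \<in> rcosets T"
    proof -
      obtain a where a: "a \<in> carrier G" "x = T #> a" using x by (auto simp: RCOSETS_def)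
      then have "x #> inv g = T #> (a \<otimes> inv g)"
        using gG T by (simp add: coset_mult_assoc subgroup.subset)
      then show ?thesis using a gG by (auto simp: RCOSETS_def)
    qed
    fix h assume h: "h \<in> carrier (G\<lparr>carrier := H\<rparr>)"
    then have hG: "h \<in> carrier G" using H subgroup.mem_carrier by auto
    show "x #> inv (g \<otimes>\<^bsub>G\<lparr>carrier := H\<rparr>\<^esub> h) = x #> inv h #> inv g"
      using gG hG xG by (simp add: coset_mult_assoc inv_mult_group)
  qed (rule p)
  then show ?thesis by simp
qed

lemma (in group) fixed_rcoset_conj:
  assumes T: "subgroup T G" and g: "g \<in> carrier G" and h: "h \<in> carrier G"
    and eq: "T #> g #> inv h = T #> g"
  shows "g \<otimes> h \<otimes> inv g \<in> T"
proof -
  have "T #> (g \<otimes> inv h) = T #> g"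
    using assms by (simp add: coset_mult_assoc subgroup.subset)
  then have "g \<otimes> inv h \<in> T #> g" using T g h by (metis inv_closed m_closed rcos_self)
  then obtain t where t: "t \<in> T" "g \<otimes> inv h = t \<otimes> g" by (auto simp: r_coset_def)
  have tG: "t \<in> carrier G" using t T subgroup.mem_carrier by metis
  have "g \<otimes> inv h \<otimes> inv g = t" using t tG g h by (simp add: m_assoc)
  then have "inv (g \<otimes> inv h \<otimes> inv g) \<in> T" using t T by (simp add: subgroup.m_inv_closed)
  then show ?thesis using g h by (simp add: inv_mult_group m_assoc)
qed

text \<open>The index is what the counting of fixed cosets sees, whereas the definition speaks of
  multiplicities.\<close>

lemma sylow_subgroup_iff_index:
  fixes G (structure)
  assumes "group G" "finite (carrier G)" and p: "Factorial_Ring.prime p"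
  shows "sylow_subgroup p T G \<longleftrightarrow>
    subgroup T G \<and> (\<exists>n. card T = p ^ n) \<and> \<not> p dvd card (rcosets\<^bsub>G\<^esub> T)"
proof -
  interpret group G by fact
  have lag: "card (rcosets T) * card T = order G" if "subgroup T G" using lagrange that by auto
  have ord: "order G \<noteq> 0" using assms order_gt_0_iff_finite by blast
  show ?thesis
  proof
    assume *: "sylow_subgroup p T G"
    then have T: "subgroup T G" "card T = p ^ multiplicity p (order G)" by (auto simp: sylow_subgroup_def)
    have "\<not> p dvd card (rcosets T)"
    proof
      assume "p dvd card (rcosets T)"
      then have "p ^ Suc (multiplicity p (order G)) dvd order G"
        using lag[OF T(1)] T(2) by (metis mult_dvd_mono dvd_refl power_Suc)
      then show False using ord p
        by (metis Suc_n_not_le_n not_prime_unit power_dvd_iff_le_multiplicity)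
    qed
    then show "subgroup T G \<and> (\<exists>n. card T = p ^ n) \<and> \<not> p dvd card (rcosets T)" using T by auto
  next
    assume *: "subgroup T G \<and> (\<exists>n. card T = p ^ n) \<and> \<not> p dvd card (rcosets T)"
    then obtain n where n: "card T = p ^ n" by auto
    have "multiplicity p (order G) = n"
    proof (rule multiplicity_eqI)
      show "p ^ n dvd order G" using lag * n by (metis dvd_triv_right)
      show "\<not> p ^ Suc n dvd order G"
      proof
        assume "p ^ Suc n dvd order G"
        then have "p ^ n * p dvd p ^ n * card (rcosets T)" using lag * n by (metis mult.commute power_Suc)
        then show False using * p by (simp add: dvd_mult_cancel_left)
      qed
    qed
    then show "sylow_subgroup p T G" using * n by (simp add: sylow_subgroup_def)
  qed
qed

text \<open>Modulo \<open>p\<close>, the number of cosets of \<open>T\<close> fixed by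
  \<open>H\<close> is the index of \<open>T\<close>, hence nonzero, and a representative of a fixed
  coset conjugates \<open>H\<close> into \<open>T\<close>.\<close>

theorem sylow_conj:
  fixes G (structure)
  assumes G: "group G" "finite (carrier G)" and p: "Factorial_Ring.prime p"
    and T: "sylow_subgroup p T G" and H: "subgroup H G" "card H = p ^ n"
  shows "\<exists>g\<in>carrier G. \<forall>h\<in>H. g \<otimes>\<^bsub>G\<^esub> h \<otimes>\<^bsub>G\<^esub> inv\<^bsub>G\<^esub> g \<in> T"
proof -
  interpret group G by fact
  have T': "subgroup T G" "\<not> p dvd card (rcosets T)"
    using T sylow_subgroup_iff_index[OF G p] by auto
  have "card {C \<in> rcosets T. \<forall>h\<in>H. C #> inv h = C} \<noteq> 0"
    using card_fixed_rcosets_mod_prime[OF p G(2) T'(1) H] T'(2) by (metis dvd_0_right mod_eq_0_iff_dvd)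
  then obtain C where C: "C \<in> rcosets T" "\<forall>h\<in>H. C #> inv h = C" by (auto simp: card_eq_0_iff)
  then obtain g where g: "g \<in> carrier G" "C = T #> g" by (auto simp: RCOSETS_def)
  have "g \<otimes> h \<otimes> inv g \<in> T" if "h \<in> H" for h
    using fixed_rcoset_conj[OF T'(1) g(1)] C g that H subgroup.mem_carrier by metis
  then show ?thesis using g by auto
qed

text \<open>\<open>H\<close> acts on its own cosets and fixes the coset \<open>H\<close>. As
  \<open>p\<close> divides the index, it divides the number of fixed cosets, so there is another
  one, and its representative normalises \<open>H\<close> from outside.\<close>

lemma (in group) normaliser_grows:
  assumes p: "Factorial_Ring.prime p" and G: "order G = p ^ m" and H: "subgroup H G" "H \<noteq> carrier G"
  shows "\<exists>g\<in>carrier G - H. \<forall>h\<in>H. g \<otimes> h \<otimes> inv g \<in> H"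
proof -
  have fin: "finite (carrier G)" using G p order_gt_0_iff_finite by (simp add: prime_gt_0_nat)
  have lag: "card (rcosets H) * card H = p ^ m" using lagrange H(1) G by auto
  obtain n where n: "card H = p ^ n"
    using lag p by (metis divides_primepow_nat dvd_triv_right)
  obtain i where i: "card (rcosets H) = p ^ i"
    using lag p by (metis divides_primepow_nat dvd_triv_left)
  have "i \<noteq> 0"
  proof
    assume "i = 0"
    then have "card H = card (carrier G)" using lag i G by (simp add: order_def)
    then show False using H fin by (metis card_subset_eq subgroup.subset)
  qed
  then have pd: "p dvd card (rcosets H)" using i by simp
  let ?F = "{C \<in> rcosets H. \<forall>h\<in>H. C #> inv h = C}"
  have pF: "p dvd card ?F"
    using card_fixed_rcosets_mod_prime[OF p fin H(1) H(1) n] pd by (simp only: dvd_eq_mod_eq_0)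
  have HF: "H \<in> ?F"
    using H(1) by (auto simp: subgroup.rcos_const subgroup.m_inv_closed is_group
        intro: subgroup.subgroup_in_rcosets)
  have "?F \<noteq> {H}"
  proof
    assume "?F = {H}"
    then have "card ?F = 1" by simp
    then show False using pF p not_prime_unit by metis
  qed
  then obtain C where C: "C \<in> rcosets H" "\<forall>h\<in>H. C #> inv h = C" "C \<noteq> H" using HF by blast
  then obtain g where g: "g \<in> carrier G" "C = H #> g" by (auto simp: RCOSETS_def)
  have "g \<notin> H" using C g H by (auto simp: subgroup.rcos_const is_group)
  moreover have "g \<otimes> h \<otimes> inv g \<in> H" if "h \<in> H" for h
    using fixed_rcoset_conj[OF H(1) g(1)] C g that H subgroup.mem_carrier by metis
  ultimately show ?thesis using g by auto
qed

lemma (in group) p_group_centre_nontrivial: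
  assumes p: "Factorial_Ring.prime p" and G: "order G = p ^ m" "carrier G \<noteq> {\<one>}"
  shows "\<exists>z\<in>carrier G. z \<noteq> \<one> \<and> (\<forall>g\<in>carrier G. g \<otimes> z = z \<otimes> g)"
proof -
  have fin: "finite (carrier G)" using G p order_gt_0_iff_finite by (simp add: prime_gt_0_nat)
  have "m \<noteq> 0" using G by (metis card_1_singletonE one_closed order_def power_0 singletonD)
  then have pd: "p dvd card (carrier G)" using G by (simp add: order_def)
  let ?F = "{x \<in> carrier G. \<forall>g\<in>carrier G. g \<otimes> x \<otimes> inv g = x}"
  have "card ?F mod p = card (carrier G) mod p"
    by (rule card_fixed_points_mod_prime[OF is_group G(1) p fin])
      (auto simp: m_assoc inv_mult_group)
  then have pF: "p dvd card ?F" using pd by (simp only: dvd_eq_mod_eq_0)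
  have "?F \<noteq> {\<one>}"
  proof
    assume "?F = {\<one>}"
    then have "card ?F = 1" by simp
    then show False using pF p not_prime_unit by metis
  qed
  moreover have "\<one> \<in> ?F" by auto
  ultimately obtain z where z: "z \<in> ?F" "z \<noteq> \<one>" by blast
  have "g \<otimes> z = z \<otimes> g" if g: "g \<in> carrier G" for g
  proof -
    have "g \<otimes> z \<otimes> inv g = z" using z g by auto
    then have "g \<otimes> z \<otimes> inv g \<otimes> g = z \<otimes> g" by simp
    then show ?thesis using g z by (simp add: m_assoc)
  qed
  then show ?thesis using z by auto
qed

section \<open>Sylow subgroups of intermediate groups and of images, and the
  \<open>p\<close>-core\<close>

lemma p_subgroup_card:
  assumes "group G" "finite (carrier G)" "Factorial_Ring.prime p" "subgroup H G" "subgroup K G" "H \<subseteq> K" "card K = p ^ n"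
  shows "\<exists>m. card H = p ^ m"
proof -
  interpret group G by fact
  have "subgroup H (G\<lparr>carrier := K\<rparr>)" using assms by (simp add: subgroup_incl)
  then have "card H dvd card K"
    using group.lagrange[OF subgroup_imp_group[OF assms(5)], of H]
    by (simp add: order_def) (metis dvd_triv_right)
  then show ?thesis using assms by (auto simp: divides_primepow_nat)
qed

lemma sylow_subgroup_intermediate:
  fixes G (structure)
  assumes G: "group G" "finite (carrier G)" and p: "Factorial_Ring.prime p"
    and T: "sylow_subgroup p T G" and H: "subgroup H G" "T \<subseteq> H"
  shows "sylow_subgroup p T (G\<lparr>carrier := H\<rparr>)"
proof -
  interpret group G by fact
  let ?H = "G\<lparr>carrier := H\<rparr>"
  have gH: "group ?H" using H by (simp add: subgroup_imp_group)
  have fH: "finite (carrier ?H)" using H G subgroup.subset[OF H(1)] by (auto intro: finite_subset)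
  have T': "subgroup T G" "\<exists>n. card T = p ^ n" "\<not> p dvd card (rcosets T)"
    using T sylow_subgroup_iff_index[OF G p] by auto
  have TH: "subgroup T ?H" using T' H by (simp add: subgroup_incl)
  have "card (rcosets\<^bsub>?H\<^esub> T) * card T = card H" using group.lagrange[OF gH TH] by (simp add: order_def)
  moreover have "card (rcosets H) * card H = order G" using lagrange H by simp
  moreover have "card (rcosets T) * card T = order G" using lagrange T' by simp
  moreover have "card T \<noteq> 0" using T' p by (auto simp: prime_gt_0_nat)
  ultimately have "card (rcosets T) = card (rcosets H) * card (rcosets\<^bsub>?H\<^esub> T)"
    by (metis mult.assoc mult_right_cancel)
  then have "\<not> p dvd card (rcosets\<^bsub>?H\<^esub> T)" using T' by auto
  then show ?thesis using sylow_subgroup_iff_index[OF gH fH p] TH T' by auto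
qed

lemma group_hom_card:
  fixes G (structure)
  assumes "group_hom G H h"
  shows "order G = card (kernel G H h) * card (h ` carrier G)"
proof -
  interpret group_hom G H h by fact
  let ?e = "\<lambda>C. the_elem (h ` C)"
  have im: "h ` (kernel G H h #> g) = {h g}" if "g \<in> carrier G" for g
  proof -
    have "g \<in> kernel G H h #> g" using that subgroup_kernel by (rule G.rcos_self)
    then show ?thesis using that by (auto simp: kernel_def r_coset_def)
  qed
  have "?e ` (rcosets kernel G H h) = h ` carrier G"
  proof -
    have "rcosets kernel G H h = (\<lambda>g. kernel G H h #> g) ` carrier G" by (auto simp: RCOSETS_def)
    then have "?e ` (rcosets kernel G H h) = (\<lambda>g. ?e (kernel G H h #> g)) ` carrier G"
      by (simp only: image_image)
    also have "\<dots> = h ` carrier G" by (rule image_cong) (simp_all add: im)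
    finally show ?thesis .
  qed
  then have "card (rcosets kernel G H h) = card (h ` carrier G)"
    using FactGroup_inj_on card_image by (fastforce simp: FactGroup_def)
  then show ?thesis using G.lagrange[OF subgroup_kernel] by (simp add: mult.commute)
qed

text \<open>The index of the image of \<open>T\<close> divides the index of \<open>T\<close>: the
  cofactor \<open>e\<close> is the index, in the kernel of \<open>h\<close>, of its intersection
  with \<open>T\<close>.\<close>

lemma sylow_subgroup_image:
  assumes h: "group_hom G H h" "h ` carrier G = carrier H" and G: "finite (carrier G)"
    and p: "Factorial_Ring.prime p" and T: "sylow_subgroup p T G"
  shows "sylow_subgroup p (h ` T) H"
proof -
  interpret group_hom G H h by fact
  have fH: "finite (carrier H)" using h(2) G by (metis finite_imageI)
  have T': "subgroup T G" "\<exists>n. card T = p ^ n" "\<not> p dvd card (rcosets\<^bsub>G\<^esub> T)"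
    using T sylow_subgroup_iff_index[OF G.is_group G p] by auto
  then obtain n where n: "card T = p ^ n" by auto
  have hT: "group_hom (G\<lparr>carrier := T\<rparr>) H h"
    unfolding group_hom_def group_hom_axioms_def
    using T' by (auto simp: hom_def subgroup.mem_carrier G.subgroup_imp_group)
  let ?K = "kernel G H h" and ?L = "kernel (G\<lparr>carrier := T\<rparr>) H h"
  have sT: "subgroup (h ` T) H" using T' by (simp add: subgroup_img_is_subgroup)
  have c1: "p ^ n = card ?L * card (h ` T)" using group_hom_card[OF hT] n by (simp add: order_def)
  have c2: "order G = card ?K * order H" using group_hom_card[OF h(1)] h(2) by (simp add: order_def)
  have "subgroup ?L (G\<lparr>carrier := T\<rparr>)" using group_hom.subgroup_kernel[OF hT] .
  then have "subgroup ?L G" using T' G.incl_subgroup by blast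
  moreover have "?L \<subseteq> ?K" using T' by (auto simp: kernel_def subgroup.mem_carrier)
  ultimately have "subgroup ?L (G\<lparr>carrier := ?K\<rparr>)" by (simp add: G.subgroup_incl subgroup_kernel)
  then have "card ?L dvd card ?K"
    using group.lagrange[OF G.subgroup_imp_group[OF subgroup_kernel], of ?L]
    by (simp add: order_def) (metis dvd_triv_right)
  then obtain e where e: "card ?K = card ?L * e" ..
  have c3: "card (rcosets\<^bsub>H\<^esub> (h ` T)) * card (h ` T) = order H" using H.lagrange sT by simp
  have c4: "card (rcosets\<^bsub>G\<^esub> T) * p ^ n = order G" using G.lagrange T' n by metis
  have "card (rcosets\<^bsub>G\<^esub> T) * p ^ n = (e * card (rcosets\<^bsub>H\<^esub> (h ` T))) * p ^ n"
  proof -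
    have "card (rcosets\<^bsub>G\<^esub> T) * p ^ n = (card ?L * e) * (card (rcosets\<^bsub>H\<^esub> (h ` T)) * card (h ` T))"
      using c2 c3 c4 e by simp
    also have "\<dots> = (e * card (rcosets\<^bsub>H\<^esub> (h ` T))) * (card ?L * card (h ` T))" by (simp only: ac_simps)
    finally show ?thesis using c1 by simp
  qed
  then have "card (rcosets\<^bsub>G\<^esub> T) = e * card (rcosets\<^bsub>H\<^esub> (h ` T))" using p by auto
  then have "\<not> p dvd card (rcosets\<^bsub>H\<^esub> (h ` T))" using T' by auto
  moreover have "\<exists>m. card (h ` T) = p ^ m" using c1 p by (metis divides_primepow_nat dvd_triv_right)
  ultimately show ?thesis using sylow_subgroup_iff_index[OF H.is_group fH p] sT by auto
qed

text \<open>\<open>p_core\<close> is a \<open>GREATEST\<close>, about which nothing is known until a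
  greatest normal \<open>p\<close>-subgroup is exhibited. It is the intersection \<open>?O\<close>
  of the conjugates of \<open>T\<close>: by Sylow's theorem a normal \<open>p\<close>-subgroup has a
  conjugate inside \<open>T\<close>, and by normality all its conjugates then lie there.\<close>

lemma p_core_normal:
  fixes G (structure)
  assumes G: "group G" "finite (carrier G)" and p: "Factorial_Ring.prime p" and T: "sylow_subgroup p T G"
  shows "p_core p G \<lhd> G" "p_core p G \<subseteq> T" 
proof -
  interpret group G by fact
  have T': "subgroup T G" "\<exists>n. card T = p ^ n"
    using T sylow_subgroup_iff_index[OF G p] by auto
  let ?O = "{x \<in> carrier G. \<forall>g\<in>carrier G. g \<otimes> x \<otimes> inv g \<in> T}"
  have "subgroup ?O G"
  proof (rule subgroupI)
    show "?O \<noteq> {}" using T' by (auto simp: subgroup.one_closed intro!: exI[of _ \<one>])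
    fix a assume a: "a \<in> ?O"
    show "inv a \<in> ?O"
    proof (intro CollectI conjI ballI)
      fix g assume g: "g \<in> carrier G"
      have "inv (g \<otimes> a \<otimes> inv g) \<in> T" using a g T' by (simp add: subgroup.m_inv_closed)
      then show "g \<otimes> inv a \<otimes> inv g \<in> T" using a g by (simp add: inv_mult_group m_assoc)
    qed (use a in auto)
    fix b assume b: "b \<in> ?O"
    show "a \<otimes> b \<in> ?O"
    proof (intro CollectI conjI ballI)
      fix g assume g: "g \<in> carrier G"
      have "(g \<otimes> a \<otimes> inv g) \<otimes> (g \<otimes> b \<otimes> inv g) \<in> T"
        using a b g T' by (simp add: subgroup.m_closed)
      also have "(g \<otimes> a \<otimes> inv g) \<otimes> (g \<otimes> b \<otimes> inv g) = g \<otimes> (a \<otimes> b) \<otimes> inv g"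
        using a b g by (simp add: m_assoc inv_solve_left')
      finally show "g \<otimes> (a \<otimes> b) \<otimes> inv g \<in> T" .
    qed (use a b in auto)
  qed auto
  then have N: "?O \<lhd> G"
  proof (rule normal_invI)
    fix x h assume x: "x \<in> carrier G" and h: "h \<in> ?O"
    show "x \<otimes> h \<otimes> inv x \<in> ?O"
    proof (intro CollectI conjI ballI)
      fix g assume g: "g \<in> carrier G"
      have "(g \<otimes> x) \<otimes> h \<otimes> inv (g \<otimes> x) \<in> T" using x g h by auto
      then show "g \<otimes> (x \<otimes> h \<otimes> inv x) \<otimes> inv g \<in> T" using x g h by (simp add: m_assoc inv_mult_group)
    qed (use x h in auto)
  qed
  have OT: "?O \<subseteq> T" using T' by (auto dest: bspec[of _ _ \<one>])
  obtain n where n: "card ?O = p ^ n"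
    using p_subgroup_card[OF G p \<open>subgroup ?O G\<close> T'(1) OT] T' by blast
  have "p_core p G = ?O"
    unfolding p_core_def
  proof (rule Greatest_equality)
    show "?O \<lhd> G \<and> (\<exists>n. card ?O = p ^ n)" using N n by auto
    fix M assume M: "M \<lhd> G \<and> (\<exists>n. card M = p ^ n)"
    then have sM: "subgroup M G" by (simp add: normal_imp_subgroup)
    obtain k where k: "card M = p ^ k" using M by auto
    obtain a where a: "a \<in> carrier G" "\<forall>h\<in>M. a \<otimes> h \<otimes> inv a \<in> T" using sylow_conj[OF G p T sM k] by auto
    show "M \<subseteq> ?O"
    proof (intro subsetI CollectI conjI ballI)
      fix x assume x: "x \<in> M"
      show xG: "x \<in> carrier G" using x sM by (simp add: subgroup.mem_carrier)
      fix g assume g: "g \<in> carrier G"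
      \<comment> \<open>The element is chosen so that conjugation by \<open>a\<close>, which carries
        \<open>M\<close> into \<open>T\<close>, completes it to conjugation by
        \<open>g\<close>.\<close>
      have "(inv a \<otimes> g) \<otimes> x \<otimes> inv (inv a \<otimes> g) \<in> M" using M x a g by (simp add: normal.inv_op_closed2)
      then have "a \<otimes> ((inv a \<otimes> g) \<otimes> x \<otimes> inv (inv a \<otimes> g)) \<otimes> inv a \<in> T" using a by blast
      then show "g \<otimes> x \<otimes> inv g \<in> T" using a g xG by (simp add: m_assoc inv_mult_group flip: m_assoc[of a "inv a"])
    qed
  qed
  then show "p_core p G \<lhd> G" "p_core p G \<subseteq> T" using N OT by auto
qed

section \<open>Conjugation as a right action, normalisers and products of subgroups\<close>

definition conj_by :: "('a, 'b) monoid_scheme \<Rightarrow> 'a \<Rightarrow> 'a \<Rightarrow> 'a" where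
  "conj_by G g x = inv\<^bsub>G\<^esub> g \<otimes>\<^bsub>G\<^esub> x \<otimes>\<^bsub>G\<^esub> g"

context group
begin

abbreviation "cj \<equiv> conj_by G"

lemma cj_closed [simp]: "g \<in> carrier G \<Longrightarrow> x \<in> carrier G \<Longrightarrow> cj g x \<in> carrier G"
  by (simp add: conj_by_def)

lemma cj_mult: "g \<in> carrier G \<Longrightarrow> x \<in> carrier G \<Longrightarrow> y \<in> carrier G \<Longrightarrow>
    cj g (x \<otimes> y) = cj g x \<otimes> cj g y"
  by (simp add: conj_by_def m_assoc flip: m_assoc[of g "inv g"])

lemma cj_inv: "g \<in> carrier G \<Longrightarrow> x \<in> carrier G \<Longrightarrow> cj g (inv x) = inv (cj g x)"
  by (simp add: conj_by_def m_assoc inv_mult_group)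

lemma cj_cj: "g \<in> carrier G \<Longrightarrow> h \<in> carrier G \<Longrightarrow> x \<in> carrier G \<Longrightarrow> cj h (cj g x) = cj (g \<otimes> h) x"
  by (simp add: conj_by_def m_assoc inv_mult_group)

lemma cj_one [simp]: "x \<in> carrier G \<Longrightarrow> cj \<one> x = x"
  by (simp add: conj_by_def)

lemma cj_inv_cj [simp]: "g \<in> carrier G \<Longrightarrow> x \<in> carrier G \<Longrightarrow> cj (inv g) (cj g x) = x"
  "g \<in> carrier G \<Longrightarrow> x \<in> carrier G \<Longrightarrow> cj g (cj (inv g) x) = x"
  by (simp_all add: cj_cj)

lemma cj_inj: "g \<in> carrier G \<Longrightarrow> inj_on (cj g) (carrier G)"
  by (rule inj_on_inverseI[where g = "cj (inv g)"]) simp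

lemma conj_image_subgroup:
  assumes H: "subgroup H G" and g: "g \<in> carrier G"
  shows "subgroup (cj g ` H) G" "card (cj g ` H) = card H"
proof -
  have "group_hom G G (cj g)"
    using g by (unfold_locales) (auto simp: hom_def cj_mult)
  then show "subgroup (cj g ` H) G" using H by (rule group_hom.subgroup_img_is_subgroup)
  show "card (cj g ` H) = card H"
    using card_image inj_on_subset[OF cj_inj[OF g] subgroup.subset[OF H]] by blast
qed

lemma cj_eq_self_iff: "g \<in> carrier G \<Longrightarrow> x \<in> carrier G \<Longrightarrow> cj g x = x \<longleftrightarrow> x \<otimes> g = g \<otimes> x"
  by (auto simp: conj_by_def m_assoc inv_solve_left')

text \<open>\<open>normalizer\<close> uses the opposite convention
  \<open>g \<otimes> x \<otimes> inv g\<close> and demands equality of sets. For finite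
  \<open>Q\<close> the mere inclusion under \<open>cj g\<close> is already an equality, and this
  also allows passing to \<open>inv g\<close>.\<close>

lemma normalizer_iff:
  assumes Q: "Q \<subseteq> carrier G" "finite Q"
  shows "g \<in> normalizer G Q \<longleftrightarrow> g \<in> carrier G \<and> (\<forall>x\<in>Q. cj g x \<in> Q)"
proof (cases "g \<in> carrier G")
  case g: True
  have im: "g <# Q #> inv g = cj (inv g) ` Q"
    using g by (auto simp: l_coset_def r_coset_def conj_by_def)
  have "cj (inv g) ` Q = Q \<longleftrightarrow> (\<forall>x\<in>Q. cj g x \<in> Q)"
  proof
    assume eq: "cj (inv g) ` Q = Q"
    show "\<forall>x\<in>Q. cj g x \<in> Q"
    proof
      fix x assume "x \<in> Q"
      then obtain y where "y \<in> Q" "x = cj (inv g) y" using eq by blast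
      then show "cj g x \<in> Q" using Q g by (simp add: subset_iff)
    qed
  next
    assume "\<forall>x\<in>Q. cj g x \<in> Q"
    then have "cj g ` Q = Q"
      using Q endo_inj_surj[of Q "cj g"] inj_on_subset[OF cj_inj[OF g] Q(1)] by blast
    then have "cj (inv g) ` Q = cj (inv g) ` cj g ` Q" by simp
    also have "\<dots> = (\<lambda>x. x) ` Q" unfolding image_image
      by (rule image_cong) (use Q g in auto)
    finally show "cj (inv g) ` Q = Q" by simp
  qed
  then show ?thesis using g Q im by (simp add: normalizer_def stabilizer_def)
qed (simp add: normalizer_def stabilizer_def)

lemma subgroup_set_mult:
  assumes R: "subgroup R G" and Q: "subgroup Q G"
    and nrm: "\<And>r q. r \<in> R \<Longrightarrow> q \<in> Q \<Longrightarrow> cj r q \<in> Q"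
  shows "subgroup (R <#> Q) G" "R \<subseteq> R <#> Q" "Q \<subseteq> R <#> Q"
proof -
  have RG: "R \<subseteq> carrier G" and QG: "Q \<subseteq> carrier G" using R Q subgroup.subset by auto
  show sR: "R \<subseteq> R <#> Q"
  proof
    fix r assume "r \<in> R"
    then have "r = r \<otimes> \<one>" using RG by auto
    then show "r \<in> R <#> Q" using \<open>r \<in> R\<close> subgroup.one_closed[OF Q] unfolding set_mult_def by blast
  qed
  show "Q \<subseteq> R <#> Q"
  proof
    fix q assume "q \<in> Q"
    then have "q = \<one> \<otimes> q" using QG by auto
    then show "q \<in> R <#> Q" using \<open>q \<in> Q\<close> subgroup.one_closed[OF R] unfolding set_mult_def by blast
  qed
  show "subgroup (R <#> Q) G"
  proof (rule subgroupI)
    show "R <#> Q \<subseteq> carrier G" using RG QG by (simp add: set_mult_closed)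
    show "R <#> Q \<noteq> {}" using sR subgroup.one_closed[OF R] by auto
    fix a assume "a \<in> R <#> Q"
    then obtain r q where a: "r \<in> R" "q \<in> Q" "a = r \<otimes> q" by (auto simp: set_mult_def)
    then have rq: "r \<in> carrier G" "q \<in> carrier G" using RG QG by auto
    have "inv a = inv r \<otimes> cj (inv r) (inv q)"
      using rq a by (simp add: conj_by_def inv_mult_group m_assoc flip: m_assoc[of "inv r" r])
    moreover have "cj (inv r) (inv q) \<in> Q" using a nrm R Q by (simp add: subgroup.m_inv_closed)
    ultimately show "inv a \<in> R <#> Q" using a R by (auto simp: set_mult_def subgroup.m_inv_closed)
    fix b assume "b \<in> R <#> Q"
    then obtain r' q' where b: "r' \<in> R" "q' \<in> Q" "b = r' \<otimes> q'" by (auto simp: set_mult_def)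
    then have rq': "r' \<in> carrier G" "q' \<in> carrier G" using RG QG by auto
    have "a \<otimes> b = (r \<otimes> r') \<otimes> (cj r' q \<otimes> q')"
      using a b rq rq' by (simp add: conj_by_def m_assoc flip: m_assoc[of r' "inv r'"])
    moreover have "r \<otimes> r' \<in> R" "cj r' q \<otimes> q' \<in> Q"
      using a b R Q nrm[OF b(1) a(2)] by (auto simp: subgroup.m_closed)
    ultimately show "a \<otimes> b \<in> R <#> Q" unfolding set_mult_def by blast
  qed
qed

lemma set_mult_subset:
  assumes "subgroup T G" "R \<subseteq> T" "Q \<subseteq> T" shows "R <#> Q \<subseteq> T"
  using assms by (auto simp: set_mult_def subgroup.m_closed subset_iff)

end

lemma inv_subgroup_eq:
  "group G \<Longrightarrow> subgroup S G \<Longrightarrow> x \<in> S \<Longrightarrow> inv\<^bsub>G\<lparr>carrier := S\<rparr>\<^esub> x = inv\<^bsub>G\<^esub> x"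
  by (simp add: group.m_inv_consistent)

lemma conj_by_subgroup:
  "group G \<Longrightarrow> subgroup S G \<Longrightarrow> g \<in> S \<Longrightarrow> conj_by (G\<lparr>carrier := S\<rparr>) g x = conj_by G g x"
  by (simp add: conj_by_def inv_subgroup_eq)

lemma normalizer_in_subgroup_iff:
  assumes "group G" "subgroup S G" "Q \<subseteq> S" "finite Q"
  shows "g \<in> normalizer (G\<lparr>carrier := S\<rparr>) Q \<longleftrightarrow> g \<in> S \<and> (\<forall>x\<in>Q. conj_by G g x \<in> Q)"
  using assms group.normalizer_iff[of "G\<lparr>carrier := S\<rparr>" Q g]
  by (auto simp: group.subgroup_imp_group conj_by_subgroup)


section \<open>Groups of bijections\<close>

abbreviation perm_group :: "'a set \<Rightarrow> ('a \<Rightarrow> 'a) set \<Rightarrow> ('a \<Rightarrow> 'a) monoid" where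
  "perm_group W C \<equiv> (BijGroup W)\<lparr>carrier := C\<rparr>"

lemma Bij_iff: "f \<in> Bij W \<longleftrightarrow> f \<in> extensional W \<and> inj_on f W \<and> f ` W = W"
  by (auto simp: Bij_def bij_betw_def)

lemma perm_mult: "f \<in> Bij W \<Longrightarrow> g \<in> Bij W \<Longrightarrow> f \<otimes>\<^bsub>BijGroup W\<^esub> g = compose W f g"
  by (simp add: BijGroup_def)

lemma perm_group_group: "subgroup C (BijGroup W) \<Longrightarrow> group (perm_group W C)"
  by (rule group.subgroup_imp_group[OF group_BijGroup])

lemma perm_carrier_Bij: "subgroup C (BijGroup W) \<Longrightarrow> f \<in> C \<Longrightarrow> f \<in> Bij W"
  using subgroup.mem_carrier by (fastforce simp: BijGroup_def)

lemma perm_inv: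
  assumes "subgroup C (BijGroup W)" "f \<in> C"
  shows "inv\<^bsub>perm_group W C\<^esub> f = restrict (inv_into W f) W"
  using assms perm_carrier_Bij[OF assms]
  by (simp add: inv_subgroup_eq[OF group_BijGroup] inv_BijGroup)

text \<open>Evaluating at \<open>t x\<close> rather than at \<open>x\<close> cancels the inverse of
  \<open>t\<close>, so conjugate automorphisms are computed without \<open>inv_into\<close>.\<close>

lemma perm_conj_apply:
  assumes C: "subgroup C (BijGroup W)" "t \<in> C" "u \<in> C" "x \<in> W"
  shows "(t \<otimes>\<^bsub>perm_group W C\<^esub> u \<otimes>\<^bsub>perm_group W C\<^esub> inv\<^bsub>perm_group W C\<^esub> t) (t x) = t (u x)"
proof -
  interpret group "perm_group W C" using C by (simp add: perm_group_group)
  have B: "t \<in> Bij W" "u \<in> Bij W" using C perm_carrier_Bij by auto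
  have "t \<otimes>\<^bsub>perm_group W C\<^esub> u \<in> C" "inv\<^bsub>perm_group W C\<^esub> t \<in> C" using C m_closed[of t u] inv_closed[of t] by auto
  then have B2: "t \<otimes>\<^bsub>perm_group W C\<^esub> u \<in> Bij W" "inv\<^bsub>perm_group W C\<^esub> t \<in> Bij W" using C perm_carrier_Bij by auto
  have tx: "t x \<in> W" "inv_into W t (t x) = x" using B C by (auto simp: Bij_iff)
  show ?thesis
    using B B2 tx C by (simp add: perm_mult perm_inv[OF C(1)] compose_def)
qed

lemma perm_subgroupI:
  assumes "C \<subseteq> Bij W" "(\<lambda>x\<in>W. x) \<in> C"
    "\<And>f g. f \<in> C \<Longrightarrow> g \<in> C \<Longrightarrow> compose W f g \<in> C"
    "\<And>f. f \<in> C \<Longrightarrow> restrict (inv_into W f) W \<in> C"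
  shows "subgroup C (BijGroup W)"
proof (rule group.subgroupI[OF group_BijGroup])
  show "C \<subseteq> carrier (BijGroup W)" using assms(1) by (simp add: BijGroup_def)
  show "C \<noteq> {}" using assms(2) by auto
  fix a assume a: "a \<in> C"
  then show "inv\<^bsub>BijGroup W\<^esub> a \<in> C" using assms by (simp add: inv_BijGroup subset_iff)
  fix b assume "b \<in> C"
  then show "a \<otimes>\<^bsub>BijGroup W\<^esub> b \<in> C" using assms a by (simp add: BijGroup_def subset_iff)
qed

section \<open>Saturated fusion systems\<close>

locale saturated_fusion =
  fixes p :: nat and P :: "'a monoid" (structure) and F :: "'a fusion"
  assumes prime: "Factorial_Ring.prime p" and sat: "saturated_fusion_system p P F"
begin

sublocale group P
  using sat by (simp add: saturated_fusion_system_def finite_p_group_def)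

abbreviation "sub Q \<equiv> subgroup Q P"

lemma grp_F [simp]: "grp F = P"
  using sat by (simp add: saturated_fusion_system_def)

lemma order_P: "\<exists>n. order P = p ^ n"
  using sat by (simp add: saturated_fusion_system_def finite_p_group_def)

lemma finite_P [simp]: "finite (carrier P)"
  using order_P prime order_gt_0_iff_finite by (metis prime_gt_0_nat zero_less_power)

lemma sub_carrier: "sub Q \<Longrightarrow> x \<in> Q \<Longrightarrow> x \<in> carrier P"
  by (rule subgroup.mem_carrier)

lemma sub_finite: "sub Q \<Longrightarrow> finite Q"
  using finite_P subgroup.subset finite_subset by metis

lemma sub_card: "sub Q \<Longrightarrow> \<exists>n. card Q = p ^ n"
  using p_subgroup_card[OF is_group finite_P prime _ subgroup_self subgroup.subset] order_P
  unfolding order_def by blast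

lemma normalizer_iff':
  "sub Q \<Longrightarrow> g \<in> normalizer P Q \<longleftrightarrow> g \<in> carrier P \<and> (\<forall>x\<in>Q. cj g x \<in> Q)"
  by (rule normalizer_iff) (auto simp: sub_finite subgroup.subset)

lemma normalizer_sub: "sub Q \<Longrightarrow> sub (normalizer P Q)"
  using normalizer_imp_subgroup subgroup.subset by blast

lemma sub_cj: "sub Q \<Longrightarrow> g \<in> Q \<Longrightarrow> x \<in> Q \<Longrightarrow> cj g x \<in> Q"
  by (simp add: conj_by_def subgroup.m_closed subgroup.m_inv_closed)

lemma sub_normalizer: "sub Q \<Longrightarrow> Q \<subseteq> normalizer P Q"
  using normalizer_iff' sub_cj sub_carrier by auto

text \<open>A member of largest cardinality absorbs every other one, since their product is again a
  member. Both \<open>fusion_core\<close> and \<open>dstar\<close> arise as such greatest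
  members.\<close>

lemma greatest_product_closed:
  assumes sub: "\<And>A. \<Phi> A \<Longrightarrow> sub A" and ne: "\<Phi> A\<^sub>0"
    and mult: "\<And>A B. \<Phi> A \<Longrightarrow> \<Phi> B \<Longrightarrow> \<Phi> (A <#> B) \<and> A \<subseteq> A <#> B \<and> B \<subseteq> A <#> B"
  obtains M where "\<Phi> M" "\<And>A. \<Phi> A \<Longrightarrow> A \<subseteq> M"
proof -
  have fin: "finite (Collect \<Phi>)"
    by (rule finite_subset[of _ "Pow (carrier P)"]) (auto dest: sub simp: sub_carrier)
  have "Max (card ` Collect \<Phi>) \<in> card ` Collect \<Phi>"
    using fin ne by (intro Max_in) auto
  then obtain M where M: "\<Phi> M" "card M = Max (card ` Collect \<Phi>)" by auto
  have "A \<subseteq> M" if "\<Phi> A" for A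
  proof -
    have m: "\<Phi> (A <#> M)" "A \<subseteq> A <#> M" "M \<subseteq> A <#> M" using mult[OF that M(1)] by auto
    then have "card (A <#> M) \<le> card M" using M(2) fin by simp
    then have "M = A <#> M" using card_seteq[OF sub_finite[OF sub[OF m(1)]] m(3)] by blast
    then show ?thesis using m(2) by blast
  qed
  then show thesis using that M(1) by blast
qed

lemma cj_onto:
  assumes "g \<in> carrier P" "Q \<subseteq> carrier P" "finite Q" "\<forall>x\<in>Q. cj g x \<in> Q"
  shows "cj g ` Q = Q"
  using assms endo_inj_surj[of Q "cj g"] inj_on_subset[OF cj_inj, of g Q] by blast

section \<open>Elementary properties of morphisms\<close>

lemma fusion_category_F: "fusion_category F" and saturated_F: "saturated p F"
  using sat by (auto simp: saturated_fusion_system_def)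

lemma mor_sub: "\<phi> \<in> mor F Q R \<Longrightarrow> sub Q \<and> sub R"
  using fusion_category_F unfolding fusion_category_def by (metis empty_iff grp_F)

lemma mor_conj: "sub Q \<Longrightarrow> sub R \<Longrightarrow> \<phi> \<in> conj_hom P Q R \<Longrightarrow> \<phi> \<in> mor F Q R"
  using fusion_category_F unfolding fusion_category_def grp_F by blast

lemma mor_props: "\<phi> \<in> mor F Q R \<Longrightarrow> \<phi> \<in> extensional Q \<and> inj_on \<phi> Q \<and>
    \<phi> \<in> hom (P\<lparr>carrier := Q\<rparr>) (P\<lparr>carrier := R\<rparr>)"
  using fusion_category_F unfolding fusion_category_def grp_F by blast

lemma mor_comp: "\<phi> \<in> mor F Q R \<Longrightarrow> \<psi> \<in> mor F R T \<Longrightarrow> compose Q \<psi> \<phi> \<in> mor F Q T"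
  using fusion_category_F unfolding fusion_category_def by blast

lemma mor_image: "\<phi> \<in> mor F Q R \<Longrightarrow>
    \<phi> \<in> mor F Q (\<phi> ` Q) \<and> restrict (inv_into Q \<phi>) (\<phi> ` Q) \<in> mor F (\<phi> ` Q) Q"
  using fusion_category_F unfolding fusion_category_def by blast

text \<open>Working with arbitrary functions that agree with a morphism on the domain avoids
  carrying the restrictions around.\<close>

definition fmap :: "'a set \<Rightarrow> ('a \<Rightarrow> 'a) \<Rightarrow> bool" where
  "fmap Q f \<longleftrightarrow> restrict f Q \<in> mor F Q (carrier P)"

lemma fmap_cong: "fmap Q f \<Longrightarrow> (\<And>x. x \<in> Q \<Longrightarrow> f x = g x) \<Longrightarrow> fmap Q g"
  unfolding fmap_def by (metis restrict_ext)

lemma fmap_sub: "fmap Q f \<Longrightarrow> sub Q"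
  unfolding fmap_def using mor_sub by blast

lemma fmap_inj: "fmap Q f \<Longrightarrow> inj_on f Q"
  unfolding fmap_def using mor_props by fastforce

lemma fmap_hom: "fmap Q f \<Longrightarrow> group_hom (P\<lparr>carrier := Q\<rparr>) P f"
proof -
  assume f: "fmap Q f"
  then have "restrict f Q \<in> hom (P\<lparr>carrier := Q\<rparr>) P" using mor_props unfolding fmap_def by fastforce
  then have "f \<in> hom (P\<lparr>carrier := Q\<rparr>) P"
    using fmap_sub[OF f] by (auto simp: hom_def Pi_def subgroup.m_closed)
  then show ?thesis
    unfolding group_hom_def group_hom_axioms_def using fmap_sub[OF f] by (simp add: subgroup_imp_group)
qed

lemma fmap_closed: "fmap Q f \<Longrightarrow> x \<in> Q \<Longrightarrow> f x \<in> carrier P"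
  using group_hom.hom_closed[OF fmap_hom] by simp

lemma fmap_mult: "fmap Q f \<Longrightarrow> x \<in> Q \<Longrightarrow> y \<in> Q \<Longrightarrow> f (x \<otimes> y) = f x \<otimes> f y"
  using group_hom.hom_mult[OF fmap_hom, of Q f x y] by simp

lemma fmap_inv: "fmap Q f \<Longrightarrow> x \<in> Q \<Longrightarrow> f (inv x) = inv (f x)"
  using group_hom.hom_inv[OF fmap_hom, of Q f x] inv_subgroup_eq[OF is_group fmap_sub, of Q f x] by simp

lemma fmap_cj: "fmap Q f \<Longrightarrow> x \<in> Q \<Longrightarrow> y \<in> Q \<Longrightarrow> f (cj x y) = cj (f x) (f y)"
  using fmap_sub[of Q f]
  by (simp add: conj_by_def fmap_mult fmap_inv subgroup.m_closed subgroup.m_inv_closed)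

lemma fmap_image_sub:
  assumes f: "fmap Q f" and R: "sub R" "R \<subseteq> Q"
  shows "sub (f ` R)"
proof -
  have "subgroup R (P\<lparr>carrier := Q\<rparr>)" using R fmap_sub[OF f] by (simp add: subgroup_incl)
  then show ?thesis by (rule group_hom.subgroup_img_is_subgroup[OF fmap_hom[OF f]])
qed

lemma fmap_card: "fmap Q f \<Longrightarrow> R \<subseteq> Q \<Longrightarrow> card (f ` R) = card R"
  using fmap_inj by (metis card_image inj_on_subset)

lemma incl_mor: "sub Q \<Longrightarrow> sub R \<Longrightarrow> Q \<subseteq> R \<Longrightarrow> (\<lambda>x\<in>Q. x) \<in> mor F Q R"
proof (rule mor_conj)
  assume *: "sub Q" "sub R" "Q \<subseteq> R"
  have "(\<lambda>x\<in>Q. x) = (\<lambda>x\<in>Q. inv \<one> \<otimes> x \<otimes> \<one>)"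
    using * by (auto simp: fun_eq_iff sub_carrier)
  then show "(\<lambda>x\<in>Q. x) \<in> conj_hom P Q R" using * unfolding conj_hom_def
    by (intro CollectI conjI bexI[of _ \<one>]) (auto simp: sub_carrier subset_iff)
qed auto

text \<open>Composing with inclusions enlarges the codomain, and the axiom on images shrinks it to
  the image. So the codomain matters only through an inclusion of sets, and proofs can work with
  \<open>fmap\<close>.\<close>

lemma mor_iff: "\<phi> \<in> mor F Q R \<longleftrightarrow> sub R \<and> \<phi> \<in> extensional Q \<and> fmap Q \<phi> \<and> \<phi> ` Q \<subseteq> R"
proof
  assume \<phi>: "\<phi> \<in> mor F Q R"
  then have s: "sub Q" "sub R" "\<phi> \<in> extensional Q" using mor_sub mor_props by auto
  have im: "\<phi> ` Q \<subseteq> R" using mor_props[OF \<phi>] by (auto simp: hom_def)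
  have "compose Q (\<lambda>x\<in>R. x) \<phi> \<in> mor F Q (carrier P)"
    using mor_comp[OF \<phi>] incl_mor[OF s(2) subgroup_self] s subgroup.subset by blast
  moreover have "compose Q (\<lambda>x\<in>R. x) \<phi> = restrict \<phi> Q"
    using im by (auto simp: compose_def fun_eq_iff)
  ultimately show "sub R \<and> \<phi> \<in> extensional Q \<and> fmap Q \<phi> \<and> \<phi> ` Q \<subseteq> R"
    using s im by (simp add: fmap_def)
next
  assume *: "sub R \<and> \<phi> \<in> extensional Q \<and> fmap Q \<phi> \<and> \<phi> ` Q \<subseteq> R"
  then have "restrict \<phi> Q = \<phi>" by (simp add: extensional_restrict)
  then have 1: "\<phi> \<in> mor F Q (\<phi> ` Q)" using * mor_image[of \<phi> Q "carrier P"] by (simp add: fmap_def)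
  have "compose Q (\<lambda>x\<in>\<phi> ` Q. x) \<phi> \<in> mor F Q R"
    using mor_comp[OF 1 incl_mor] mor_sub[OF 1] * by blast
  moreover have "compose Q (\<lambda>x\<in>\<phi> ` Q. x) \<phi> = restrict \<phi> Q"
    by (auto simp: compose_def fun_eq_iff)
  ultimately show "\<phi> \<in> mor F Q R" using \<open>restrict \<phi> Q = \<phi>\<close> by simp
qed

lemma restrict_mor_iff: "restrict f Q \<in> mor F Q R \<longleftrightarrow> sub R \<and> fmap Q f \<and> f ` Q \<subseteq> R"
  unfolding mor_iff using fmap_cong[of Q f "restrict f Q"] fmap_cong[of Q "restrict f Q" f] by auto

lemma fmap_id: "sub Q \<Longrightarrow> fmap Q (\<lambda>x. x)"
  unfolding fmap_def using incl_mor[OF _ subgroup_self] subgroup.subset by blast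

lemma fmap_conj: "sub Q \<Longrightarrow> g \<in> carrier P \<Longrightarrow> fmap Q (cj g)"
  unfolding fmap_def
  by (rule mor_conj) (auto simp: conj_hom_def subgroup_self conj_by_def fun_eq_iff sub_carrier)

lemma fmap_comp:
  assumes "fmap Q f" "fmap R g" "f ` Q \<subseteq> R" shows "fmap Q (\<lambda>x. g (f x))"
proof -
  have "restrict f Q \<in> mor F Q R" using assms fmap_sub by (simp add: restrict_mor_iff)
  then have "compose Q (restrict g R) (restrict f Q) \<in> mor F Q (carrier P)"
    using assms mor_comp unfolding fmap_def by blast
  moreover have "compose Q (restrict g R) (restrict f Q) = restrict (\<lambda>x. g (f x)) Q"
    using assms by (auto simp: compose_def fun_eq_iff)
  ultimately show ?thesis by (simp add: fmap_def)
qed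

lemma fmap_subset: "fmap Q f \<Longrightarrow> sub R \<Longrightarrow> R \<subseteq> Q \<Longrightarrow> fmap R f"
  using fmap_comp[OF fmap_id, of R Q f] by auto

lemma fmap_inv_into:
  assumes f: "fmap Q f" shows "fmap (f ` Q) (inv_into Q f)"
proof -
  have "restrict (inv_into Q (restrict f Q)) (restrict f Q ` Q) \<in> mor F (restrict f Q ` Q) Q"
    using mor_image f unfolding fmap_def by blast
  moreover have "restrict f Q ` Q = f ` Q" by auto
  ultimately have "restrict (inv_into Q (restrict f Q)) (f ` Q) \<in> mor F (f ` Q) Q" by simp
  then have "fmap (f ` Q) (inv_into Q (restrict f Q))" by (simp add: restrict_mor_iff)
  then show ?thesis
  proof (rule fmap_cong)
    fix x assume "x \<in> f ` Q"
    then obtain y where y: "y \<in> Q" "x = f y" by auto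
    have "inj_on (restrict f Q) Q" using fmap_inj[OF f] by (simp add: inj_on_def)
    then have "inv_into Q (restrict f Q) (restrict f Q y) = y" using y by (simp only: inv_into_f_f)
    then show "inv_into Q (restrict f Q) x = inv_into Q f x" using y fmap_inj[OF f] by simp
  qed
qed

lemma fmap_inv_into_f: "fmap Q f \<Longrightarrow> x \<in> Q \<Longrightarrow> inv_into Q f (f x) = x"
  using fmap_inj by simp

lemma fmap_image_eq: "fmap Q f \<Longrightarrow> R \<subseteq> Q \<Longrightarrow> f ` R \<subseteq> R \<Longrightarrow> sub R \<Longrightarrow> f ` R = R"
  using fmap_card[of Q f R] by (meson card_subset_eq sub_finite)

section \<open>Fully normalised conjugates and the extension axiom\<close>

lemma all_mor_image_iff: "(\<forall>R. \<forall>\<phi>\<in>mor F Q R. \<Phi> (\<phi> ` Q)) \<longleftrightarrow> (\<forall>f. fmap Q f \<longrightarrow> \<Phi> (f ` Q))"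
proof (intro iffI allI impI ballI)
  fix f assume "\<forall>R. \<forall>\<phi>\<in>mor F Q R. \<Phi> (\<phi> ` Q)" "fmap Q f"
  then have "\<Phi> (restrict f Q ` Q)" unfolding fmap_def by blast
  then show "\<Phi> (f ` Q)" by simp
qed (simp add: mor_iff)

lemma fully_normalised_iff: "fully_normalised F Q \<longleftrightarrow>
    sub Q \<and> (\<forall>f. fmap Q f \<longrightarrow> card (normalizer P (f ` Q)) \<le> card (normalizer P Q))"
  unfolding fully_normalised_def grp_F
    all_mor_image_iff[where \<Phi> = "\<lambda>T. card (normalizer P T) \<le> card (normalizer P Q)"] ..

lemma fully_centralised_iff: "fully_centralised F Q \<longleftrightarrow>
    sub Q \<and> (\<forall>f. fmap Q f \<longrightarrow> card (centraliser P (f ` Q)) \<le> card (centraliser P Q))"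
  unfolding fully_centralised_def grp_F
    all_mor_image_iff[where \<Phi> = "\<lambda>T. card (centraliser P T) \<le> card (centraliser P Q)"] ..

lemma fully_centralised_if_normalised: "fully_normalised F Q \<Longrightarrow> fully_centralised F Q"
  and sylow_if_fully_normalised:
    "fully_normalised F Q \<Longrightarrow> sylow_subgroup p (conj_hom P Q Q) (fusion_aut F Q)"
  using saturated_F unfolding saturated_def grp_F by blast+

lemma obtain_fully_normalised:
  assumes Q: "sub Q"
  obtains f where "fmap Q f" "fully_normalised F (f ` Q)"
proof -
  let ?S = "{n. \<exists>f. fmap Q f \<and> n = card (normalizer P (f ` Q))}"
  have fin: "finite ?S"
  proof (rule finite_subset)
    show "?S \<subseteq> {..card (carrier P)}"
    proof
      fix n assume "n \<in> ?S"
      then obtain f where "fmap Q f" and n: "n = card (normalizer P (f ` Q))" by blast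
      then have "normalizer P (f ` Q) \<subseteq> carrier P"
        using fmap_image_sub[OF _ Q] normalizer_sub subgroup.subset by blast
      then show "n \<in> {..card (carrier P)}" using n by (simp add: card_mono)
    qed
  qed simp
  have "?S \<noteq> {}" using fmap_id[OF Q] by auto
  then have "Max ?S \<in> ?S" using fin by (rule Max_in[rotated])
  then obtain f where f: "fmap Q f" "card (normalizer P (f ` Q)) = Max ?S" by auto
  have "fully_normalised F (f ` Q)"
    unfolding fully_normalised_iff
  proof (intro conjI allI impI)
    show "sub (f ` Q)" using fmap_image_sub[OF f(1) Q] by simp
    fix g assume "fmap (f ` Q) g"
    then have "fmap Q (\<lambda>x. g (f x))" using f fmap_comp by blast
    then have "card (normalizer P ((\<lambda>x. g (f x)) ` Q)) \<le> Max ?S" using fin by (intro Max_ge) auto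
    then show "card (normalizer P (g ` f ` Q)) \<le> card (normalizer P (f ` Q))"
      using f by (simp add: image_image)
  qed
  then show thesis using f that by blast
qed

text \<open>This is \<open>extension_domain\<close> with the inverse of \<open>f\<close> eliminated
  by evaluating at the points \<open>f x\<close>. That \<open>h\<close> then preserves the image of
  \<open>f\<close> is automatic, because \<open>g\<close> normalises \<open>Q\<close>.\<close>

definition ext_dom :: "'a set \<Rightarrow> ('a \<Rightarrow> 'a) \<Rightarrow> 'a set" where
  "ext_dom Q f = {g \<in> normalizer P Q. \<exists>h\<in>carrier P. \<forall>x\<in>Q. f (cj g x) = cj h (f x)}"

lemma subset_ext_dom: "fmap Q f \<Longrightarrow> Q \<subseteq> ext_dom Q f"
  unfolding ext_dom_def using fmap_cj fmap_closed sub_normalizer fmap_sub by blast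

lemma extend_to_ext_dom:
  assumes f: "fmap Q f" and c: "fully_centralised F (f ` Q)"
  obtains f' where "fmap (ext_dom Q f) f'" "\<And>x. x \<in> Q \<Longrightarrow> f' x = f x"
proof -
  let ?N = "ext_dom Q f"
  let ?r = "restrict f Q"
  have Q: "sub Q" using fmap_sub f .
  have "extension_domain P Q ?r = ?N"
    unfolding extension_domain_def ext_dom_def
  proof (rule Collect_cong, rule conj_cong[OF refl])
    fix g assume g: "g \<in> normalizer P Q"
    have cl: "cj g x \<in> Q" if "x \<in> Q" for x using g that normalizer_iff'[OF Q] by auto
    have iv: "inv_into Q ?r (f x) = x" if "x \<in> Q" for x
    proof -
      have "inj_on ?r Q" using fmap_inj[OF f] by (simp add: inj_on_def)
      then have "inv_into Q ?r (?r x) = x" using that by (rule inv_into_f_f)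
      then show ?thesis using that by simp
    qed
    have im: "?r ` Q = f ` Q" by auto
    have ev: "(\<lambda>y\<in>f ` Q. ?r (inv g \<otimes> inv_into Q ?r y \<otimes> g)) (f x) = f (cj g x)" if "x \<in> Q" for x
      using that iv cl by (simp add: conj_by_def)
    show "(\<lambda>y\<in>?r ` Q. ?r (inv g \<otimes> inv_into Q ?r y \<otimes> g)) \<in> conj_hom P (?r ` Q) (?r ` Q) \<longleftrightarrow>
        (\<exists>h\<in>carrier P. \<forall>x\<in>Q. f (cj g x) = cj h (f x))"
      unfolding im
    proof
      assume "(\<lambda>y\<in>f ` Q. ?r (inv g \<otimes> inv_into Q ?r y \<otimes> g)) \<in> conj_hom P (f ` Q) (f ` Q)"
      then obtain h where h: "h \<in> carrier P"
        "(\<lambda>y\<in>f ` Q. ?r (inv g \<otimes> inv_into Q ?r y \<otimes> g)) = (\<lambda>y\<in>f ` Q. inv h \<otimes> y \<otimes> h)"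
        by (auto simp: conj_hom_def)
      have "f (cj g x) = cj h (f x)" if x: "x \<in> Q" for x
        using ev[OF x] x unfolding h(2) by (simp add: conj_by_def)
      then show "\<exists>h\<in>carrier P. \<forall>x\<in>Q. f (cj g x) = cj h (f x)" using h by auto
    next
      assume "\<exists>h\<in>carrier P. \<forall>x\<in>Q. f (cj g x) = cj h (f x)"
      then obtain h where h: "h \<in> carrier P" "\<forall>x\<in>Q. f (cj g x) = cj h (f x)" by auto
      have eq: "(\<lambda>y\<in>f ` Q. ?r (inv g \<otimes> inv_into Q ?r y \<otimes> g)) = (\<lambda>y\<in>f ` Q. inv h \<otimes> y \<otimes> h)"
      proof (rule ext)
        fix y show "(\<lambda>y\<in>f ` Q. ?r (inv g \<otimes> inv_into Q ?r y \<otimes> g)) y = (\<lambda>y\<in>f ` Q. inv h \<otimes> y \<otimes> h) y"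
        proof (cases "y \<in> f ` Q")
          case True
          then obtain x where x: "x \<in> Q" "y = f x" by auto
          show ?thesis using ev[OF x(1)] h x by (simp add: conj_by_def)
        qed simp
      qed
      have "(\<lambda>y\<in>f ` Q. ?r (inv g \<otimes> inv_into Q ?r y \<otimes> g)) ` (f ` Q) \<subseteq> f ` Q"
      proof clarify
        fix x assume "x \<in> Q"
        then show "(\<lambda>y\<in>f ` Q. ?r (inv g \<otimes> inv_into Q ?r y \<otimes> g)) (f x) \<in> f ` Q"
          unfolding ev[OF \<open>x \<in> Q\<close>] using cl by blast
      qed
      then show "(\<lambda>y\<in>f ` Q. ?r (inv g \<otimes> inv_into Q ?r y \<otimes> g)) \<in> conj_hom P (f ` Q) (f ` Q)"
        unfolding eq conj_hom_def using h by blast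
    qed
  qed
  moreover have "\<exists>\<psi>\<in>mor F (extension_domain P Q ?r) (carrier P). restrict \<psi> Q = ?r"
    using saturated_F f c unfolding saturated_def fmap_def grp_F by auto
  ultimately obtain \<psi> where \<psi>: "\<psi> \<in> mor F ?N (carrier P)" "restrict \<psi> Q = ?r" by auto
  show thesis
  proof (rule that)
    show "fmap ?N \<psi>" using \<psi> by (simp add: mor_iff)
    show "\<psi> x = f x" if "x \<in> Q" for x using that \<psi>(2) by (metis restrict_apply')
  qed
qed

section \<open>Automorphism groups and their transport to fully normalised conjugates\<close>

lemma mor_self_Bij: "\<phi> \<in> mor F W W \<Longrightarrow> \<phi> \<in> Bij W"
  unfolding Bij_iff mor_iff using fmap_inj fmap_image_eq[of W \<phi> W] by blast

text \<open>If \<open>R\<close> is fully normalised and \<open>W\<close> lies between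
  \<open>R\<close> and its normaliser, this set is the automorphism group of \<open>W\<close> in the
  normaliser system of \<open>R\<close>; see \<open>mor_E_self\<close>. The case
  \<open>R = W\<close> gives \<open>aut_subgroup\<close>.\<close>

lemma stabiliser_subgroup:
  assumes W: "sub W" and R: "sub R" "R \<subseteq> W"
  shows "subgroup {\<phi> \<in> mor F W W. \<phi> ` R = R} (BijGroup W)"
proof (rule perm_subgroupI)
  show "{\<phi> \<in> mor F W W. \<phi> ` R = R} \<subseteq> Bij W" using mor_self_Bij by blast
  have "(\<lambda>x\<in>W. x) ` R = R" using R by force
  then show "(\<lambda>x\<in>W. x) \<in> {\<phi> \<in> mor F W W. \<phi> ` R = R}" using incl_mor W by simp
next
  fix f g assume f: "f \<in> {\<phi> \<in> mor F W W. \<phi> ` R = R}" and g: "g \<in> {\<phi> \<in> mor F W W. \<phi> ` R = R}"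
  have "compose W f g ` R = f ` g ` R" using R by (force simp: compose_def image_image)
  then show "compose W f g \<in> {\<phi> \<in> mor F W W. \<phi> ` R = R}" using f g mor_comp[of g W W f W] by simp
next
  fix f assume f: "f \<in> {\<phi> \<in> mor F W W. \<phi> ` R = R}"
  then have B: "f ` W = W" "inj_on f W" using mor_self_Bij by (auto simp: Bij_iff)
  have "restrict (inv_into W f) W ` R = inv_into W f ` f ` R" using f R by (force simp: subset_iff)
  also have "\<dots> = R" using R B by (simp add: inv_into_image_cancel)
  finally show "restrict (inv_into W f) W \<in> {\<phi> \<in> mor F W W. \<phi> ` R = R}"
    using f B mor_image[of f W W] by simp
qed

lemma aut_subgroup: "sub W \<Longrightarrow> subgroup (mor F W W) (BijGroup W)"
  using stabiliser_subgroup[of W W] mor_self_Bij by (auto simp: Bij_iff cong: conj_cong)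

lemma aut_group: "sub W \<Longrightarrow> group (fusion_aut F W)"
  unfolding fusion_aut_def by (rule perm_group_group[OF aut_subgroup])

lemma finite_Bij: "finite W \<Longrightarrow> finite (Bij W)"
proof (rule finite_subset)
  show "Bij W \<subseteq> W \<rightarrow>\<^sub>E W" using Bij_imp_funcset Bij_imp_extensional unfolding PiE_def by blast
qed (simp add: finite_PiE)

lemma aut_finite: "sub W \<Longrightarrow> finite (mor F W W)"
  using finite_Bij[OF sub_finite] mor_self_Bij finite_subset by (metis subsetI)

text \<open>The group usually written Aut_S(W), for a subgroup \<open>S\<close> that normalises
  \<open>W\<close>.\<close>

definition conj_auts :: "'a set \<Rightarrow> 'a set \<Rightarrow> ('a \<Rightarrow> 'a) set" where
  "conj_auts W S = (\<lambda>g. restrict (cj g) W) ` S"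

lemma conj_hom_self: "sub W \<Longrightarrow> conj_hom P W W = conj_auts W (normalizer P W)"
proof -
  assume W: "sub W"
  have "restrict (cj g) W = (\<lambda>x\<in>W. inv g \<otimes> x \<otimes> g)" for g by (simp add: conj_by_def fun_eq_iff)
  then show ?thesis
    using normalizer_iff'[OF W] by (force simp: conj_hom_def conj_auts_def conj_by_def image_subset_iff)
qed

lemma conj_auts_subgroup:
  assumes W: "sub W" and S: "sub S" "S \<subseteq> normalizer P W"
  shows "subgroup (conj_auts W S) (BijGroup W)" "\<exists>n. card (conj_auts W S) = p ^ n"
    "conj_auts W S \<subseteq> mor F W W"
proof -
  show sub: "conj_auts W S \<subseteq> mor F W W"
  proof
    fix u assume "u \<in> conj_auts W S"
    then obtain g where "g \<in> normalizer P W" "u = restrict (cj g) W" using S by (auto simp: conj_auts_def)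
    then show "u \<in> mor F W W"
      using W normalizer_iff'[OF W] fmap_conj[OF W] by (auto simp: restrict_mor_iff)
  qed
  \<comment> \<open>Conjugation is a right action while \<open>BijGroup\<close> composes on the
    left, so only the inverse gives a homomorphism; the image is the same.\<close>
  let ?h = "\<lambda>g. restrict (cj (inv g)) W"
  have SP: "g \<in> carrier P" if "g \<in> S" for g using that S sub_carrier by blast
  have Sn: "cj g x \<in> W" if "g \<in> S" "x \<in> W" for g x using that S normalizer_iff'[OF W] by blast
  have Si: "inv g \<in> S" if "g \<in> S" for g using that S by (simp add: subgroup.m_inv_closed)
  have hB: "?h g \<in> Bij W" if "g \<in> S" for g using sub Si[OF that] mor_self_Bij by (auto simp: conj_auts_def)
  have hom: "group_hom (P\<lparr>carrier := S\<rparr>) (BijGroup W) ?h"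
    unfolding group_hom_def group_hom_axioms_def
  proof (intro conjI homI)
    show "group (P\<lparr>carrier := S\<rparr>)" using S by (simp add: subgroup_imp_group)
    show "group (BijGroup W)" by (rule group_BijGroup)
    fix g assume g: "g \<in> carrier (P\<lparr>carrier := S\<rparr>)"
    then show "?h g \<in> carrier (BijGroup W)" using hB by (simp add: BijGroup_def)
    fix h assume h: "h \<in> carrier (P\<lparr>carrier := S\<rparr>)"
    have "?h (g \<otimes> h) = compose W (?h g) (?h h)"
      using g h SP Sn Si sub_carrier[OF W] by (auto simp: compose_def fun_eq_iff cj_cj inv_mult_group)
    then show "?h (g \<otimes>\<^bsub>P\<lparr>carrier := S\<rparr>\<^esub> h) = ?h g \<otimes>\<^bsub>BijGroup W\<^esub> ?h h"
      using g h hB by (simp add: perm_mult)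
  qed
  have im: "?h ` S = conj_auts W S"
  proof
    show "?h ` S \<subseteq> conj_auts W S" using Si by (auto simp: conj_auts_def)
    show "conj_auts W S \<subseteq> ?h ` S"
    proof
      fix u assume "u \<in> conj_auts W S"
      then obtain g where "g \<in> S" "u = restrict (cj g) W" by (auto simp: conj_auts_def)
      then have "u = ?h (inv g)" "inv g \<in> S" using Si SP by auto
      then show "u \<in> ?h ` S" by blast
    qed
  qed
  show "subgroup (conj_auts W S) (BijGroup W)"
    using group_hom.img_is_subgroup[OF hom] im by simp
  obtain n where "card S = p ^ n" using sub_card S by auto
  then have "card (conj_auts W S) dvd p ^ n" using group_hom_card[OF hom] im by (simp add: order_def)
  then show "\<exists>n. card (conj_auts W S) = p ^ n" using prime by (auto simp: divides_primepow_nat)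
qed

text \<open>Conjugation by \<open>f\<close> carries \<open>U\<close> to a \<open>p\<close>-subgroup
  of the automorphism group of the image, where the automorphisms induced by \<open>P\<close> form a
  Sylow subgroup. Following \<open>f\<close> by an automorphism \<open>t\<close> supplied by Sylow's
  theorem makes all of \<open>U\<close> act there as conjugation by elements of
  \<open>P\<close>.\<close>

lemma transport_p_automorphisms:
  assumes f: "fmap W f" and n: "fully_normalised F (f ` W)"
    and U: "subgroup U (BijGroup W)" "U \<subseteq> mor F W W" "card U = p ^ k"
  obtains f' where "fmap W f'" "f' ` W = f ` W"
    "\<And>u. u \<in> U \<Longrightarrow> \<exists>g\<in>normalizer P (f ` W). \<forall>x\<in>W. f' (u x) = cj g (f' x)"
proof -
  let ?V = "f ` W"
  have W: "sub W" using f by (rule fmap_sub)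
  have V: "sub ?V" using fmap_image_sub[OF f W] by simp
  let ?tr = "\<lambda>u. \<lambda>y\<in>?V. f (u (inv_into W f y))"
  have iv: "inv_into W f (f x) = x" if "x \<in> W" for x using f that by (rule fmap_inv_into_f)
  have mW: "u x \<in> W" if "u \<in> mor F W W" "x \<in> W" for u x using that by (auto simp: mor_iff)
  have trm: "?tr u \<in> mor F ?V ?V" if u: "u \<in> mor F W W" for u
  proof -
    have 1: "fmap ?V (\<lambda>y. u (inv_into W f y))"
      using u iv by (intro fmap_comp[OF fmap_inv_into[OF f]]) (auto simp: mor_iff)
    have "fmap ?V (\<lambda>y. f (u (inv_into W f y)))"
      by (rule fmap_comp[OF 1 f]) (use u iv mW in auto)
    then show ?thesis using V u iv mW by (auto simp: restrict_mor_iff)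
  qed
  have hom: "group_hom (fusion_aut F W) (fusion_aut F ?V) ?tr"
    unfolding group_hom_def group_hom_axioms_def
  proof (intro conjI homI aut_group W V)
    fix u assume u: "u \<in> carrier (fusion_aut F W)"
    then show "?tr u \<in> carrier (fusion_aut F ?V)" using trm by (simp add: fusion_aut_def)
    fix v assume v: "v \<in> carrier (fusion_aut F W)"
    have "?tr (compose W u v) = compose ?V (?tr u) (?tr v)"
      using u v iv mW by (auto simp: compose_def fun_eq_iff fusion_aut_def)
    then show "?tr (u \<otimes>\<^bsub>fusion_aut F W\<^esub> v) = ?tr u \<otimes>\<^bsub>fusion_aut F ?V\<^esub> ?tr v"
      using u v trm mor_self_Bij by (simp add: fusion_aut_def perm_mult)
  qed
  have UA: "subgroup U (fusion_aut F W)"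
    unfolding fusion_aut_def by (rule group.subgroup_incl[OF group_BijGroup U(1) aut_subgroup[OF W] U(2)])
  have "subgroup (?tr ` U) (fusion_aut F ?V)" by (rule group_hom.subgroup_img_is_subgroup[OF hom UA])
  moreover have "inj_on ?tr U"
  proof (rule inj_onI)
    fix u v assume u: "u \<in> U" and v: "v \<in> U" and eq: "?tr u = ?tr v"
    show "u = v"
    proof (rule extensionalityI)
      show "u \<in> extensional W" "v \<in> extensional W" using u v U(2) by (auto simp: mor_iff)
      fix x assume x: "x \<in> W"
      have "?tr u (f x) = ?tr v (f x)" using eq by simp
      then have "f (u x) = f (v x)" using x iv by simp
      then show "u x = v x" using fmap_inj[OF f] mW u v U(2) x by (meson inj_onD subsetD)
    qed
  qed
  ultimately obtain t where t: "t \<in> carrier (fusion_aut F ?V)" and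
    conj: "\<forall>h\<in>?tr ` U. t \<otimes>\<^bsub>fusion_aut F ?V\<^esub> h \<otimes>\<^bsub>fusion_aut F ?V\<^esub> inv\<^bsub>fusion_aut F ?V\<^esub> t \<in> conj_hom P ?V ?V"
    using sylow_conj[OF aut_group[OF V] _ prime sylow_if_fully_normalised[OF n], of "?tr ` U" k]
      aut_finite[OF V] U(3) by (auto simp: card_image fusion_aut_def)
  then have tm: "t \<in> mor F ?V ?V" by (simp add: fusion_aut_def)
  let ?f = "\<lambda>x. t (f x)"
  show thesis
  proof (rule that)
    show "fmap W ?f" by (rule fmap_comp[OF f, of ?V]) (use tm in \<open>auto simp: mor_iff\<close>)
    show "?f ` W = f ` W" using mor_self_Bij[OF tm] by (simp add: Bij_iff flip: image_image)
    fix u assume u: "u \<in> U"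
    let ?h = "?tr u"
    have "t \<otimes>\<^bsub>fusion_aut F ?V\<^esub> ?h \<otimes>\<^bsub>fusion_aut F ?V\<^esub> inv\<^bsub>fusion_aut F ?V\<^esub> t \<in> conj_auts ?V (normalizer P ?V)"
      using conj u conj_hom_self[OF V] by blast
    then obtain g where g: "g \<in> normalizer P ?V"
      "t \<otimes>\<^bsub>fusion_aut F ?V\<^esub> ?h \<otimes>\<^bsub>fusion_aut F ?V\<^esub> inv\<^bsub>fusion_aut F ?V\<^esub> t = restrict (cj g) ?V"
      by (auto simp: conj_auts_def)
    have "?f (u x) = cj g (?f x)" if x: "x \<in> W" for x
    proof -
      have "(t \<otimes>\<^bsub>fusion_aut F ?V\<^esub> ?h \<otimes>\<^bsub>fusion_aut F ?V\<^esub> inv\<^bsub>fusion_aut F ?V\<^esub> t) (t (f x)) = t (?h (f x))"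
        unfolding fusion_aut_def
        by (rule perm_conj_apply[OF aut_subgroup[OF V] tm trm]) (use u U x in auto)
      moreover have "t (f x) \<in> ?V" using tm x by (auto simp: mor_iff)
      ultimately show ?thesis using g iv x by simp
    qed
    then show "\<exists>g\<in>normalizer P ?V. \<forall>x\<in>W. ?f (u x) = cj g (?f x)" using g by blast
  qed
qed

text \<open>Once the automorphisms induced by \<open>normalizer P Q\<close> are transported into
  those induced by \<open>P\<close>, the extension domain is all of \<open>normalizer P Q\<close>.
  The price is a change of \<open>f\<close> by an automorphism of its image, so \<open>c\<close> is
  only known to have the same image of \<open>Q\<close>.\<close>

lemma extend_to_normalizer:
  assumes f: "fmap Q f" and n: "fully_normalised F (f ` Q)"
  obtains c where "fmap (normalizer P Q) c" "c ` Q = f ` Q"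
proof -
  have Q: "sub Q" using f by (rule fmap_sub)
  note N = normalizer_sub[OF Q]
  note U = conj_auts_subgroup[OF Q N subset_refl]
  obtain k where k: "card (conj_auts Q (normalizer P Q)) = p ^ k" using U(2) by auto
  obtain f' where f': "fmap Q f'" "f' ` Q = f ` Q"
    "\<And>u. u \<in> conj_auts Q (normalizer P Q) \<Longrightarrow> \<exists>g\<in>normalizer P (f ` Q). \<forall>x\<in>Q. f' (u x) = cj g (f' x)"
    using transport_p_automorphisms[OF f n U(1,3) k] by blast
  have "fully_centralised F (f' ` Q)" using f'(2) n fully_centralised_if_normalised by simp
  then obtain c where c: "fmap (ext_dom Q f') c" "\<And>x. x \<in> Q \<Longrightarrow> c x = f' x"
    using extend_to_ext_dom[OF f'(1)] by blast
  have "ext_dom Q f' = normalizer P Q"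
  proof -
    have "\<exists>h\<in>carrier P. \<forall>x\<in>Q. f' (cj g x) = cj h (f' x)" if g: "g \<in> normalizer P Q" for g
    proof -
      have "restrict (cj g) Q \<in> conj_auts Q (normalizer P Q)" using g by (simp add: conj_auts_def)
      then obtain h where h: "h \<in> normalizer P (f ` Q)" "\<forall>x\<in>Q. f' (restrict (cj g) Q x) = cj h (f' x)"
        using f'(3) by blast
      have "sub (f ` Q)" using fmap_image_sub[OF f Q] by simp
      then have "h \<in> carrier P" using h normalizer_iff' by auto
      then show ?thesis using h by auto
    qed
    then show ?thesis by (auto simp: ext_dom_def)
  qed
  moreover have "c ` Q = f' ` Q" using c(2) by (rule image_cong[OF refl])
  ultimately show thesis using that c(1) f'(2) by simp
qed

end

section \<open>Normalisers of fully normalised subgroups\<close>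

locale normaliser_system = saturated_fusion +
  fixes R
  assumes R: "fully_normalised F R"
begin

abbreviation "S \<equiv> normalizer P R"
abbreviation "E \<equiv> fusion_normaliser F R"

lemma sub_R: "sub R"
  using R by (simp add: fully_normalised_iff)

lemma sub_S: "sub S"
  using normalizer_sub[OF sub_R] .

lemma R_S: "R \<subseteq> S"
  using sub_normalizer[OF sub_R] .

lemma S_carrier: "x \<in> S \<Longrightarrow> x \<in> carrier P"
  using sub_S sub_carrier by blast

lemma S_iff: "s \<in> S \<longleftrightarrow> s \<in> carrier P \<and> (\<forall>x\<in>R. cj s x \<in> R)"
  using normalizer_iff'[OF sub_R] .

text \<open>These are the maps of \<open>E\<close> whose domain contains \<open>R\<close>. By
  \<open>mor_E_D\<close> and \<open>mor_E_I\<close> the morphisms of \<open>E\<close> are exactly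
  their restrictions, so most arguments can ignore smaller domains.\<close>

definition emap where
  "emap A f \<longleftrightarrow> R \<subseteq> A \<and> A \<subseteq> S \<and> fmap A f \<and> f ` R = R"

lemma emap_sub: "emap A f \<Longrightarrow> sub A" and emap_fmap: "emap A f \<Longrightarrow> fmap A f"
  and emap_dom: "emap A f \<Longrightarrow> R \<subseteq> A" "emap A f \<Longrightarrow> A \<subseteq> S" and emap_R: "emap A f \<Longrightarrow> f ` R = R"
  using fmap_sub by (auto simp: emap_def)

lemma emap_into:
  assumes f: "emap A f" shows "f ` A \<subseteq> S"
proof clarify
  fix x assume x: "x \<in> A"
  show "f x \<in> S"
    unfolding S_iff
  proof (intro conjI ballI)
    show "f x \<in> carrier P" using fmap_closed[OF emap_fmap[OF f] x] .
    fix y assume "y \<in> R"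
    then obtain z where z: "z \<in> R" "y = f z" using emap_R[OF f] by blast
    have "cj (f x) y = f (cj x z)" using fmap_cj[OF emap_fmap[OF f] x] z emap_dom(1)[OF f] by auto
    moreover have "cj x z \<in> R" using x z emap_dom(2)[OF f] S_iff by blast
    ultimately show "cj (f x) y \<in> R" using emap_R[OF f] by blast
  qed
qed

lemma emap_comp: "emap A f \<Longrightarrow> emap B g \<Longrightarrow> f ` A \<subseteq> B \<Longrightarrow> emap A (\<lambda>x. g (f x))"
  unfolding emap_def using fmap_comp[of A f B g] by (simp flip: image_image)

lemma emap_inv: "emap A f \<Longrightarrow> emap (f ` A) (inv_into A f)"
  using emap_into[of A f] fmap_inv_into[of A f] fmap_inj[of A f]
  unfolding emap_def by (metis image_mono inv_into_image_cancel)

lemma emap_conj: "s \<in> S \<Longrightarrow> sub A \<Longrightarrow> R \<subseteq> A \<Longrightarrow> A \<subseteq> S \<Longrightarrow> emap A (cj s)"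
  unfolding emap_def using fmap_conj S_iff cj_onto[of s R] sub_finite[OF sub_R] subgroup.subset[OF sub_R] by blast

lemma emap_subset: "emap A f \<Longrightarrow> sub B \<Longrightarrow> R \<subseteq> B \<Longrightarrow> B \<subseteq> A \<Longrightarrow> emap B f"
  unfolding emap_def using fmap_subset by blast

lemma emap_id: "sub A \<Longrightarrow> R \<subseteq> A \<Longrightarrow> A \<subseteq> S \<Longrightarrow> emap A (\<lambda>x. x)"
  unfolding emap_def using fmap_id by auto

lemma grp_E: "grp E = P\<lparr>carrier := S\<rparr>"
  by (simp add: fusion_normaliser_def Let_def)

lemma sub_S_iff: "subgroup A (P\<lparr>carrier := S\<rparr>) \<longleftrightarrow> sub A \<and> A \<subseteq> S"
  using subgroup_incl[OF _ sub_S] incl_subgroup[OF sub_S] subgroup.subset[of A "P\<lparr>carrier := S\<rparr>"] by auto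

lemma mult_R: "sub A \<Longrightarrow> A \<subseteq> S \<Longrightarrow> sub (A <#> R) \<and> A \<subseteq> A <#> R \<and> R \<subseteq> A <#> R \<and> A <#> R \<subseteq> S"
  using subgroup_set_mult[of A R] set_mult_subset[OF sub_S _ R_S, of A] sub_R S_iff by (auto simp: subset_iff)

lemma mor_E_D:
  assumes "\<phi> \<in> mor E A B"
  shows "sub A" "A \<subseteq> S" "sub B" "B \<subseteq> S" "\<phi> \<in> extensional A" "\<phi> ` A \<subseteq> B" "\<phi> \<in> mor F A B"
    "\<exists>f. emap (A <#> R) f \<and> (\<forall>x\<in>A. f x = \<phi> x)"
proof -
  have *: "\<phi> \<in> mor F A B \<and> subgroup A (P\<lparr>carrier := S\<rparr>) \<and> subgroup B (P\<lparr>carrier := S\<rparr>) \<and>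
      (\<exists>\<psi>\<in>mor F (A <#> R) (B <#> R). restrict \<psi> A = \<phi> \<and> restrict \<psi> R \<in> auto (P\<lparr>carrier := R\<rparr>))"
    using assms unfolding fusion_normaliser_def Let_def by simp
  then show AB: "sub A" "A \<subseteq> S" "sub B" "B \<subseteq> S" "\<phi> \<in> extensional A" "\<phi> ` A \<subseteq> B" "\<phi> \<in> mor F A B"
    unfolding sub_S_iff mor_iff by auto
  obtain \<psi> where \<psi>: "\<psi> \<in> mor F (A <#> R) (B <#> R)" "restrict \<psi> A = \<phi>" "restrict \<psi> R \<in> auto (P\<lparr>carrier := R\<rparr>)"
    using * by blast
  have "restrict \<psi> R ` R = R" using \<psi>(3) by (auto simp: auto_def Bij_iff)
  then have "\<psi> ` R = R" by simp
  then have "emap (A <#> R) \<psi>" using \<psi>(1) mult_R[OF AB(1,2)] unfolding emap_def mor_iff by blast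
  moreover have "\<forall>x\<in>A. \<psi> x = \<phi> x" using \<psi>(2) by auto
  ultimately show "\<exists>f. emap (A <#> R) f \<and> (\<forall>x\<in>A. f x = \<phi> x)" by blast
qed

text \<open>A subgroup \<open>C\<close> that contains \<open>A\<close> and \<open>R\<close> contains
  \<open>A <#> R\<close>, so the extension demanded by the definition of the normaliser is again a
  restriction of \<open>f\<close>.\<close>

lemma mor_E_I:
  assumes f: "emap C f" and A: "sub A" "A \<subseteq> C" and B: "sub B" "B \<subseteq> S" "f ` A \<subseteq> B"
  shows "restrict f A \<in> mor E A B"
proof -
  have AS: "A \<subseteq> S" using emap_dom[OF f] A by blast
  note m = mult_R[OF A(1) AS]
  have AC: "A <#> R \<subseteq> C" by (rule set_mult_subset[OF emap_sub[OF f] A(2) emap_dom(1)[OF f]])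
  have fA: "fmap (A <#> R) f" using fmap_subset[OF emap_fmap[OF f]] m AC by blast
  have im: "f ` (A <#> R) \<subseteq> B <#> R"
  proof clarify
    fix x assume "x \<in> A <#> R"
    then obtain a r where "a \<in> A" "r \<in> R" "x = a \<otimes> r" by (auto simp: set_mult_def)
    moreover from this have "f x = f a \<otimes> f r" "f r \<in> R" "f a \<in> B"
      using fmap_mult[OF emap_fmap[OF f], of a r] A(2) emap_dom(1)[OF f] emap_R[OF f] B(3) by auto
    ultimately show "f x \<in> B <#> R" unfolding set_mult_def by auto
  qed
  have "restrict f (A <#> R) \<in> mor F (A <#> R) (B <#> R)"
    using mult_R[OF B(1,2)] fA im by (simp add: restrict_mor_iff)
  moreover have "restrict (restrict f (A <#> R)) A = restrict f A" using m by (auto simp: fun_eq_iff)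
  moreover have "restrict (restrict f (A <#> R)) R \<in> auto (P\<lparr>carrier := R\<rparr>)"
  proof -
    have fR: "fmap R f" using fmap_subset[OF emap_fmap[OF f] sub_R emap_dom(1)[OF f]] .
    then have rm: "restrict f R \<in> mor F R R" using emap_R[OF f] sub_R by (simp add: restrict_mor_iff)
    have "restrict (restrict f (A <#> R)) R = restrict f R" using m by (auto simp: fun_eq_iff)
    then show ?thesis using mor_props[OF rm] mor_self_Bij[OF rm] by (simp add: auto_def)
  qed
  moreover have "restrict f A \<in> mor F A B"
    using fmap_subset[OF emap_fmap[OF f] A] B by (simp add: restrict_mor_iff)
  ultimately have "restrict f A \<in> mor F A B \<and> (\<exists>\<psi>\<in>mor F (A <#> R) (B <#> R).
      restrict \<psi> A = restrict f A \<and> restrict \<psi> R \<in> auto (P\<lparr>carrier := R\<rparr>))" by blast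
  then show ?thesis
    using A AS B unfolding fusion_normaliser_def Let_def by (simp add: sub_S_iff del: restrict_restrict)
qed

text \<open>Normality of \<open>Q\<close> in \<open>E\<close>, by \<open>fusion_normal_iff\<close>.
  The equality of records becomes an extension property in which codomains no longer appear; it
  suffices to extend maps whose domain contains \<open>R\<close>, since all other morphisms are
  restrictions of these.\<close>

definition enormal :: "'a set \<Rightarrow> bool" where
  "enormal Q \<longleftrightarrow> sub Q \<and> Q \<subseteq> S \<and> (\<forall>s\<in>S. \<forall>q\<in>Q. cj s q \<in> Q) \<and>
    (\<forall>A f. emap A f \<longrightarrow> (\<exists>f'. emap (A <#> Q) f' \<and> (\<forall>x\<in>A. f' x = f x) \<and> f' ` Q = Q))"

lemma enormal_sub: "enormal Q \<Longrightarrow> sub Q" and enormal_S: "enormal Q \<Longrightarrow> Q \<subseteq> S"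
  and enormal_cj: "enormal Q \<Longrightarrow> s \<in> S \<Longrightarrow> q \<in> Q \<Longrightarrow> cj s q \<in> Q"
  by (auto simp: enormal_def)

lemma enormal_extend:
  assumes "enormal Q" "emap A f"
  obtains f' where "emap (A <#> Q) f'" "\<And>x. x \<in> A \<Longrightarrow> f' x = f x" "f' ` Q = Q"
proof -
  have *: "\<forall>A f. emap A f \<longrightarrow> (\<exists>f'. emap (A <#> Q) f' \<and> (\<forall>x\<in>A. f' x = f x) \<and> f' ` Q = Q)"
    using assms(1) unfolding enormal_def by (elim conjE)
  from *[rule_format, OF assms(2)] show thesis using that by (elim exE conjE) simp
qed

lemma mult_S:
  "sub A \<Longrightarrow> A \<subseteq> S \<Longrightarrow> sub Q \<Longrightarrow> Q \<subseteq> S \<Longrightarrow> \<forall>s\<in>S. \<forall>q\<in>Q. cj s q \<in> Q \<Longrightarrow>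
    sub (A <#> Q) \<and> A \<subseteq> A <#> Q \<and> Q \<subseteq> A <#> Q \<and> A <#> Q \<subseteq> S"
  using subgroup_set_mult[of A Q] set_mult_subset[OF sub_S, of A Q] by (auto simp: subset_iff)

lemma enormal_invariant:
  assumes Q: "enormal Q" and f: "emap A f" "Q \<subseteq> A"
  shows "f ` Q = Q"
proof -
  obtain f' where "emap (A <#> Q) f'" "\<And>x. x \<in> A \<Longrightarrow> f' x = f x" "f' ` Q = Q"
    using enormal_extend[OF Q f(1)] by blast
  then show ?thesis using f(2) by (metis image_cong subsetD)
qed

lemma fully_normalised_E:
  assumes "sub Q" "Q \<subseteq> S" "\<forall>s\<in>S. \<forall>q\<in>Q. cj s q \<in> Q"
  shows "fully_normalised E Q" "normalizer (P\<lparr>carrier := S\<rparr>) Q = S"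
proof -
  show N: "normalizer (P\<lparr>carrier := S\<rparr>) Q = S"
    using normalizer_in_subgroup_iff[OF is_group sub_S assms(2) sub_finite[OF assms(1)]] assms(3) by blast
  show "fully_normalised E Q"
    unfolding fully_normalised_def grp_E N
  proof (intro conjI allI ballI)
    show "subgroup Q (P\<lparr>carrier := S\<rparr>)" using assms by (simp add: sub_S_iff)
    fix T \<phi> assume \<phi>: "\<phi> \<in> mor E Q T"
    have "\<phi> ` Q \<subseteq> S" using mor_E_D(4,6)[OF \<phi>] by blast
    moreover have "finite (\<phi> ` Q)" using sub_finite[OF assms(1)] by simp
    ultimately have "normalizer (P\<lparr>carrier := S\<rparr>) (\<phi> ` Q) \<subseteq> S"
      using normalizer_in_subgroup_iff[OF is_group sub_S] by blast
    then show "card (normalizer (P\<lparr>carrier := S\<rparr>) (\<phi> ` Q)) \<le> card S"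
      using sub_finite[OF sub_S] card_mono by blast
  qed
qed

text \<open>The group component of \<open>E = fusion_normaliser E Q\<close> says that
  \<open>S\<close> normalises \<open>Q\<close>, the morphism component that morphisms extend over
  \<open>Q\<close>. Conversely, a morphism on \<open>A\<close> is extended to
  \<open>A <#> R\<close>, from there over \<open>Q\<close>, and cut down to \<open>A <#> Q\<close>;
  the other inclusion of morphism sets is built into the definition.\<close>

lemma fusion_normal_iff: "fusion_normal E Q \<longleftrightarrow> enormal Q"
proof
  assume fn: "fusion_normal E Q"
  have eq: "E = fusion_normaliser E Q" and Q: "sub Q" "Q \<subseteq> S"
    using fn by (auto simp: fusion_normal_def fully_normalised_def grp_E sub_S_iff)
  have "grp E = grp (fusion_normaliser E Q)" using eq by simp
  then have "P\<lparr>carrier := S\<rparr> = P\<lparr>carrier := normalizer (P\<lparr>carrier := S\<rparr>) Q\<rparr>"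
    unfolding fusion_normaliser_def[of E] Let_def grp_E by simp
  then have "carrier (P\<lparr>carrier := S\<rparr>) = carrier (P\<lparr>carrier := normalizer (P\<lparr>carrier := S\<rparr>) Q\<rparr>)" by (rule arg_cong)
  then have N: "normalizer (P\<lparr>carrier := S\<rparr>) Q = S" by simp
  then have nQ: "\<forall>s\<in>S. \<forall>q\<in>Q. cj s q \<in> Q"
    using normalizer_in_subgroup_iff[OF is_group sub_S Q(2) sub_finite[OF Q(1)]] by blast
  show "enormal Q"
    unfolding enormal_def
  proof (intro conjI allI impI Q nQ)
    fix A f assume f: "emap A f"
    have A: "sub A" "R \<subseteq> A" "A \<subseteq> S" using emap_sub emap_dom f by auto
    have "restrict f A \<in> mor E A S" using mor_E_I[OF f A(1) subset_refl sub_S subset_refl emap_into[OF f]] .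
    then have "restrict f A \<in> mor (fusion_normaliser E Q) A S" using eq by simp
    then have "\<exists>\<psi>\<in>mor E (A <#>\<^bsub>grp E\<^esub> Q) (S <#>\<^bsub>grp E\<^esub> Q). restrict \<psi> A = restrict f A \<and>
        restrict \<psi> Q \<in> auto ((grp E)\<lparr>carrier := Q\<rparr>)"
      unfolding fusion_normaliser_def[of E] Let_def by simp
    then obtain \<psi> where \<psi>: "\<psi> \<in> mor E (A <#> Q) (S <#> Q)" "restrict \<psi> A = restrict f A"
        "restrict \<psi> Q \<in> Bij Q"
      unfolding grp_E auto_def by (auto simp: set_mult_def)
    have m: "sub (A <#> Q)" "A \<subseteq> A <#> Q" "Q \<subseteq> A <#> Q" "A <#> Q \<subseteq> S" using mult_S[OF A(1,3) Q nQ] by auto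
    obtain g where g: "emap (A <#> Q <#> R) g" "\<forall>x\<in>A <#> Q. g x = \<psi> x" using mor_E_D(8)[OF \<psi>(1)] by blast
    have "emap (A <#> Q) g"
      using emap_subset[OF g(1) m(1)] A(2) m mult_R[OF m(1,4)] by blast
    moreover have "\<forall>x\<in>A. g x = f x" using g(2) \<psi>(2) m(2) by (metis restrict_apply' subsetD)
    moreover have "g ` Q = Q"
    proof -
      have "g ` Q = restrict \<psi> Q ` Q" using g(2) m(3) by force
      then show ?thesis using \<psi>(3) by (simp add: Bij_iff)
    qed
    ultimately show "\<exists>f'. emap (A <#> Q) f' \<and> (\<forall>x\<in>A. f' x = f x) \<and> f' ` Q = Q" by blast
  qed
next
  assume en: "enormal Q"
  have Q: "sub Q" "Q \<subseteq> S" "\<forall>s\<in>S. \<forall>q\<in>Q. cj s q \<in> Q" using en by (auto simp: enormal_def)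
  note N = fully_normalised_E[OF Q]
  have "mor E A B \<subseteq> mor (fusion_normaliser E Q) A B" for A B
  proof
    fix \<phi> assume \<phi>: "\<phi> \<in> mor E A B"
    note D = mor_E_D[OF \<phi>]
    obtain f where f: "emap (A <#> R) f" "\<forall>x\<in>A. f x = \<phi> x" using D(8) by blast
    obtain f' where f': "emap (A <#> R <#> Q) f'" "\<And>x. x \<in> A <#> R \<Longrightarrow> f' x = f x" "f' ` Q = Q"
      using enormal_extend[OF en f(1)] by blast
    have AR: "sub (A <#> R)" "A \<subseteq> A <#> R" "A <#> R \<subseteq> S" using mult_R D by auto
    have ARQ: "sub (A <#> R <#> Q)" "A <#> R \<subseteq> A <#> R <#> Q" "Q \<subseteq> A <#> R <#> Q"
      using mult_S[OF AR(1,3) Q] by auto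
    have AQ: "sub (A <#> Q)" "A \<subseteq> A <#> Q" "Q \<subseteq> A <#> Q" using mult_S[OF D(1,2) Q] by auto
    have BQ: "sub (B <#> Q)" "B <#> Q \<subseteq> S" using mult_S[OF D(3,4) Q] by auto
    have AQ': "A <#> Q \<subseteq> A <#> R <#> Q" by (rule set_mult_subset[OF ARQ(1)]) (use AR ARQ in auto)
    have eqA: "f' x = \<phi> x" if "x \<in> A" for x using that f f' AR(2) by auto
    have im: "f' ` (A <#> Q) \<subseteq> B <#> Q"
    proof clarify
      fix x assume "x \<in> A <#> Q"
      then obtain a q where "a \<in> A" "q \<in> Q" "x = a \<otimes> q" by (auto simp: set_mult_def)
      moreover from this have "f' x = f' a \<otimes> f' q" "f' q \<in> Q" "f' a \<in> B"
        using fmap_mult[OF emap_fmap[OF f'(1)], of a q] AQ AQ' f'(3) eqA D(6) by auto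
      ultimately show "f' x \<in> B <#> Q" unfolding set_mult_def by auto
    qed
    have "restrict f' (A <#> Q) \<in> mor E (A <#> Q) (B <#> Q)"
      by (rule mor_E_I[OF f'(1) AQ(1) AQ' BQ im])
    moreover have "restrict (restrict f' (A <#> Q)) A = \<phi>"
      using AQ(2) eqA D(5) by (auto simp: fun_eq_iff extensional_def)
    moreover have "restrict (restrict f' (A <#> Q)) Q \<in> auto (P\<lparr>carrier := Q\<rparr>)"
    proof -
      have "fmap Q f'" using fmap_subset[OF emap_fmap[OF f'(1)]] Q ARQ by blast
      then have rm: "restrict f' Q \<in> mor F Q Q" using f'(3) Q by (simp add: restrict_mor_iff)
      have "restrict (restrict f' (A <#> Q)) Q = restrict f' Q" using AQ by (auto simp: fun_eq_iff)
      then show ?thesis using mor_props[OF rm] mor_self_Bij[OF rm] by (simp add: auto_def)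
    qed
    ultimately have "\<exists>\<psi>\<in>mor E (A <#> Q) (B <#> Q). restrict \<psi> A = \<phi> \<and> restrict \<psi> Q \<in> auto (P\<lparr>carrier := Q\<rparr>)"
      by blast
    moreover have "C <#>\<^bsub>P\<lparr>carrier := S\<rparr>\<^esub> Q = C <#> Q" for C by (simp add: set_mult_def)
    ultimately show "\<phi> \<in> mor (fusion_normaliser E Q) A B"
      using \<phi> D unfolding fusion_normaliser_def[of E] Let_def grp_E
      by (simp add: sub_S_iff N del: restrict_restrict)
  qed
  moreover have "mor (fusion_normaliser E Q) A B \<subseteq> mor E A B" for A B
    unfolding fusion_normaliser_def[of E] Let_def by auto
  ultimately have "mor E = mor (fusion_normaliser E Q)" by blast
  moreover have "grp E = grp (fusion_normaliser E Q)"
    unfolding fusion_normaliser_def[of E] Let_def grp_E by (simp add: N)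
  ultimately have "E = fusion_normaliser E Q" by simp
  then show "fusion_normal E Q" using N(1) by (simp add: fusion_normal_def)
qed

lemma enormal_R: "enormal R"
  unfolding enormal_def
proof (intro conjI allI impI sub_R R_S)
  show "\<forall>s\<in>S. \<forall>q\<in>R. cj s q \<in> R" using S_iff by blast
  fix A f assume f: "emap A f"
  have "A <#> R = A"
    using mult_R[OF emap_sub[OF f] emap_dom(2)[OF f]]
      set_mult_subset[OF emap_sub[OF f] subset_refl emap_dom(1)[OF f]] by blast
  then show "\<exists>f'. emap (A <#> R) f' \<and> (\<forall>x\<in>A. f' x = f x) \<and> f' ` R = R"
    using f emap_R[OF f] by auto
qed

text \<open>Extend over \<open>Q1\<close> and then over \<open>Q2\<close>. The second extension
  agrees with the first on \<open>A <#> Q1\<close> and therefore still maps \<open>Q1\<close> onto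
  itself.\<close>

lemma enormal_mult:
  assumes 1: "enormal Q1" and 2: "enormal Q2" shows "enormal (Q1 <#> Q2)"
proof -
  have Q1: "sub Q1" "Q1 \<subseteq> S" "\<forall>s\<in>S. \<forall>q\<in>Q1. cj s q \<in> Q1" and Q2: "sub Q2" "Q2 \<subseteq> S" "\<forall>s\<in>S. \<forall>q\<in>Q2. cj s q \<in> Q2"
    using 1 2 by (auto simp: enormal_def)
  note m = mult_S[OF Q1(1,2) Q2]
  show ?thesis
    unfolding enormal_def
  proof (intro conjI allI impI ballI)
    show "sub (Q1 <#> Q2)" "Q1 <#> Q2 \<subseteq> S" using m by auto
    fix s q assume s: "s \<in> S" and "q \<in> Q1 <#> Q2"
    then obtain a b where ab: "a \<in> Q1" "b \<in> Q2" "q = a \<otimes> b" by (auto simp: set_mult_def)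
    then have "cj s q = cj s a \<otimes> cj s b" using s S_carrier Q1(2) Q2(2) by (auto intro: cj_mult)
    then show "cj s q \<in> Q1 <#> Q2" using ab s Q1(3) Q2(3) unfolding set_mult_def by blast
  next
    fix A f assume f: "emap A f"
    obtain f1 where f1: "emap (A <#> Q1) f1" "\<And>x. x \<in> A \<Longrightarrow> f1 x = f x" "f1 ` Q1 = Q1"
      using enormal_extend[OF 1 f] by blast
    obtain f2 where f2: "emap (A <#> Q1 <#> Q2) f2" "\<And>x. x \<in> A <#> Q1 \<Longrightarrow> f2 x = f1 x" "f2 ` Q2 = Q2"
      using enormal_extend[OF 2 f1(1)] by blast
    have A: "sub A" "A \<subseteq> S" using emap_sub emap_dom f by auto
    note mA = mult_S[OF A Q1]
    have mA2: "A <#> Q1 \<subseteq> A <#> Q1 <#> Q2" "Q2 \<subseteq> A <#> Q1 <#> Q2" using mult_S[OF _ _ Q2, of "A <#> Q1"] mA by auto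
    have im1: "f2 ` Q1 = Q1" using f1(3) f2(2) mA by (metis image_cong subsetD)
    have "f2 ` (Q1 <#> Q2) = Q1 <#> Q2"
    proof (rule fmap_image_eq[OF emap_fmap[OF f2(1)]])
      show "Q1 <#> Q2 \<subseteq> A <#> Q1 <#> Q2"
        by (rule set_mult_subset[OF emap_sub[OF f2(1)]]) (use mA mA2 in auto)
      show "sub (Q1 <#> Q2)" using m by auto
      show "f2 ` (Q1 <#> Q2) \<subseteq> Q1 <#> Q2"
      proof clarify
        fix x assume "x \<in> Q1 <#> Q2"
        then obtain a b where ab: "a \<in> Q1" "b \<in> Q2" "x = a \<otimes> b" by (auto simp: set_mult_def)
        then have "f2 x = f2 a \<otimes> f2 b" using fmap_mult[OF emap_fmap[OF f2(1)], of a b] mA mA2 by auto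
        then show "f2 x \<in> Q1 <#> Q2" using ab im1 f2(3) unfolding set_mult_def by blast
      qed
    qed
    moreover have "A <#> Q1 <#> Q2 = A <#> (Q1 <#> Q2)"
      using A Q1 Q2 by (intro set_mult_assoc) (auto simp: subgroup.subset)
    moreover have "\<forall>x\<in>A. f2 x = f x" using f1 f2 mA by auto
    ultimately show "\<exists>f'. emap (A <#> (Q1 <#> Q2)) f' \<and> (\<forall>x\<in>A. f' x = f x) \<and> f' ` (Q1 <#> Q2) = Q1 <#> Q2"
      using f2(1) by auto
  qed
qed

text \<open>Closure under products is what makes the \<open>GREATEST\<close> in
  \<open>fusion_core\<close> meaningful; \<open>R\<close> serves as the initial member.\<close>

lemma fusion_core_greatest: "enormal (fusion_core E)" "enormal Q \<Longrightarrow> Q \<subseteq> fusion_core E"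
proof -
  have mult: "enormal (A <#> B) \<and> A \<subseteq> A <#> B \<and> B \<subseteq> A <#> B" if "enormal A" "enormal B" for A B
  proof -
    have "\<forall>s\<in>S. \<forall>b\<in>B. cj s b \<in> B" using enormal_cj[OF that(2)] by blast
    from mult_S[OF enormal_sub[OF that(1)] enormal_S[OF that(1)] enormal_sub[OF that(2)] enormal_S[OF that(2)] this]
    show ?thesis using enormal_mult[OF that] by simp
  qed
  obtain M where M: "enormal M" "\<And>Q. enormal Q \<Longrightarrow> Q \<subseteq> M"
    using greatest_product_closed[where \<Phi> = enormal, OF enormal_sub enormal_R mult] by blast
  have "fusion_core E = M"
    unfolding fusion_core_def fusion_normal_iff by (rule Greatest_equality) (use M in auto)
  then show "enormal (fusion_core E)" "enormal Q \<Longrightarrow> Q \<subseteq> fusion_core E" using M by auto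
qed

text \<open>A morphism \<open>f\<close> of \<open>F\<close> may move \<open>R\<close> and so leave
  \<open>E\<close>. Since \<open>R\<close> is fully normalised, the inverse of \<open>f\<close> on
  the image of \<open>R\<close> extends, up to an automorphism of \<open>R\<close>, to the whole
  normaliser of that image. Following \<open>f\<close> by this extension \<open>c\<close> gives a
  map of \<open>E\<close>; in this way properties of fully normalised conjugates in \<open>F\<close>
  are carried back to \<open>E\<close>.\<close>

lemma conjugate_back:
  assumes W: "R \<subseteq> W" "W \<subseteq> S" and f: "fmap W f"
  obtains c where "fmap (normalizer P (f ` R)) c" "c ` f ` R = R" "f ` W \<subseteq> normalizer P (f ` R)"
    "c ` normalizer P (f ` R) \<subseteq> S" "emap W (\<lambda>x. c (f x))"
proof -
  have fR: "fmap R f" using fmap_subset[OF f sub_R W(1)] .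
  have sfR: "sub (f ` R)" using fmap_image_sub[OF fR sub_R] by simp
  have iR: "inv_into R f ` f ` R = R" using fmap_inj[OF fR] by (simp add: inv_into_image_cancel)
  obtain c where c: "fmap (normalizer P (f ` R)) c" "c ` f ` R = R"
    using extend_to_normalizer[OF fmap_inv_into[OF fR]] iR R by metis
  have fW: "f ` W \<subseteq> normalizer P (f ` R)"
  proof clarify
    fix w assume w: "w \<in> W"
    show "f w \<in> normalizer P (f ` R)"
      unfolding normalizer_iff'[OF sfR]
    proof (intro conjI ballI)
      show "f w \<in> carrier P" using fmap_closed[OF f w] .
      fix y assume "y \<in> f ` R"
      then obtain r where r: "r \<in> R" "y = f r" by auto
      then have "cj (f w) y = f (cj w r)" using fmap_cj[OF f w, of r] W(1) by auto
      moreover have "cj w r \<in> R" using w r W(2) S_iff by blast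
      ultimately show "cj (f w) y \<in> f ` R" by blast
    qed
  qed
  have cS: "c ` normalizer P (f ` R) \<subseteq> S"
  proof clarify
    fix g assume g: "g \<in> normalizer P (f ` R)"
    show "c g \<in> S"
      unfolding S_iff
    proof (intro conjI ballI)
      show "c g \<in> carrier P" using fmap_closed[OF c(1) g] .
      fix y assume "y \<in> R"
      then obtain z where z: "z \<in> f ` R" "y = c z" using c(2) by blast
      then have "cj (c g) y = c (cj g z)"
        using fmap_cj[OF c(1) g, of z] sub_normalizer[OF sfR] by auto
      moreover have "cj g z \<in> f ` R" using g z normalizer_iff'[OF sfR] by blast
      ultimately show "cj (c g) y \<in> R" using c(2) by blast
    qed
  qed
  have "emap W (\<lambda>x. c (f x))"
    unfolding emap_def using W fmap_comp[OF f c(1) fW] c(2) by (simp add: image_image)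
  then show thesis using that c fW cS by blast
qed

lemma centraliser_image:
  assumes "fmap N c" "sub W" "W \<subseteq> N" "centraliser P W \<subseteq> N"
  shows "c ` centraliser P W \<subseteq> centraliser P (c ` W)"
proof clarify
  fix g assume g: "g \<in> centraliser P W"
  then have gN: "g \<in> N" using assms by blast
  have "c g \<otimes> c w = c w \<otimes> c g" if w: "w \<in> W" for w
  proof -
    have "g \<otimes> w = w \<otimes> g" using g w by (simp add: centraliser_def)
    then have "c (g \<otimes> w) = c (w \<otimes> g)" by simp
    then show ?thesis using fmap_mult[OF assms(1)] w gN assms(3) by auto
  qed
  then show "c g \<in> centraliser P (c ` W)"
    using fmap_closed[OF assms(1) gN] by (auto simp: centraliser_def)
qed

lemma finite_centraliser: "finite (centraliser P W)"
  by (rule finite_subset[OF _ finite_P]) (auto simp: centraliser_def)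

text \<open>Let \<open>?V\<close> be a fully normalised conjugate of \<open>W\<close>. An element
  centralising \<open>?V\<close> centralises the image of \<open>R\<close>, hence lies in the domain
  of the map \<open>c\<close> leading back, and \<open>c\<close> maps \<open>?V\<close> onto
  \<open>W\<close> because \<open>W\<close> is invariant under the maps of \<open>E\<close>. So the
  centraliser of \<open>W\<close> is at least as large as that of \<open>?V\<close>, which is the
  largest possible.\<close>

lemma enormal_fully_centralised:
  assumes W: "enormal W" "R \<subseteq> W"
  shows "fully_centralised F W"
proof -
  have sW: "sub W" "W \<subseteq> S" using W enormal_sub enormal_S by auto
  obtain f where f: "fmap W f" "fully_normalised F (f ` W)" using obtain_fully_normalised[OF sW(1)] by blast
  let ?V = "f ` W"
  have sV: "sub ?V" using fmap_image_sub[OF f(1) sW(1)] by simp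
  have sfR: "sub (f ` R)" using fmap_image_sub[OF f(1) sub_R W(2)] .
  obtain c where c: "fmap (normalizer P (f ` R)) c" "f ` W \<subseteq> normalizer P (f ` R)"
      "emap W (\<lambda>x. c (f x))"
    using conjugate_back[OF W(2) sW(2) f(1)] by metis
  have cV: "c ` ?V = W" using enormal_invariant[OF W(1) c(3)] by (simp add: image_image)
  have cN: "centraliser P ?V \<subseteq> normalizer P (f ` R)"
  proof
    fix g assume g: "g \<in> centraliser P ?V"
    then have gP: "g \<in> carrier P" by (simp add: centraliser_def)
    have "cj g y = y" if "y \<in> f ` R" for y
    proof -
      have "y \<in> ?V" using that W(2) by blast
      then have "g \<otimes> y = y \<otimes> g" "y \<in> carrier P" using g sV sub_carrier by (auto simp: centraliser_def)
      then show ?thesis using gP by (simp add: cj_eq_self_iff)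
    qed
    then show "g \<in> normalizer P (f ` R)" using gP by (simp add: normalizer_iff'[OF sfR])
  qed
  note im = centraliser_image[OF c(1) sV c(2) cN]
  have "card (centraliser P ?V) = card (c ` centraliser P ?V)" using fmap_card[OF c(1) cN] by simp
  also have "\<dots> \<le> card (centraliser P W)" using im cV card_mono[OF finite_centraliser] by simp
  finally have le: "card (centraliser P ?V) \<le> card (centraliser P W)" .
  have fc: "fully_centralised F ?V" using f(2) by (rule fully_centralised_if_normalised)
  show ?thesis
    unfolding fully_centralised_iff
  proof (intro conjI allI impI sW(1))
    fix g assume g: "fmap W g"
    have "fmap ?V (\<lambda>y. g (inv_into W f y))"
      by (rule fmap_comp[OF fmap_inv_into[OF f(1)] g]) (use fmap_inv_into_f[OF f(1)] in auto)
    then have "card (centraliser P ((\<lambda>y. g (inv_into W f y)) ` ?V)) \<le> card (centraliser P ?V)"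
      using fc unfolding fully_centralised_iff by blast
    moreover have "(\<lambda>y. g (inv_into W f y)) ` ?V = g ` W"
      using fmap_inv_into_f[OF f(1)] by (simp add: image_image)
    ultimately show "card (centraliser P (g ` W)) \<le> card (centraliser P W)" using le by simp
  qed
qed

lemma mor_E_self: "sub W \<Longrightarrow> R \<subseteq> W \<Longrightarrow> W \<subseteq> S \<Longrightarrow> mor E W W = {\<phi> \<in> mor F W W. \<phi> ` R = R}"
proof -
  assume W: "sub W" "R \<subseteq> W" "W \<subseteq> S"
  show ?thesis
  proof (intro subset_antisym subsetI)
    fix \<phi> assume \<phi>: "\<phi> \<in> mor E W W"
    obtain f where f: "emap (W <#> R) f" "\<forall>x\<in>W. f x = \<phi> x" using mor_E_D(8)[OF \<phi>] by blast
    have "\<phi> ` R = f ` R" using f(2) W(2) by (intro image_cong) auto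
    then show "\<phi> \<in> {\<phi> \<in> mor F W W. \<phi> ` R = R}" using mor_E_D(7)[OF \<phi>] emap_R[OF f(1)] by simp
  next
    fix \<phi> assume \<phi>: "\<phi> \<in> {\<phi> \<in> mor F W W. \<phi> ` R = R}"
    then have "emap W \<phi>" "\<phi> ` W \<subseteq> W" "\<phi> \<in> extensional W" using W by (auto simp: emap_def mor_iff)
    then show "\<phi> \<in> mor E W W" using mor_E_I[of W \<phi> W W] W by (simp add: extensional_restrict)
  qed
qed

text \<open>Saturation of \<open>E\<close> would yield this; here it comes from that of
  \<open>F\<close>. A Sylow subgroup \<open>U\<close> of the automorphism group is transported to a
  fully normalised conjugate of \<open>W\<close>, where elements of \<open>P\<close> induce it, and
  \<open>c\<close> brings these elements into \<open>S\<close>. Conjugation by \<open>?h\<close>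
  thus embeds \<open>U\<close> into \<open>conj_auts W S\<close>, which must have full
  order.\<close>

lemma conj_auts_sylow:
  assumes W: "enormal W" "R \<subseteq> W"
  shows "sylow_subgroup p (conj_auts W S) (fusion_aut E W)"
proof -
  have sW: "sub W" "W \<subseteq> S" using W enormal_sub enormal_S by auto
  define C where "C = {\<phi> \<in> mor F W W. \<phi> ` R = R}"
  have C: "mor E W W = C" unfolding C_def using mor_E_self[OF sW(1) W(2) sW(2)] .
  have sC: "subgroup C (BijGroup W)" unfolding C_def using stabiliser_subgroup[OF sW(1) sub_R W(2)] .
  have A: "fusion_aut E W = perm_group W C" by (simp add: fusion_aut_def C)
  have gC: "group (perm_group W C)" using perm_group_group[OF sC] .
  have finC: "finite C" using aut_finite[OF sW(1)] by (simp add: C_def)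
  have SnW: "S \<subseteq> normalizer P W" using W enormal_cj S_carrier normalizer_iff'[OF sW(1)] by blast
  note T = conj_auts_subgroup[OF sW(1) sub_S SnW]
  have TC: "conj_auts W S \<subseteq> C"
  proof
    fix u assume u: "u \<in> conj_auts W S"
    then obtain s where s: "s \<in> S" "u = restrict (cj s) W" by (auto simp: conj_auts_def)
    have "u ` R = cj s ` R" using s(2) W(2) by (intro image_cong) auto
    then show "u \<in> C" using T(3) u emap_R[OF emap_conj[OF s(1) sW(1) W(2) sW(2)]] by (auto simp: C_def)
  qed
  have sT: "subgroup (conj_auts W S) (perm_group W C)"
    by (rule group.subgroup_incl[OF group_BijGroup T(1) sC TC])
  have "p ^ multiplicity p (order (perm_group W C)) dvd order (perm_group W C)" by (rule multiplicity_dvd)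
  then obtain m where m: "order (perm_group W C) = p ^ multiplicity p (order (perm_group W C)) * m" by (rule dvdE)
  then obtain U where U: "subgroup U (perm_group W C)" "card U = p ^ multiplicity p (order (perm_group W C))"
    using sylow_thm[OF prime gC m] finC by auto
  have UB: "subgroup U (BijGroup W)" using group.incl_subgroup[OF group_BijGroup sC U(1)] .
  have UC: "U \<subseteq> C" using subgroup.subset[OF U(1)] by simp
  then have UF: "U \<subseteq> mor F W W" by (auto simp: C_def)
  obtain f0 where f0: "fmap W f0" "fully_normalised F (f0 ` W)" using obtain_fully_normalised[OF sW(1)] by blast
  obtain f where f: "fmap W f" "f ` W = f0 ` W"
    and fU: "\<And>u. u \<in> U \<Longrightarrow> \<exists>g\<in>normalizer P (f0 ` W). \<forall>x\<in>W. f (u x) = cj g (f x)"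
    using transport_p_automorphisms[OF f0 UB UF U(2)] by blast
  have sfW: "sub (f0 ` W)" using fmap_image_sub[OF f0(1) sW(1)] by simp
  have sfR: "sub (f ` R)" using fmap_image_sub[OF f(1) sub_R W(2)] .
  obtain c where c: "fmap (normalizer P (f ` R)) c" "f ` W \<subseteq> normalizer P (f ` R)"
      "c ` normalizer P (f ` R) \<subseteq> S" "emap W (\<lambda>x. c (f x))"
    using conjugate_back[OF W(2) sW(2) f(1)] by metis
  let ?h = "\<lambda>x. c (f x)"
  have hW: "?h ` W = W" using enormal_invariant[OF W(1) c(4)] by simp
  have hf: "fmap W ?h" using emap_fmap[OF c(4)] .
  have iv: "inv_into W ?h (?h x) = x" if "x \<in> W" for x using fmap_inv_into_f[OF hf that] .
  have uW: "u x \<in> W" if "u \<in> U" "x \<in> W" for u x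
  proof -
    have "u \<in> mor F W W" using that UF by blast
    then show ?thesis using that by (auto simp: mor_iff)
  qed
  let ?\<tau> = "\<lambda>u. \<lambda>y\<in>W. ?h (u (inv_into W ?h y))"
  have "?\<tau> u \<in> conj_auts W S" if u: "u \<in> U" for u
  proof -
    obtain g where g: "g \<in> normalizer P (f0 ` W)" "\<forall>x\<in>W. f (u x) = cj g (f x)" using fU[OF u] by blast
    have gP: "g \<in> carrier P" using g(1) normalizer_iff'[OF sfW] by blast
    \<comment> \<open>The members of \<open>U\<close> stabilise \<open>R\<close>, so an element of
      \<open>P\<close> that induces one of them after transport normalises the image of
      \<open>R\<close> and lies in the domain of \<open>c\<close>.\<close>
    have gR: "g \<in> normalizer P (f ` R)"
      unfolding normalizer_iff'[OF sfR]
    proof (intro conjI ballI gP)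
      fix y assume "y \<in> f ` R"
      then obtain r where r: "r \<in> R" "y = f r" by auto
      then have "cj g y = f (u r)" using g(2) W(2) by auto
      moreover have "u r \<in> R" using UC u r by (auto simp: C_def)
      ultimately show "cj g y \<in> f ` R" by blast
    qed
    have "?\<tau> u = restrict (cj (c g)) W"
    proof (rule ext)
      fix y show "?\<tau> u y = restrict (cj (c g)) W y"
      proof (cases "y \<in> W")
        case True
        then obtain x where x: "x \<in> W" "y = ?h x" using hW by blast
        have "?\<tau> u y = ?h (u x)" using x True iv by simp
        also have "\<dots> = c (cj g (f x))" using g(2) x by simp
        also have "\<dots> = cj (c g) y" using fmap_cj[OF c(1) gR, of "f x"] c(2) x by auto
        finally show ?thesis using True by simp
      qed simp
    qed
    moreover have "c g \<in> S" using c(3) gR by blast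
    ultimately show ?thesis by (auto simp: conj_auts_def)
  qed
  then have sub: "?\<tau> ` U \<subseteq> conj_auts W S" by blast
  have inj: "inj_on ?\<tau> U"
  proof (rule inj_onI)
    fix u v assume u: "u \<in> U" and v: "v \<in> U" and eq: "?\<tau> u = ?\<tau> v"
    show "u = v"
    proof (rule extensionalityI)
      show "u \<in> extensional W" "v \<in> extensional W" using u v UF by (auto simp: mor_iff)
      fix x assume x: "x \<in> W"
      have "?\<tau> u (?h x) = ?\<tau> v (?h x)" using eq by simp
      moreover have "?h x \<in> W" using hW x by blast
      ultimately have "?h (u x) = ?h (v x)" using x iv by simp
      then show "u x = v x" using fmap_inj[OF hf] uW[OF u x] uW[OF v x] by (meson inj_onD)
    qed
  qed
  have fin: "finite (conj_auts W S)" using finite_subset[OF TC finC] .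
  have "card U = card (?\<tau> ` U)" using card_image[OF inj] by simp
  also have "\<dots> \<le> card (conj_auts W S)" by (rule card_mono[OF fin sub])
  finally have le: "p ^ multiplicity p (order (perm_group W C)) \<le> card (conj_auts W S)" using U(2) by simp
  obtain b where b: "card (conj_auts W S) = p ^ b" using T(2) by blast
  have "card (conj_auts W S) dvd order (perm_group W C)"
    using group.lagrange[OF gC sT] by (metis dvd_triv_right)
  moreover have "order (perm_group W C) \<noteq> 0"
    using monoid.order_gt_0_iff_finite[OF group.is_monoid[OF gC]] finC by simp
  ultimately have "b \<le> multiplicity p (order (perm_group W C))"
    using b prime by (metis multiplicity_geI not_prime_unit)
  moreover have "multiplicity p (order (perm_group W C)) \<le> b"
    using le b prime_gt_1_nat[OF prime] by (simp add: power_increasing_iff)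
  ultimately show ?thesis unfolding A sylow_subgroup_def using sT b by simp
qed

text \<open>For \<open>y\<close> in \<open>Y\<close> the quotient
  \<open>\<gamma> y \<otimes> inv y\<close> centralises \<open>Q\<close>, hence lies in
  \<open>Q\<close> and is fixed by \<open>\<gamma>\<close>. This makes the order of
  \<open>\<gamma>\<close> a power of \<open>p\<close>, so on a fully normalised conjugate of
  \<open>Y\<close> it becomes conjugation by some \<open>g\<close>. As \<open>g\<close> centralises
  the image of \<open>Q\<close> and \<open>Q\<close> is fully centralised, \<open>g\<close> is the
  image of an element of the centraliser of \<open>Q\<close>.\<close>

lemma trivial_on_centric:
  assumes Q: "enormal Q" "R \<subseteq> Q" "centraliser P Q \<subseteq> Q"
    and Y: "Q \<subseteq> Y" "Y \<subseteq> S" and \<gamma>: "fmap Y \<gamma>" "\<gamma> ` Y = Y" "\<And>q. q \<in> Q \<Longrightarrow> \<gamma> q = q"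
  obtains z where "z \<in> Q" "\<And>y. y \<in> Y \<Longrightarrow> \<gamma> y = cj z y"
proof -
  have sQ: "sub Q" and sY: "sub Y" using Q enormal_sub fmap_sub[OF \<gamma>(1)] by auto
  have YP: "y \<in> carrier P" if "y \<in> Y" for y using sub_carrier[OF sY that] .
  have \<gamma>Y: "\<gamma> y \<in> Y" if "y \<in> Y" for y using \<gamma>(2) that by blast
  have zQ: "\<gamma> y \<otimes> inv y \<in> Q" if y: "y \<in> Y" for y
  proof -
    have yS: "y \<in> S" using y Y by blast
    have "(\<gamma> y \<otimes> inv y) \<otimes> q = q \<otimes> (\<gamma> y \<otimes> inv y)" if q: "q \<in> Q" for q
    proof -
      have cq: "cj y q \<in> Q" using enormal_cj[OF Q(1) yS q] .
      have qP: "q \<in> carrier P" using sub_carrier[OF sQ q] .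
      have "cj (\<gamma> y) q = \<gamma> (cj y q)" using fmap_cj[OF \<gamma>(1) y, of q] q Y \<gamma>(3) by auto
      also have "\<dots> = cj y q" using \<gamma>(3) cq by simp
      finally have "cj (inv y) (cj (\<gamma> y) q) = cj (inv y) (cj y q)" by simp
      then have "cj (\<gamma> y \<otimes> inv y) q = q" using YP y \<gamma>Y qP by (simp add: cj_cj)
      then show ?thesis using YP y \<gamma>Y qP by (simp add: cj_eq_self_iff)
    qed
    then have "\<gamma> y \<otimes> inv y \<in> centraliser P Q" using YP y \<gamma>Y by (simp add: centraliser_def)
    then show ?thesis using Q(3) by blast
  qed
  let ?g = "restrict \<gamma> Y"
  let ?A = "perm_group Y (mor F Y Y)"
  interpret A: group ?A using perm_group_group[OF aut_subgroup[OF sY]] .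
  have gm: "?g \<in> carrier ?A" using \<gamma> sY by (simp add: restrict_mor_iff)
  have gB: "h \<in> Bij Y" if "h \<in> carrier ?A" for h using that mor_self_Bij by simp
  \<comment> \<open>Each application of \<open>\<gamma>\<close> contributes one more factor
    \<open>\<gamma> y \<otimes> inv y\<close>, which \<open>\<gamma>\<close> fixes; at the exponent
    \<open>order P\<close> the product of these factors is trivial.\<close>
  have pw: "(?g [^]\<^bsub>?A\<^esub> k) y = (\<gamma> y \<otimes> inv y) [^] k \<otimes> y" if y: "y \<in> Y" for k :: nat and y
    using y
  proof (induction k arbitrary: y)
    case 0
    then show ?case using YP by (simp add: BijGroup_def)
  next
    case (Suc k)
    let ?z = "\<gamma> y \<otimes> inv y"
    have z: "?z \<in> Q" "?z \<in> carrier P" using zQ[OF Suc.prems] YP \<gamma>Y Suc.prems by auto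
    have "(?g [^]\<^bsub>?A\<^esub> Suc k) y = (?g [^]\<^bsub>?A\<^esub> k \<otimes>\<^bsub>BijGroup Y\<^esub> ?g) y" by simp
    also have "\<dots> = (?g [^]\<^bsub>?A\<^esub> k) (\<gamma> y)"
      using gB[OF A.nat_pow_closed[OF gm, of k]] gB[OF gm] Suc.prems by (simp add: perm_mult compose_def)
    also have "\<dots> = (\<gamma> (\<gamma> y) \<otimes> inv (\<gamma> y)) [^] k \<otimes> \<gamma> y" using Suc.IH[OF \<gamma>Y[OF Suc.prems]] .
    also have "\<gamma> (\<gamma> y) = ?z \<otimes> \<gamma> y"
    proof -
      have "\<gamma> y = ?z \<otimes> y" using YP \<gamma>Y Suc.prems by (simp add: m_assoc)
      then have "\<gamma> (\<gamma> y) = \<gamma> ?z \<otimes> \<gamma> y" using fmap_mult[OF \<gamma>(1), of ?z y] z Y Suc.prems by auto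
      then show ?thesis using \<gamma>(3) z by simp
    qed
    also have "?z \<otimes> \<gamma> y \<otimes> inv (\<gamma> y) = ?z" using z YP \<gamma>Y Suc.prems by (simp add: m_assoc)
    also have "?z [^] k \<otimes> \<gamma> y = ?z [^] Suc k \<otimes> y" using z YP \<gamma>Y Suc.prems by (simp add: m_assoc)
    finally show ?case .
  qed
  obtain n where n: "order P = p ^ n" using order_P by blast
  have "?g [^]\<^bsub>?A\<^esub> order P = \<one>\<^bsub>?A\<^esub>"
  proof (rule extensionalityI)
    show "?g [^]\<^bsub>?A\<^esub> order P \<in> extensional Y" using gB[OF A.nat_pow_closed[OF gm]] by (simp add: Bij_iff)
    show "\<one>\<^bsub>?A\<^esub> \<in> extensional Y" by (simp add: BijGroup_def)
    fix y assume y: "y \<in> Y"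
    have "(\<gamma> y \<otimes> inv y) [^] order P = \<one>" using YP \<gamma>Y y by (simp add: pow_order_eq_1)
    then show "(?g [^]\<^bsub>?A\<^esub> order P) y = \<one>\<^bsub>?A\<^esub> y" using pw[OF y] YP y by (simp add: BijGroup_def)
  qed
  then have "A.ord ?g dvd p ^ n" using A.pow_eq_id[OF gm] n by simp
  then obtain k where k: "A.ord ?g = p ^ k" using prime by (auto simp: divides_primepow_nat)
  let ?U = "generate ?A {?g}"
  have sU: "subgroup ?U ?A" using A.generate_is_subgroup gm by blast
  have gU: "?g \<in> ?U" by (simp add: generate.incl)
  have cU: "card ?U = p ^ k" using A.generate_pow_card[OF gm] k by simp
  have UB: "subgroup ?U (BijGroup Y)" using group.incl_subgroup[OF group_BijGroup aut_subgroup[OF sY] sU] .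
  have UF: "?U \<subseteq> mor F Y Y" using subgroup.subset[OF sU] by simp
  obtain f0 where f0: "fmap Y f0" "fully_normalised F (f0 ` Y)" using obtain_fully_normalised[OF sY] by blast
  obtain f where f: "fmap Y f" "f ` Y = f0 ` Y"
    and fU: "\<And>u. u \<in> ?U \<Longrightarrow> \<exists>g\<in>normalizer P (f0 ` Y). \<forall>x\<in>Y. f (u x) = cj g (f x)"
    using transport_p_automorphisms[OF f0 UB UF cU] by blast
  obtain g where g: "g \<in> normalizer P (f0 ` Y)" "\<forall>x\<in>Y. f (?g x) = cj g (f x)" using fU[OF gU] by blast
  have "sub (f0 ` Y)" using fmap_image_sub[OF f0(1) sY] by simp
  then have gP: "g \<in> carrier P" using g(1) normalizer_iff' by blast
  have fQ: "fmap Q f" using fmap_subset[OF f(1) sQ Y(1)] .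
  have gC: "g \<in> centraliser P (f ` Q)"
    unfolding centraliser_def
  proof (intro CollectI conjI ballI gP)
    fix y assume "y \<in> f ` Q"
    then obtain q where q: "q \<in> Q" "y = f q" by auto
    then have "q \<in> Y" using Y by blast
    then have "cj g (f q) = f (\<gamma> q)" using g(2) by simp
    then have "cj g y = y" using \<gamma>(3) q by simp
    then show "g \<otimes> y = y \<otimes> g" using gP q fmap_closed[OF fQ] by (simp add: cj_eq_self_iff)
  qed
  \<comment> \<open>The image of the centraliser of \<open>Q\<close> centralises the image of
    \<open>Q\<close>; the bound on cardinalities is the assertion that \<open>Q\<close> is fully
    centralised.\<close>
  have "f ` centraliser P Q = centraliser P (f ` Q)"
  proof (rule card_seteq[OF finite_centraliser])
    show "f ` centraliser P Q \<subseteq> centraliser P (f ` Q)"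
      using centraliser_image[OF fQ sQ subset_refl Q(3)] .
    have "card (centraliser P (f ` Q)) \<le> card (centraliser P Q)"
      using enormal_fully_centralised[OF Q(1,2)] fQ unfolding fully_centralised_iff by blast
    then show "card (centraliser P (f ` Q)) \<le> card (f ` centraliser P Q)"
      using fmap_card[OF fQ Q(3)] by simp
  qed
  then obtain z where z: "z \<in> centraliser P Q" "g = f z" using gC by blast
  then have zQ': "z \<in> Q" "z \<in> Y" using Q(3) Y by auto
  show thesis
  proof (rule that[OF zQ'(1)])
    fix y assume y: "y \<in> Y"
    have "f (\<gamma> y) = f (cj z y)" using g(2) y z(2) fmap_cj[OF f(1) zQ'(2) y] by simp
    then show "\<gamma> y = cj z y"
      using fmap_inj[OF f(1)] \<gamma>Y[OF y] sub_cj[OF sY zQ'(2) y] by (meson inj_onD)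
  qed
qed

end

section \<open>The subgroup of Glauberman and Solomon\<close>

lemma (in group) centre_subgroup:
  "subgroup {z \<in> carrier G. \<forall>g\<in>carrier G. g \<otimes> z = z \<otimes> g} G" (is "subgroup ?Z G")
proof (rule subgroupI)
  fix a assume a: "a \<in> ?Z"
  show "inv a \<in> ?Z"
  proof (intro CollectI conjI ballI)
    fix g assume g: "g \<in> carrier G"
    have aG: "a \<in> carrier G" "a \<otimes> g = g \<otimes> a" using a g by auto
    then have "cj g (inv a) = inv a" using g cj_eq_self_iff[OF g aG(1)] by (simp add: cj_inv)
    then show "g \<otimes> inv a = inv a \<otimes> g" using cj_eq_self_iff[OF g, of "inv a"] aG by simp
  qed (use a in auto)
  fix b assume b: "b \<in> ?Z"
  show "a \<otimes> b \<in> ?Z"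
  proof (intro CollectI conjI ballI)
    fix g assume g: "g \<in> carrier G"
    have aG: "a \<in> carrier G" "a \<otimes> g = g \<otimes> a" "b \<in> carrier G" "b \<otimes> g = g \<otimes> b"
      using a b g by auto
    then have "cj g (a \<otimes> b) = a \<otimes> b"
      using g cj_eq_self_iff[OF g aG(1)] cj_eq_self_iff[OF g aG(3)] by (simp add: cj_mult)
    then show "g \<otimes> (a \<otimes> b) = a \<otimes> b \<otimes> g" using cj_eq_self_iff[OF g, of "a \<otimes> b"] aG by simp
  qed (rule m_closed; use a b in blast)
qed auto

text \<open>Let \<open>a\<close> represent a non-trivial central element of the quotient by the
  centre \<open>?Z\<close>. Every conjugate of \<open>a\<close> is \<open>z \<otimes> a\<close> with
  \<open>z\<close> central and so commutes with \<open>a\<close>, although \<open>a\<close> is not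
  central. In the terms used below, \<open>a\<close> is quadratic on the group without centralising
  it.\<close>

lemma (in group) p_group_second_centre:
  assumes p: "Factorial_Ring.prime p" and G: "order G = p ^ m"
    and nonab: "c \<in> carrier G" "d \<in> carrier G" "c \<otimes> d \<noteq> d \<otimes> c"
  obtains a b where "a \<in> carrier G" "b \<in> carrier G" "a \<otimes> b \<noteq> b \<otimes> a"
    "\<And>g. g \<in> carrier G \<Longrightarrow> a \<otimes> cj g a = cj g a \<otimes> a"
proof -
  let ?Z = "{z \<in> carrier G. \<forall>g\<in>carrier G. g \<otimes> z = z \<otimes> g}"
  note sZ = centre_subgroup
  from sZ have nZ: "?Z \<lhd> G"
  proof (rule normal_invI)
    fix x h assume x: "x \<in> carrier G" and h: "h \<in> ?Z"
    then have "x \<otimes> h \<otimes> inv x = h" by (auto simp: m_assoc)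
    then show "x \<otimes> h \<otimes> inv x \<in> ?Z" using h by simp
  qed
  interpret Q: group "G Mod ?Z" using nZ by (rule normal.factorgroup_is_group)
  have "card (rcosets ?Z) * card ?Z = p ^ m" using lagrange[OF sZ] G by simp
  then have "card (rcosets ?Z) dvd p ^ m" by (rule dvdI[OF sym])
  then obtain k where k: "card (rcosets ?Z) = p ^ k" using divides_primepow_nat[OF p] by blast
  then have ord: "order (G Mod ?Z) = p ^ k" by (simp add: order_def FactGroup_def)
  have "?Z #> c \<in> carrier (G Mod ?Z)" using nonab by (auto simp: FactGroup_def RCOSETS_def)
  moreover have "?Z #> c \<noteq> \<one>\<^bsub>G Mod ?Z\<^esub>"
  proof
    assume "?Z #> c = \<one>\<^bsub>G Mod ?Z\<^esub>"
    then have "?Z #> c = ?Z" by (simp add: FactGroup_def)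
    then have "c \<in> ?Z" using rcos_self[OF nonab(1) sZ] by blast
    then show False using nonab by auto
  qed
  ultimately have "carrier (G Mod ?Z) \<noteq> {\<one>\<^bsub>G Mod ?Z\<^esub>}" by blast
  then obtain C where C: "C \<in> carrier (G Mod ?Z)" "C \<noteq> \<one>\<^bsub>G Mod ?Z\<^esub>"
    "\<forall>D\<in>carrier (G Mod ?Z). D \<otimes>\<^bsub>G Mod ?Z\<^esub> C = C \<otimes>\<^bsub>G Mod ?Z\<^esub> D"
    using Q.p_group_centre_nontrivial[OF p ord] by blast
  then obtain a where a: "a \<in> carrier G" "C = ?Z #> a" by (auto simp: FactGroup_def RCOSETS_def)
  have "a \<notin> ?Z"
  proof
    assume "a \<in> ?Z"
    then have "?Z #> a = ?Z" using sZ by (simp add: subgroup.rcos_const is_group)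
    then show False using C a by (simp add: FactGroup_def)
  qed
  then obtain b where b: "b \<in> carrier G" "b \<otimes> a \<noteq> a \<otimes> b" using a by auto
  have "a \<otimes> cj g a = cj g a \<otimes> a" if g: "g \<in> carrier G" for g
  proof -
    have "?Z #> g \<in> carrier (G Mod ?Z)" using g by (auto simp: FactGroup_def RCOSETS_def)
    then have "(?Z #> g) <#> (?Z #> a) = (?Z #> a) <#> (?Z #> g)" using C a by (simp add: FactGroup_def)
    then have "?Z #> (g \<otimes> a) = ?Z #> (a \<otimes> g)" using a g nZ by (simp add: normal.rcos_sum)
    then have "a \<otimes> g \<in> ?Z #> (g \<otimes> a)" using rcos_self[OF m_closed[OF a(1) g] sZ] by blast
    then obtain z where z: "z \<in> ?Z" "a \<otimes> g = z \<otimes> (g \<otimes> a)" by (auto simp: r_coset_def)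
    then have zc: "z \<in> carrier G" "\<And>h. h \<in> carrier G \<Longrightarrow> h \<otimes> z = z \<otimes> h" by auto
    have "cj g a = inv g \<otimes> (a \<otimes> g)" using a g by (simp add: conj_by_def m_assoc)
    also have "\<dots> = (inv g \<otimes> z) \<otimes> (g \<otimes> a)" using z(2) zc(1) a g by (simp add: m_assoc)
    also have "\<dots> = z \<otimes> a" using zc(1) zc(2)[of "inv g"] a g by (simp add: m_assoc flip: m_assoc[of "inv g" g])
    finally have "cj g a = z \<otimes> a" .
    moreover have "a \<otimes> (z \<otimes> a) = z \<otimes> a \<otimes> a"
      using zc(1) zc(2)[of a] a by (simp add: m_assoc[symmetric])
    ultimately show ?thesis by simp
  qed
  then show thesis using that[OF a(1) b(1)] b(2) by simp
qed

section \<open>Quadratic action and the subgroup \<open>dstar\<close>\<close>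

context saturated_fusion
begin

text \<open>The condition \<open>x \<otimes> cj a x = cj a x \<otimes> x\<close> says that the commutator \<open>[a, x, x]\<close> is trivial.\<close>

definition quadratic_on :: "'a \<Rightarrow> 'a set \<Rightarrow> bool" where
  "quadratic_on x A \<longleftrightarrow> (\<forall>a\<in>A. x \<otimes> cj a x = cj a x \<otimes> x)"

definition gs_subgroup :: "'a set \<Rightarrow> 'a set \<Rightarrow> bool" where
  "gs_subgroup T A \<longleftrightarrow> sub A \<and> A \<subseteq> T \<and> (\<forall>s\<in>T. \<forall>a\<in>A. cj s a \<in> A) \<and>
    (\<forall>x\<in>T. quadratic_on x A \<longrightarrow> (\<forall>a\<in>A. x \<otimes> a = a \<otimes> x))"

definition dstar :: "'a set \<Rightarrow> 'a set" where
  "dstar T = \<Union>{A. gs_subgroup T A}"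

text \<open>An element that is quadratic on the product is quadratic on both factors, hence
  centralises both.\<close>

lemma gs_subgroup_mult:
  assumes T: "sub T" and A: "gs_subgroup T A" and B: "gs_subgroup T B"
  shows "gs_subgroup T (A <#> B)"
proof -
  have A': "sub A" "A \<subseteq> T" "\<And>s a. s \<in> T \<Longrightarrow> a \<in> A \<Longrightarrow> cj s a \<in> A"
    "\<And>x a. x \<in> T \<Longrightarrow> quadratic_on x A \<Longrightarrow> a \<in> A \<Longrightarrow> x \<otimes> a = a \<otimes> x" using A by (auto simp: gs_subgroup_def)
  have B': "sub B" "B \<subseteq> T" "\<And>s a. s \<in> T \<Longrightarrow> a \<in> B \<Longrightarrow> cj s a \<in> B"
    "\<And>x a. x \<in> T \<Longrightarrow> quadratic_on x B \<Longrightarrow> a \<in> B \<Longrightarrow> x \<otimes> a = a \<otimes> x" using B by (auto simp: gs_subgroup_def)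
  have TP: "x \<in> carrier P" if "x \<in> T" for x using T that by (rule sub_carrier)
  have m: "sub (A <#> B)" "A \<subseteq> A <#> B" "B \<subseteq> A <#> B"
    using subgroup_set_mult[OF A'(1) B'(1) B'(3)] A'(2) by blast+
  have AP: "a \<in> carrier P" if "a \<in> A" for a using sub_carrier[OF A'(1) that] .
  have BP: "a \<in> carrier P" if "a \<in> B" for a using sub_carrier[OF B'(1) that] .
  show ?thesis
    unfolding gs_subgroup_def
  proof (intro conjI ballI impI m(1))
    show "A <#> B \<subseteq> T" by (rule set_mult_subset[OF T A'(2) B'(2)])
    fix s c assume s: "s \<in> T" and "c \<in> A <#> B"
    then obtain a b where ab: "a \<in> A" "b \<in> B" "c = a \<otimes> b" by (auto simp: set_mult_def)
    then have "cj s c = cj s a \<otimes> cj s b" using TP[OF s] AP BP by (simp add: cj_mult)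
    then show "cj s c \<in> A <#> B" using A'(3)[OF s ab(1)] B'(3)[OF s ab(2)] unfolding set_mult_def by blast
  next
    fix x c assume x: "x \<in> T" "quadratic_on x (A <#> B)" and "c \<in> A <#> B"
    then obtain a b where ab: "a \<in> A" "b \<in> B" "c = a \<otimes> b" by (auto simp: set_mult_def)
    have "quadratic_on x A" "quadratic_on x B" using x(2) m by (auto simp: quadratic_on_def)
    then have xa: "x \<otimes> a = a \<otimes> x" "x \<otimes> b = b \<otimes> x" using A'(4) B'(4) x(1) ab by auto
    have "x \<otimes> c = (x \<otimes> a) \<otimes> b" using ab AP BP TP[OF x(1)] by (simp add: m_assoc)
    also have "\<dots> = a \<otimes> (x \<otimes> b)" using xa(1) ab AP BP TP[OF x(1)] by (simp add: m_assoc)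
    also have "\<dots> = c \<otimes> x" using xa(2) ab AP BP TP[OF x(1)] by (simp add: m_assoc)
    finally show "x \<otimes> c = c \<otimes> x" .
  qed
qed

text \<open>Every element of \<open>T\<close> centralises \<open>?Z\<close>, whether quadratic or
  not. This supplies an initial member of the family and makes \<open>dstar T\<close> non-trivial
  for non-trivial \<open>T\<close>.\<close>

lemma gs_subgroup_centre:
  assumes T: "sub T" shows "gs_subgroup T {z \<in> T. \<forall>s\<in>T. s \<otimes> z = z \<otimes> s}" (is "gs_subgroup T ?Z")
proof -
  have TP: "x \<in> carrier P" if "x \<in> T" for x using T that by (rule sub_carrier)
  have cz: "cj s z = z" if "s \<in> T" "z \<in> ?Z" for s z using that TP by (simp add: cj_eq_self_iff)
  have "sub ?Z"
    using incl_subgroup[OF T group.centre_subgroup[OF subgroup_imp_group[OF T]]] by simp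
  then show ?thesis using cz by (auto simp: gs_subgroup_def)
qed

text \<open>With \<open>dstar\<close> defined as a union, containing each member is immediate;
  closure under products makes the union itself a member.\<close>

lemma gs_subgroup_dstar:
  assumes T: "sub T" shows "gs_subgroup T (dstar T)" "gs_subgroup T A \<Longrightarrow> A \<subseteq> dstar T"
proof -
  show "gs_subgroup T A \<Longrightarrow> A \<subseteq> dstar T" for A by (auto simp: dstar_def)
  have sub: "sub A" if "gs_subgroup T A" for A using that by (simp add: gs_subgroup_def)
  have mult: "gs_subgroup T (A <#> B) \<and> A \<subseteq> A <#> B \<and> B \<subseteq> A <#> B" if "gs_subgroup T A" "gs_subgroup T B" for A B
  proof -
    have "sub A" "sub B" "\<And>a b. a \<in> A \<Longrightarrow> b \<in> B \<Longrightarrow> cj a b \<in> B" using that by (auto simp: gs_subgroup_def)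
    then show ?thesis using gs_subgroup_mult[OF T that] subgroup_set_mult[of A B] by blast
  qed
  obtain M where M: "gs_subgroup T M" "\<And>A. gs_subgroup T A \<Longrightarrow> A \<subseteq> M"
    using greatest_product_closed[where \<Phi> = "gs_subgroup T", OF sub gs_subgroup_centre[OF T] mult] by blast
  then have "dstar T = M" by (auto simp: dstar_def)
  then show "gs_subgroup T (dstar T)" using M by simp
qed

lemma dstar_nontrivial:
  assumes T: "sub T" "T \<noteq> {\<one>}" shows "dstar T \<noteq> {\<one>}"
proof -
  obtain n where n: "order (P\<lparr>carrier := T\<rparr>) = p ^ n" using sub_card[OF T(1)] by (auto simp: order_def)
  obtain z where "z \<in> T" "z \<noteq> \<one>" "\<forall>g\<in>T. g \<otimes> z = z \<otimes> g"
    using group.p_group_centre_nontrivial[OF subgroup_imp_group[OF T(1)] prime n] T(2) by auto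
  then have "z \<in> dstar T" using gs_subgroup_dstar(2)[OF T(1) gs_subgroup_centre[OF T(1)]] by blast
  then show ?thesis using \<open>z \<noteq> \<one>\<close> by blast
qed

text \<open>The defining condition is applied to elements of \<open>A\<close> itself: in a
  non-abelian \<open>A\<close>, an element of the second centre outside the centre would be
  quadratic on \<open>A\<close> without centralising it.\<close>

lemma gs_subgroup_abelian:
  assumes A: "gs_subgroup T A" and T: "sub T" and ab: "a \<in> A" "b \<in> A"
  shows "a \<otimes> b = b \<otimes> a"
proof (rule ccontr)
  assume ne: "a \<otimes> b \<noteq> b \<otimes> a"
  have A': "sub A" "A \<subseteq> T" using A by (auto simp: gs_subgroup_def)
  let ?A = "P\<lparr>carrier := A\<rparr>"
  obtain n where n: "order ?A = p ^ n" using sub_card[OF A'(1)] by (auto simp: order_def)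
  obtain c d where c: "c \<in> A" "d \<in> A" "c \<otimes> d \<noteq> d \<otimes> c"
    "\<And>g. g \<in> A \<Longrightarrow> c \<otimes> conj_by ?A g c = conj_by ?A g c \<otimes> c"
    using group.p_group_second_centre[OF subgroup_imp_group[OF A'(1)] prime n, of a b] ab ne by auto
  have "quadratic_on c A"
    unfolding quadratic_on_def using c(4) conj_by_subgroup[OF is_group A'(1)] by metis
  then have "c \<otimes> d = d \<otimes> c" using A A'(2) c(1,2) unfolding gs_subgroup_def by blast
  then show False using c by simp
qed

lemma quadratic_on_image:
  assumes f: "fmap D f" "A \<subseteq> D" "x \<in> D" and q: "quadratic_on x A"
  shows "quadratic_on (f x) (f ` A)"
  unfolding quadratic_on_def
proof (intro ballI)
  fix b assume "b \<in> f ` A"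
  then obtain a where a: "a \<in> A" "b = f a" by auto
  have aD: "a \<in> D" using a f(2) by blast
  have cD: "cj a x \<in> D" using sub_cj[OF fmap_sub[OF f(1)] aD f(3)] .
  have "f x \<otimes> cj b (f x) = f (x \<otimes> cj a x)"
    using fmap_mult[OF f(1,3) cD] fmap_cj[OF f(1) aD f(3)] a(2) by simp
  also have "\<dots> = f (cj a x \<otimes> x)" using q a(1) by (simp add: quadratic_on_def)
  also have "\<dots> = cj b (f x) \<otimes> f x"
    using fmap_mult[OF f(1) cD f(3)] fmap_cj[OF f(1) aD f(3)] a(2) by simp
  finally show "f x \<otimes> cj b (f x) = cj b (f x) \<otimes> f x" .
qed

text \<open>An element normalising \<open>T\<close> permutes the subgroups that compete in the
  definition of \<open>dstar T\<close>. Conjugating back by \<open>inv g\<close> turns quadratic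
  action on the conjugate into quadratic action on \<open>dstar T\<close>.\<close>

lemma dstar_conj:
  assumes T: "sub T" and g: "g \<in> normalizer P T" and a: "a \<in> dstar T"
  shows "cj g a \<in> dstar T"
proof -
  let ?A = "dstar T"
  have gP: "g \<in> carrier P" and gT: "\<And>x. x \<in> T \<Longrightarrow> cj g x \<in> T" using g normalizer_iff'[OF T] by auto
  have "inv g \<in> normalizer P T" using g by (rule subgroup.m_inv_closed[OF normalizer_sub[OF T]])
  then have giT: "\<And>x. x \<in> T \<Longrightarrow> cj (inv g) x \<in> T" using normalizer_iff'[OF T] by auto
  have TP: "x \<in> carrier P" if "x \<in> T" for x using T that by (rule sub_carrier)
  have A: "sub ?A" "?A \<subseteq> T" "\<And>s a. s \<in> T \<Longrightarrow> a \<in> ?A \<Longrightarrow> cj s a \<in> ?A"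
    "\<And>x a. x \<in> T \<Longrightarrow> quadratic_on x ?A \<Longrightarrow> a \<in> ?A \<Longrightarrow> x \<otimes> a = a \<otimes> x"
    using gs_subgroup_dstar(1)[OF T] by (auto simp: gs_subgroup_def)
  have AP: "x \<in> carrier P" if "x \<in> ?A" for x using A(2) TP that by blast
  have "gs_subgroup T (cj g ` ?A)"
    unfolding gs_subgroup_def
  proof (intro conjI ballI impI)
    show "sub (cj g ` ?A)" using conj_image_subgroup(1)[OF A(1) gP] .
    show "cj g ` ?A \<subseteq> T" using A(2) gT by blast
    fix s b assume s: "s \<in> T" and "b \<in> cj g ` ?A"
    then obtain a where a: "a \<in> ?A" "b = cj g a" by blast
    have "cj s b = cj g (cj (cj (inv g) s) a)"
      using fmap_cj[OF fmap_conj[OF subgroup_self gP], of "cj (inv g) s" a] a AP TP[OF s] gP by simp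
    then show "cj s b \<in> cj g ` ?A" using A(3)[OF giT[OF s] a(1)] by blast
  next
    fix x b assume x: "x \<in> T" "quadratic_on x (cj g ` ?A)" and "b \<in> cj g ` ?A"
    then obtain a where a: "a \<in> ?A" "b = cj g a" by blast
    have "quadratic_on (cj (inv g) x) (cj (inv g) ` cj g ` ?A)"
      by (rule quadratic_on_image[OF fmap_conj[OF subgroup_self] _ TP[OF x(1)] x(2)]) (use gP AP in auto)
    moreover have "cj (inv g) ` cj g ` ?A = ?A" using AP gP by (force simp: image_image)
    ultimately have "cj (inv g) x \<otimes> a = a \<otimes> cj (inv g) x" using A(4)[OF giT[OF x(1)] _ a(1)] by simp
    then have "cj g (cj (inv g) x \<otimes> a) = cj g (a \<otimes> cj (inv g) x)" by simp
    then show "x \<otimes> b = b \<otimes> x" using gP TP[OF x(1)] AP[OF a(1)] a(2) by (simp add: cj_mult)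
  qed
  then show ?thesis using gs_subgroup_dstar(2)[OF T] a by blast
qed

end

lemma image_onto: "f ` A = B \<Longrightarrow> y \<in> B \<Longrightarrow> \<exists>x\<in>A. y = f x"
  by blast

section \<open>Consequences of constrainedness and \<open>p\<close>-stability in a normaliser
  system\<close>

context normaliser_system
begin

text \<open>With \<open>?y = cj a x\<close>, the word of \<open>p_stable\<close> at \<open>a\<close>
  is \<open>inv x \<otimes> ?y\<close> times the conjugate by \<open>x\<close> of
  \<open>inv ?y \<otimes> x\<close>. Quadratic action says that \<open>x\<close> and
  \<open>?y\<close> commute, so this conjugation has no effect and the word collapses.\<close>

lemma p_stable_conj:
  assumes E: "p_stable p E" and V: "sub V" "V \<subseteq> S" "\<forall>s\<in>S. \<forall>v\<in>V. cj s v \<in> V"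
    and x: "x \<in> S" "quadratic_on x V"
  shows "restrict (cj x) V \<in> p_core p (fusion_aut E V)"
proof -
  let ?\<chi> = "restrict (cj x) V"
  have xP: "x \<in> carrier P" using S_carrier x by blast
  have VP: "v \<in> carrier P" if "v \<in> V" for v using sub_carrier[OF V(1) that] .
  note m = mult_R[OF V(1,2)]
  have e: "emap (V <#> R) (cj x)" using emap_conj[OF x(1)] m by blast
  have "?\<chi> \<in> mor E V V"
    by (rule mor_E_I[OF e V(1) _ V(1,2)]) (use m V x in auto)
  moreover have "?\<chi> (inv a) \<otimes> a \<otimes> ?\<chi> (inv a) \<otimes> ?\<chi> (?\<chi> a) = \<one>" if a: "a \<in> V" for a
  proof -
    let ?y = "cj a x"
    have aP: "a \<in> carrier P" using VP a .
    have yP: "?y \<in> carrier P" using aP xP by simp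
    have q: "x \<otimes> ?y = ?y \<otimes> x" using x(2) a by (simp add: quadratic_on_def)
    have cV: "cj x a \<in> V" "inv a \<in> V" using V x a by (auto simp: subgroup.m_inv_closed)
    have c1: "cj x (inv a) \<otimes> a = inv x \<otimes> ?y"
      using aP xP by (simp add: conj_by_def m_assoc)
    have c2: "cj x (inv a) \<otimes> cj x (cj x a) = cj x (inv a \<otimes> cj x a)"
      using aP xP by (simp add: cj_mult)
    have c3: "inv a \<otimes> cj x a = inv ?y \<otimes> x"
      using aP xP by (simp add: conj_by_def m_assoc inv_mult_group)
    have "cj x ?y = ?y" using cj_eq_self_iff[OF xP yP] q by simp
    moreover have "cj x x = x" using xP by (simp add: conj_by_def)
    ultimately have c4: "cj x (inv ?y \<otimes> x) = inv ?y \<otimes> x" using xP yP by (simp add: cj_mult cj_inv)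
    have "?\<chi> (inv a) \<otimes> a \<otimes> ?\<chi> (inv a) \<otimes> ?\<chi> (?\<chi> a) =
        (cj x (inv a) \<otimes> a) \<otimes> (cj x (inv a) \<otimes> cj x (cj x a))"
      using cV a aP xP by (simp add: m_assoc)
    also have "\<dots> = (inv x \<otimes> ?y) \<otimes> (inv ?y \<otimes> x)" using c1 c2 c3 c4 by simp
    also have "\<dots> = inv x \<otimes> (?y \<otimes> inv ?y) \<otimes> x" using xP yP by (simp only: m_assoc inv_closed m_closed)
    also have "\<dots> = \<one>" using xP yP by simp
    finally show ?thesis .
  qed
  moreover have "inv\<^bsub>grp E\<^esub> a = inv a" if "a \<in> V" for a
    unfolding grp_E using inv_subgroup_eq[OF is_group sub_S] that V(2) by blast
  moreover have "monoid.mult (grp E) = monoid.mult P" "one (grp E) = one P" by (simp_all add: grp_E)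
  ultimately show ?thesis
    using E fully_normalised_E(1)[OF V] unfolding p_stable_def by auto
qed

lemma core_contains_R: "R \<subseteq> fusion_core E"
  using fusion_core_greatest(2)[OF enormal_R] .

text \<open>\<open>constrained\<close> refers to the centraliser inside \<open>S\<close>. Elements
  of \<open>P\<close> that centralise the core centralise \<open>R\<close> as well and therefore lie
  in \<open>S\<close> anyway.\<close>

lemma constrained_centraliser: "constrained E \<Longrightarrow> centraliser P (fusion_core E) \<subseteq> fusion_core E"
proof -
  assume c: "constrained E"
  have "centraliser P (fusion_core E) \<subseteq> S"
  proof
    fix g assume g: "g \<in> centraliser P (fusion_core E)"
    then have gP: "g \<in> carrier P" by (simp add: centraliser_def)
    have "cj g r = r" if r: "r \<in> R" for r
    proof -
      have "g \<otimes> r = r \<otimes> g" using g r core_contains_R by (auto simp: centraliser_def)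
      then show ?thesis using cj_eq_self_iff[OF gP sub_carrier[OF sub_R r]] by simp
    qed
    then show "g \<in> S" using gP S_iff by auto
  qed
  then have "centraliser P (fusion_core E) \<subseteq> centraliser (grp E) (fusion_core E)"
    by (auto simp: centraliser_def grp_E)
  then show ?thesis using c by (auto simp: constrained_def)
qed

text \<open>A morphism and the extension of its restriction to \<open>Q\<close> differ by conjugation with an element
  of \<open>Q\<close>, which allows extending it to the elements inducing \<open>O\<^sub>p(Aut\<^sub>E(Q))\<close>.\<close>

lemma enormal_p_core_preimage:
  assumes Q: "enormal Q" "R \<subseteq> Q" "centraliser P Q \<subseteq> Q"
  shows "enormal {g \<in> S. restrict (cj g) Q \<in> p_core p (fusion_aut E Q)}" (is "enormal ?T")
proof -
  have sQ: "sub Q" "Q \<subseteq> S" using Q enormal_sub enormal_S by auto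
  have QP: "q \<in> carrier P" if "q \<in> Q" for q using sub_carrier[OF sQ(1) that] .
  define C where "C = {\<phi> \<in> mor F Q Q. \<phi> ` R = R}"
  have C: "mor E Q Q = C" unfolding C_def using mor_E_self[OF sQ(1) Q(2) sQ(2)] .
  have sC: "subgroup C (BijGroup Q)" unfolding C_def using stabiliser_subgroup[OF sQ(1) sub_R Q(2)] .
  have A: "fusion_aut E Q = perm_group Q C" by (simp add: fusion_aut_def C)
  have CB: "c \<in> Bij Q" if "c \<in> C" for c using perm_carrier_Bij[OF sC that] .
  interpret A: group "perm_group Q C" using perm_group_group[OF sC] .
  let ?r = "\<lambda>g. restrict (cj g) Q"
  let ?O = "p_core p (perm_group Q C)"
  have syl: "sylow_subgroup p (conj_auts Q S) (perm_group Q C)" using conj_auts_sylow[OF Q(1,2)] A by simp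
  have finC: "finite (carrier (perm_group Q C))" using aut_finite[OF sQ(1)] by (simp add: C_def)
  note O = p_core_normal[OF A.is_group finC prime syl]
  have sO: "subgroup ?O (perm_group Q C)" using O(1) by (rule normal_imp_subgroup)
  have OC: "?O \<subseteq> C" using subgroup.subset[OF sO] by simp
  have rC: "?r s \<in> C" if "s \<in> S" for s
    using that sylow_subgroup_def[of p "conj_auts Q S"] syl subgroup.subset by (fastforce simp: conj_auts_def)
  have cjQ: "cj s q \<in> Q" if "s \<in> S" "q \<in> Q" for s q using enormal_cj[OF Q(1) that] .
  have rmult: "?r (g \<otimes> h) = ?r h \<otimes>\<^bsub>perm_group Q C\<^esub> ?r g" if "g \<in> S" "h \<in> S" for g h
    using that CB[OF rC[OF that(1)]] CB[OF rC[OF that(2)]] S_carrier QP cjQ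
    by (auto simp: perm_mult compose_def fun_eq_iff cj_cj)
  have rone: "?r \<one> = \<one>\<^bsub>perm_group Q C\<^esub>" using QP by (auto simp: BijGroup_def fun_eq_iff)
  have rinv: "?r (inv g) = inv\<^bsub>perm_group Q C\<^esub> ?r g" if g: "g \<in> S" for g
  proof -
    have gi: "inv g \<in> S" using g sub_S by (simp add: subgroup.m_inv_closed)
    have "?r (inv g) \<otimes>\<^bsub>perm_group Q C\<^esub> ?r g = \<one>\<^bsub>perm_group Q C\<^esub>"
      using rmult[OF g gi] rone S_carrier[OF g] by simp
    then show ?thesis using A.inv_equality rC[OF g] rC[OF gi] by simp
  qed
  have T: "?T = {g \<in> S. ?r g \<in> ?O}" unfolding A ..
  have sT: "sub {g \<in> S. ?r g \<in> ?O}"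
  proof (rule subgroupI)
    show "{g \<in> S. ?r g \<in> ?O} \<subseteq> carrier P" using S_carrier by auto
    have "\<one> \<in> {g \<in> S. ?r g \<in> ?O}"
      using subgroup.one_closed[OF sub_S] rone subgroup.one_closed[OF sO] by simp
    then show "{g \<in> S. ?r g \<in> ?O} \<noteq> {}" by blast
    fix g assume g: "g \<in> {g \<in> S. ?r g \<in> ?O}"
    then show "inv g \<in> {g \<in> S. ?r g \<in> ?O}"
      using rinv[of g] subgroup.m_inv_closed[OF sO] subgroup.m_inv_closed[OF sub_S] by simp
    fix h assume h: "h \<in> {g \<in> S. ?r g \<in> ?O}"
    then show "g \<otimes> h \<in> {g \<in> S. ?r g \<in> ?O}"
      using g rmult[of g h] subgroup.m_closed[OF sO] subgroup.m_closed[OF sub_S] by simp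
  qed
  have nT: "cj s g \<in> {g \<in> S. ?r g \<in> ?O}" if s: "s \<in> S" and g: "g \<in> {g \<in> S. ?r g \<in> ?O}" for s g
  proof -
    have gS: "g \<in> S" using g by simp
    have si: "inv s \<in> S" using s sub_S by (simp add: subgroup.m_inv_closed)
    have "?r (cj s g) = ?r s \<otimes>\<^bsub>perm_group Q C\<^esub> (?r g \<otimes>\<^bsub>perm_group Q C\<^esub> ?r (inv s))"
      unfolding conj_by_def[of P s g]
      using rmult[of "inv s \<otimes> g" s] rmult[OF si gS] s si gS sub_S by (simp add: subgroup.m_closed)
    also have "\<dots> = ?r s \<otimes>\<^bsub>perm_group Q C\<^esub> ?r g \<otimes>\<^bsub>perm_group Q C\<^esub> inv\<^bsub>perm_group Q C\<^esub> (?r s)"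
      unfolding rinv[OF s] by (rule A.m_assoc[symmetric]) (use rC[OF s] rC[OF gS] A.inv_closed[of "?r s"] in simp_all)
    also have "\<dots> \<in> ?O" using O(1) g rC[OF s] by (intro normal.inv_op_closed2) auto
    finally show ?thesis using sub_cj[OF sub_S s gS] by simp
  qed
  show ?thesis
    unfolding T enormal_def
  proof (intro conjI allI impI ballI sT)
    let ?T = "{g \<in> S. ?r g \<in> ?O}"
    show "?T \<subseteq> S" by blast
    show "cj s g \<in> ?T" if "s \<in> S" "g \<in> ?T" for s g using nT[OF that] .
    fix B f assume f: "emap B f"
    obtain f1 where f1: "emap (B <#> Q) f1" "\<And>x. x \<in> B \<Longrightarrow> f1 x = f x" "f1 ` Q = Q"
      using enormal_extend[OF Q(1) f] by blast
    have B: "sub B" "R \<subseteq> B" "B \<subseteq> S" using emap_sub emap_dom f by auto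
    have nQ: "\<forall>s\<in>S. \<forall>q\<in>Q. cj s q \<in> Q" using cjQ by blast
    let ?D = "B <#> Q"
    have D: "sub ?D" "B \<subseteq> ?D" "Q \<subseteq> ?D" "?D \<subseteq> S" using mult_S[OF B(1,3) sQ nQ] by auto
    have fQ: "fmap Q f1" using fmap_subset[OF emap_fmap[OF f1(1)] sQ(1) D(3)] .
    have "fully_centralised F (f1 ` Q)" using enormal_fully_centralised[OF Q(1,2)] f1(3) by simp
    \<comment> \<open>\<open>b\<close> extends the restriction of \<open>f1\<close> to
      \<open>Q\<close>, not \<open>f1\<close> itself. Its domain contains both
      \<open>B <#> Q\<close> and the preimage of the \<open>p\<close>-core, but on
      \<open>B <#> Q\<close> it may differ from \<open>f1\<close>.\<close>
    then obtain b where b: "fmap (ext_dom Q f1) b" "\<And>x. x \<in> Q \<Longrightarrow> b x = f1 x"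
      using extend_to_ext_dom[OF fQ] by blast
    have SnQ: "S \<subseteq> normalizer P Q" using normalizer_iff'[OF sQ(1)] S_carrier cjQ by blast
    have DN: "?D \<subseteq> ext_dom Q f1"
    proof
      fix x assume x: "x \<in> ?D"
      have "f1 (cj x q) = cj (f1 x) (f1 q)" if "q \<in> Q" for q
        using fmap_cj[OF emap_fmap[OF f1(1)] x] D(3) that by blast
      then show "x \<in> ext_dom Q f1"
        unfolding ext_dom_def using fmap_closed[OF emap_fmap[OF f1(1)] x] x D(4) SnQ by blast
    qed
    let ?\<alpha> = "restrict f1 Q"
    have \<alpha>C: "?\<alpha> \<in> C" unfolding C[symmetric]
      by (rule mor_E_I[OF f1(1) sQ(1) D(3) sQ]) (simp add: f1(3))
    \<comment> \<open>The \<open>p\<close>-core is normal in the automorphism group and contained in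
      the Sylow subgroup \<open>conj_auts Q S\<close>. So the conjugate by \<open>?\<alpha>\<close>
      of the automorphism induced by \<open>t\<close> is again in the \<open>p\<close>-core and
      induced by an element of \<open>S\<close>.\<close>
    have conj\<alpha>: "\<exists>h\<in>?T. \<forall>q\<in>Q. f1 (cj t q) = cj h (f1 q)" if t: "t \<in> ?T" for t
    proof -
      let ?u = "?\<alpha> \<otimes>\<^bsub>perm_group Q C\<^esub> ?r t \<otimes>\<^bsub>perm_group Q C\<^esub> inv\<^bsub>perm_group Q C\<^esub> ?\<alpha>"
      have tS: "t \<in> S" using t by simp
      have uO: "?u \<in> ?O" using O(1) t \<alpha>C by (intro normal.inv_op_closed2) auto
      then obtain h where h: "h \<in> S" "?u = ?r h" using O(2) by (auto simp: conj_auts_def)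
      have "f1 (cj t q) = cj h (f1 q)" if q: "q \<in> Q" for q
      proof -
        have "?u (?\<alpha> q) = ?\<alpha> (?r t q)" using perm_conj_apply[OF sC \<alpha>C rC[OF tS] q] .
        moreover have "f1 q \<in> Q" using f1(3) q by blast
        ultimately show ?thesis using q cjQ[OF tS q] h(2) by simp
      qed
      moreover have "h \<in> ?T" using h uO by simp
      ultimately show ?thesis by blast
    qed
    have TN: "?T \<subseteq> ext_dom Q f1"
    proof
      fix t assume t: "t \<in> ?T"
      then obtain h where h: "h \<in> ?T" "\<forall>q\<in>Q. f1 (cj t q) = cj h (f1 q)" using conj\<alpha> by blast
      have "t \<in> normalizer P Q" using t SnQ by blast
      moreover have "h \<in> carrier P" using h(1) S_carrier by blast
      ultimately show "t \<in> ext_dom Q f1" unfolding ext_dom_def using h(2) by blast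
    qed
    have nT': "\<forall>s\<in>S. \<forall>g\<in>?T. cj s g \<in> ?T" using nT by blast
    let ?DT = "?D <#> ?T"
    have DT: "sub ?DT" "?D \<subseteq> ?DT" "?T \<subseteq> ?DT" "?DT \<subseteq> S" using mult_S[OF D(1,4) sT _ nT'] by auto
    have "?DT \<subseteq> ext_dom Q f1" by (rule set_mult_subset[OF fmap_sub[OF b(1)] DN TN])
    then have bDT: "fmap ?DT b" using fmap_subset[OF b(1) DT(1)] by blast
    have bR: "b ` R = R"
    proof -
      have "b ` R = f1 ` R" using b(2) Q(2) by (intro image_cong) auto
      then show ?thesis using emap_R[OF f1(1)] by simp
    qed
    have "R \<subseteq> ?DT" using subset_trans[OF B(2) subset_trans[OF D(2) DT(2)]] .
    then have eb: "emap ?DT b" unfolding emap_def using bDT bR DT(4) by (intro conjI)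
    have "b ` Q = f1 ` Q" using b(2) by (intro image_cong) auto
    then have bQ: "b ` Q = Q" using f1(3) by simp
    have ebD: "emap ?D b" using emap_subset[OF eb D(1) _ DT(2)] B(2) D(2) by blast
    let ?Y = "b ` ?D"
    have sY: "sub ?Y" using fmap_image_sub[OF emap_fmap[OF ebD] D(1)] by simp
    have QY: "Q \<subseteq> ?Y" using image_mono[OF D(3), of b] bQ by simp
    have YS: "?Y \<subseteq> S" using emap_into[OF ebD] .
    \<comment> \<open>The discrepancy between the two maps on \<open>B <#> Q\<close>, viewed on the
      image \<open>?Y\<close> under \<open>b\<close>; it fixes \<open>Q\<close> pointwise. It
      preserves \<open>?Y\<close>, because \<open>f1 x\<close> and \<open>b x\<close> differ by a
      factor that centralises \<open>Q\<close> and hence lies in \<open>Q\<close>.\<close>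
    let ?\<gamma> = "\<lambda>y. f1 (inv_into ?D b y)"
    have iv: "inv_into ?D b (b x) = x" if "x \<in> ?D" for x using fmap_inv_into_f[OF emap_fmap[OF ebD] that] .
    have f1Y: "f1 x \<in> ?Y" if x: "x \<in> ?D" for x
    proof -
      have xP: "f1 x \<in> carrier P" "b x \<in> carrier P"
        using fmap_closed[OF emap_fmap[OF f1(1)] x] fmap_closed[OF emap_fmap[OF ebD] x] by auto
      have "cj (f1 x) q = cj (b x) q" if q: "q \<in> Q" for q
      proof -
        obtain w where w: "w \<in> Q" "q = f1 w" using image_onto[OF f1(3) q] by blast
        have cx: "cj x w \<in> Q" using cjQ[OF subsetD[OF D(4) x] w(1)] .
        have wD: "w \<in> ?D" using w D(3) by blast
        have "cj (f1 x) q = f1 (cj x w)" using fmap_cj[OF emap_fmap[OF f1(1)] x wD] w by simp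
        also have "\<dots> = b (cj x w)" using b(2)[OF cx] by simp
        also have "\<dots> = cj (b x) (b w)" using fmap_cj[OF emap_fmap[OF ebD] x wD] .
        also have "b w = q" using b(2)[OF w(1)] w by simp
        finally show ?thesis .
      qed
      note eq = this
      have "f1 x \<otimes> inv (b x) \<in> centraliser P Q"
        unfolding centraliser_def
      proof (intro CollectI conjI ballI)
        fix q assume q: "q \<in> Q"
        have "cj (f1 x \<otimes> inv (b x)) q = cj (inv (b x)) (cj (f1 x) q)"
          using xP QP[OF q] by (simp add: cj_cj)
        also have "\<dots> = q" using eq[OF q] xP QP[OF q] by simp
        finally show "f1 x \<otimes> inv (b x) \<otimes> q = q \<otimes> (f1 x \<otimes> inv (b x))"
          using cj_eq_self_iff[of "f1 x \<otimes> inv (b x)" q] xP QP[OF q] by simp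
      qed (use xP in auto)
      then have fx: "f1 x \<otimes> inv (b x) \<in> ?Y" by (rule subsetD[OF QY subsetD[OF Q(3)]])
      have "f1 x \<otimes> inv (b x) \<otimes> b x \<in> ?Y" using subgroup.m_closed[OF sY fx] x by blast
      then show ?thesis using xP by (simp add: m_assoc)
    qed
    have g1: "fmap ?Y ?\<gamma>"
      by (rule fmap_comp[OF fmap_inv_into[OF emap_fmap[OF ebD]] emap_fmap[OF f1(1)]]) (use iv in auto)
    have g2: "?\<gamma> ` ?Y = ?Y"
      by (rule fmap_image_eq[OF g1 subset_refl _ sY]) (use iv f1Y in auto)
    have g3: "?\<gamma> q = q" if q: "q \<in> Q" for q
    proof -
      obtain w where w: "w \<in> Q" "q = b w" using image_onto[OF bQ q] by blast
      then have "?\<gamma> q = f1 w" using iv D(3) by auto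
      then show ?thesis using b(2)[OF w(1)] w by simp
    qed
    obtain z where z: "z \<in> Q" "\<And>y. y \<in> ?Y \<Longrightarrow> ?\<gamma> y = cj z y"
      using trivial_on_centric[OF Q QY YS g1 g2 g3] by blast
    have zS: "z \<in> S" using z sQ by blast
    \<comment> \<open>Conjugation by \<open>z\<close> makes \<open>b\<close> agree with
      \<open>f\<close> on \<open>B\<close> while keeping the larger domain. It does no harm to
      \<open>?T\<close>, which is normalised by \<open>S\<close>.\<close>
    let ?f = "\<lambda>x. cj z (b x)"
    have efDT: "emap ?DT ?f"
      by (rule emap_comp[OF eb emap_conj[OF zS sub_S R_S subset_refl] emap_into[OF eb]])
    have TS: "?T \<subseteq> S" by blast
    have BTs: "sub (B <#> ?T)" "B \<subseteq> B <#> ?T" "?T \<subseteq> B <#> ?T"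
      using mult_S[OF B(1,3) sT TS nT'] by auto
    have BT: "B <#> ?T \<subseteq> ?DT" by (rule set_mult_subset[OF DT(1)]) (use D(2) DT in auto)
    have ef: "emap (B <#> ?T) ?f"
      using emap_subset[OF efDT BTs(1) subset_trans[OF B(2) BTs(2)] BT] .
    have "?f x = f x" if x: "x \<in> B" for x
    proof -
      have xD: "x \<in> ?D" using subsetD[OF D(2) x] .
      have "cj z (b x) = ?\<gamma> (b x)" by (rule z(2)[OF imageI[OF xD], symmetric])
      also have "\<dots> = f1 x" using iv[OF xD] by simp
      finally show ?thesis using f1(2)[OF x] by simp
    qed
    moreover have "?f ` ?T = ?T"
    proof (rule fmap_image_eq[OF emap_fmap[OF ef] _ _ sT])
      show "?T \<subseteq> B <#> ?T" by (rule BTs(3))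
      show "?f ` ?T \<subseteq> ?T"
      proof clarify
        fix t assume "t \<in> S" "?r t \<in> ?O"
        then have t: "t \<in> ?T" by simp
        then have tD: "t \<in> ?DT" by (rule subsetD[OF DT(3)])
        obtain h where h: "h \<in> ?T" "\<forall>q\<in>Q. f1 (cj t q) = cj h (f1 q)" using conj\<alpha>[OF t] by blast
        have "?r (b t) = ?r h"
        proof (rule restrict_ext)
          fix q assume "q \<in> Q"
          then obtain w where w: "w \<in> Q" "q = f1 w" using image_onto[OF f1(3)] by blast
          have cx: "cj t w \<in> Q" using cjQ[OF _ w(1)] t by simp
          have wD: "w \<in> ?DT" using subsetD[OF DT(2) subsetD[OF D(3) w(1)]] .
          have "cj (b t) q = cj (b t) (b w)" using w b(2) by simp
          also have "\<dots> = b (cj t w)" using fmap_cj[OF emap_fmap[OF eb] tD wD] by simp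
          also have "\<dots> = cj h q" using b(2)[OF cx] h(2) w by simp
          finally show "cj (b t) q = cj h q" .
        qed
        moreover have "b t \<in> S" using subsetD[OF emap_into[OF eb] imageI[OF tD]] .
        ultimately have "b t \<in> ?T" using h(1) by simp
        then have "cj z (b t) \<in> ?T" by (rule nT[OF zS])
        then show "cj z (b t) \<in> S \<and> ?r (cj z (b t)) \<in> ?O" by simp
      qed
    qed
    ultimately show "\<exists>f'. emap (B <#> ?T) f' \<and> (\<forall>x\<in>B. f' x = f x) \<and> f' ` ?T = ?T"
      by (intro exI[of _ ?f] conjI ballI ef)
  qed
qed

text \<open>For \<open>a\<close> in \<open>A\<close> and \<open>q\<close> in the core,
  \<open>cj q a\<close> lies in \<open>A\<close> and commutes with \<open>a\<close>, so
  \<open>a\<close> is quadratic on the core. By \<open>p\<close>-stability it induces there an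
  element of the \<open>p\<close>-core, and the elements of \<open>S\<close> that do so form a
  normal subgroup of \<open>E\<close>, which the core contains.\<close>

lemma abelian_normal_subset_core:
  assumes E: "constrained E" "p_stable p E"
    and A: "A \<subseteq> S" "\<And>s a. s \<in> S \<Longrightarrow> a \<in> A \<Longrightarrow> cj s a \<in> A" "\<And>a b. a \<in> A \<Longrightarrow> b \<in> A \<Longrightarrow> a \<otimes> b = b \<otimes> a"
  shows "A \<subseteq> fusion_core E"
proof -
  let ?Q = "fusion_core E"
  have Q: "enormal ?Q" "R \<subseteq> ?Q" "centraliser P ?Q \<subseteq> ?Q"
    using fusion_core_greatest(1) core_contains_R constrained_centraliser[OF E(1)] by auto
  have nQ: "\<forall>s\<in>S. \<forall>q\<in>?Q. cj s q \<in> ?Q" using enormal_cj[OF Q(1)] by blast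
  have "restrict (cj a) ?Q \<in> p_core p (fusion_aut E ?Q)" if a: "a \<in> A" for a
  proof (rule p_stable_conj[OF E(2) enormal_sub[OF Q(1)] enormal_S[OF Q(1)] nQ])
    show "a \<in> S" using a A by blast
    show "quadratic_on a ?Q"
      unfolding quadratic_on_def using A(2,3) a enormal_S[OF Q(1)] by blast
  qed
  then have "A \<subseteq> {g \<in> S. restrict (cj g) ?Q \<in> p_core p (fusion_aut E ?Q)}" using A(1) by blast
  then show ?thesis using fusion_core_greatest(2)[OF enormal_p_core_preimage[OF Q]] by blast
qed

text \<open>\<open>V\<close> need not contain \<open>R\<close>, so \<open>mor_E_self\<close> does
  not describe its automorphism group in \<open>E\<close>. That group is instead obtained from
  \<open>V <#> R\<close> by restriction: automorphisms of \<open>V\<close> in \<open>E\<close>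
  extend to \<open>V <#> R\<close> by the definition of the normaliser, and those of
  \<open>V <#> R\<close> preserve \<open>V\<close> because it is normal in \<open>E\<close>.\<close>

lemma res_group_hom:
  assumes V: "enormal V"
  defines "W \<equiv> V <#> R"
  shows "group_hom (fusion_aut E W) (fusion_aut E V) (\<lambda>\<phi>. restrict \<phi> V)"
    "(\<lambda>\<phi>. restrict \<phi> V) ` carrier (fusion_aut E W) = carrier (fusion_aut E V)"
    "subgroup (mor E V V) (BijGroup V)"
proof -
  let ?res = "\<lambda>\<phi>. restrict \<phi> V"
  have sV: "sub V" "V \<subseteq> S" using enormal_sub[OF V] enormal_S[OF V] by auto
  have sW: "sub W" "V \<subseteq> W" "R \<subseteq> W" "W \<subseteq> S" unfolding W_def using mult_R[OF sV] by auto
  have C: "mor E W W = {\<phi> \<in> mor F W W. \<phi> ` R = R}" using mor_E_self[OF sW(1,3,4)] .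
  have sC: "subgroup (mor E W W) (BijGroup W)" unfolding C using stabiliser_subgroup[OF sW(1) sub_R sW(3)] .
  have CB: "\<phi> \<in> Bij W" if "\<phi> \<in> mor E W W" for \<phi> using perm_carrier_Bij[OF sC that] .
  have Ce: "emap W \<phi>" if "\<phi> \<in> mor E W W" for \<phi> using that sW unfolding C emap_def by (auto simp: mor_iff)
  have inv: "\<phi> ` V = V" if "\<phi> \<in> mor E W W" for \<phi> using enormal_invariant[OF V Ce[OF that] sW(2)] .
  have resB: "?res \<phi> \<in> Bij V" if "\<phi> \<in> mor E W W" for \<phi>
    using inv[OF that] CB[OF that] inj_on_subset[OF _ sW(2)] unfolding Bij_iff by auto
  have hom: "group_hom (fusion_aut E W) (BijGroup V) ?res"
    unfolding group_hom_def group_hom_axioms_def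
  proof (intro conjI homI group_BijGroup)
    show "group (fusion_aut E W)" unfolding fusion_aut_def by (rule perm_group_group[OF sC])
    fix \<phi> assume \<phi>: "\<phi> \<in> carrier (fusion_aut E W)"
    then show "?res \<phi> \<in> carrier (BijGroup V)" using resB by (simp add: fusion_aut_def BijGroup_def)
    fix \<psi> assume \<psi>: "\<psi> \<in> carrier (fusion_aut E W)"
    have "?res (compose W \<phi> \<psi>) = compose V (?res \<phi>) (?res \<psi>)"
      using sW(2) inv[of \<psi>] \<psi> by (auto simp: compose_def fun_eq_iff fusion_aut_def)
    then show "?res (\<phi> \<otimes>\<^bsub>fusion_aut E W\<^esub> \<psi>) = ?res \<phi> \<otimes>\<^bsub>BijGroup V\<^esub> ?res \<psi>"
      using \<phi> \<psi> CB resB by (simp add: fusion_aut_def perm_mult)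
  qed
  have im: "?res ` mor E W W = mor E V V"
  proof (intro subset_antisym subsetI)
    fix u assume "u \<in> ?res ` mor E W W"
    then obtain \<phi> where \<phi>: "\<phi> \<in> mor E W W" "u = ?res \<phi>" by blast
    then show "u \<in> mor E V V" using mor_E_I[OF Ce[OF \<phi>(1)] sV(1) sW(2) sV] inv by simp
  next
    fix u assume u: "u \<in> mor E V V"
    obtain f where f: "emap W f" "\<forall>x\<in>V. f x = u x" using mor_E_D(8)[OF u] unfolding W_def by blast
    have "f ` W = W" using enormal_invariant[OF enormal_mult[OF V enormal_R]] f(1) by (simp add: W_def)
    then have "restrict f W \<in> mor E W W" using mor_E_I[OF f(1) sW(1) subset_refl sW(1,4)] by simp
    moreover have "?res (restrict f W) = u"
      using f(2) sW(2) mor_E_D(5)[OF u] by (auto simp: fun_eq_iff extensional_def)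
    ultimately show "u \<in> ?res ` mor E W W" by (metis image_eqI)
  qed
  then show "?res ` carrier (fusion_aut E W) = carrier (fusion_aut E V)" by (simp add: fusion_aut_def)
  show sub: "subgroup (mor E V V) (BijGroup V)"
    using group_hom.img_is_subgroup[OF hom] im by (simp add: fusion_aut_def)
  show "group_hom (fusion_aut E W) (fusion_aut E V) ?res"
    using hom perm_group_group[OF sub] im
    unfolding group_hom_def group_hom_axioms_def by (auto simp: hom_def fusion_aut_def)
qed

text \<open>By \<open>p\<close>-stability the conjugate by \<open>d\<close> of the automorphism induced by \<open>x\<close> restricts into
  \<open>Aut\<^sub>S(V)\<close>; Sylow's theorem among the automorphisms of \<open>V R\<close> with this property moves it into
  \<open>Aut\<^sub>S(V R)\<close>.\<close>

lemma conjugate_quadratic_element: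
  assumes E: "p_stable p E" and V: "enormal V" and x: "x \<in> S" "quadratic_on x V"
    and d: "emap (V <#> R) d"
  obtains D e s where "emap D e" "V \<subseteq> D" "x \<in> D" "s \<in> S" "\<And>v. v \<in> V \<Longrightarrow> e v = cj s (d v)"
proof -
  let ?W = "V <#> R" and ?res = "\<lambda>\<phi>. restrict \<phi> V"
  let ?G1 = "fusion_aut E ?W" and ?G2 = "fusion_aut E V"
  have sV: "sub V" "V \<subseteq> S" using enormal_sub[OF V] enormal_S[OF V] by auto
  have nV: "\<forall>s\<in>S. \<forall>v\<in>V. cj s v \<in> V" using enormal_cj[OF V] by blast
  have sW: "sub ?W" "V \<subseteq> ?W" "R \<subseteq> ?W" "?W \<subseteq> S" using mult_R[OF sV] by auto
  have W: "enormal ?W" using enormal_mult[OF V enormal_R] .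
  define C where "C = {\<phi> \<in> mor F ?W ?W. \<phi> ` R = R}"
  have C: "mor E ?W ?W = C" unfolding C_def using mor_E_self[OF sW(1,3,4)] .
  have sC: "subgroup C (BijGroup ?W)" unfolding C_def using stabiliser_subgroup[OF sW(1) sub_R sW(3)] .
  have G1: "?G1 = perm_group ?W C" by (simp add: fusion_aut_def C)
  have Ce: "emap ?W \<phi>" if "\<phi> \<in> C" for \<phi> using that sW unfolding C_def emap_def by (auto simp: mor_iff)
  have finC: "finite C" using aut_finite[OF sW(1)] by (simp add: C_def)
  interpret A: group_hom ?G1 ?G2 ?res using res_group_hom(1)[OF V] .
  have cG1: "carrier ?G1 = C" by (simp add: G1)
  have fG1: "finite (carrier ?G1)" using finC cG1 by simp
  have surj: "?res ` carrier ?G1 = carrier ?G2" using res_group_hom(2)[OF V] .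
  then have fG2: "finite (carrier ?G2)" using fG1 by (metis finite_imageI)
  let ?T1 = "conj_auts ?W S" and ?T2 = "conj_auts V S"
  have T1: "sylow_subgroup p ?T1 ?G1" using conj_auts_sylow[OF W sW(3)] .
  have resT: "?res ` ?T1 = ?T2"
    unfolding conj_auts_def image_image
    by (rule image_cong) (use sW(2) in \<open>auto simp: fun_eq_iff\<close>)
  have T2: "sylow_subgroup p ?T2 ?G2"
    using sylow_subgroup_image[OF A.group_hom_axioms surj fG1 prime T1] resT by simp
  have sT1: "subgroup ?T1 ?G1" and sT2: "subgroup ?T2 ?G2"
    using T1 T2 by (auto simp: sylow_subgroup_def)
  note O = p_core_normal[OF A.H.is_group fG2 prime T2]
  let ?O = "p_core p ?G2"
  have sO: "subgroup ?O ?G2" using O(1) by (rule normal_imp_subgroup)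
  \<comment> \<open>These automorphisms act on \<open>V\<close> like elements of \<open>S\<close>.
    Sylow's theorem is applied inside this group so that the conjugating automorphism
    \<open>b\<close> has that property too.\<close>
  let ?H = "{b \<in> carrier ?G1. ?res b \<in> ?T2}"
  have sH: "subgroup ?H ?G1"
  proof (rule A.G.subgroupI)
    have "\<one>\<^bsub>?G1\<^esub> \<in> ?H" using subgroup.one_closed[OF sT2] A.hom_one A.G.one_closed by simp
    then show "?H \<noteq> {}" by blast
    fix a assume a: "a \<in> ?H"
    then show "inv\<^bsub>?G1\<^esub> a \<in> ?H" using subgroup.m_inv_closed[OF sT2] by simp
    fix b assume "b \<in> ?H"
    then show "a \<otimes>\<^bsub>?G1\<^esub> b \<in> ?H" using a subgroup.m_closed[OF sT2] by simp
  qed auto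
  have T1H: "?T1 \<subseteq> ?H" using resT subgroup.subset[OF sT1] by blast
  \<comment> \<open>By \<open>p\<close>-stability this \<open>p\<close>-group contains the
    automorphism induced by \<open>x\<close>. Its restrictions lie in the normal subgroup
    \<open>?O\<close>, so its conjugate by \<open>?d\<close> stays inside \<open>?H\<close>.\<close>
  let ?K = "{b \<in> ?T1. ?res b \<in> ?O}"
  have sK: "subgroup ?K ?G1"
  proof (rule A.G.subgroupI)
    show "?K \<subseteq> carrier ?G1" using subgroup.subset[OF sT1] by blast
    have "\<one>\<^bsub>?G1\<^esub> \<in> ?K" using subgroup.one_closed[OF sT1] subgroup.one_closed[OF sO] A.hom_one by simp
    then show "?K \<noteq> {}" by blast
    fix a assume a: "a \<in> ?K"
    then have ac: "a \<in> carrier ?G1" using subgroup.mem_carrier[OF sT1] by blast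
    then show "inv\<^bsub>?G1\<^esub> a \<in> ?K" using a subgroup.m_inv_closed[OF sT1] subgroup.m_inv_closed[OF sO] by simp
    fix b assume b: "b \<in> ?K"
    then have bc: "b \<in> carrier ?G1" using subgroup.mem_carrier[OF sT1] by blast
    then show "a \<otimes>\<^bsub>?G1\<^esub> b \<in> ?K" using a b ac subgroup.m_closed[OF sT1] subgroup.m_closed[OF sO] by simp
  qed
  obtain n where "card ?T1 = p ^ n" using T1 by (auto simp: sylow_subgroup_def)
  then obtain k where k: "card ?K = p ^ k"
    using p_subgroup_card[OF A.G.is_group fG1 prime sK sT1] by blast
  let ?u = "restrict (cj x) ?W" and ?d = "restrict d ?W"
  have uK: "?u \<in> ?K"
  proof -
    have "?res ?u = restrict (cj x) V" using sW(2) by (auto simp: fun_eq_iff)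
    then show ?thesis using p_stable_conj[OF E sV nV x] x(1) by (auto simp: conj_auts_def)
  qed
  have dC: "?d \<in> C"
    unfolding C[symmetric]
    by (rule mor_E_I[OF d sW(1) subset_refl sW(1,4)]) (simp add: enormal_invariant[OF W d])
  then have dG: "?d \<in> carrier ?G1" using cG1 by simp
  let ?di = "inv\<^bsub>?G1\<^esub> ?d"
  let ?U = "conj_by ?G1 ?di ` ?K"
  have U: "subgroup ?U ?G1" "card ?U = p ^ k"
    using A.G.conj_image_subgroup[OF sK, of ?di] dG k by auto
  have UH: "?U \<subseteq> ?H"
  proof
    fix w assume "w \<in> ?U"
    then obtain b where b: "b \<in> ?K" "w = conj_by ?G1 ?di b" by blast
    have bc: "b \<in> carrier ?G1" using b(1) subgroup.mem_carrier[OF sT1] by blast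
    have w: "w = ?d \<otimes>\<^bsub>?G1\<^esub> b \<otimes>\<^bsub>?G1\<^esub> inv\<^bsub>?G1\<^esub> ?d" using b dG by (simp add: conj_by_def)
    have rd: "?res ?d \<in> carrier ?G2" using dG A.hom_closed by blast
    have "?res w = ?res ?d \<otimes>\<^bsub>?G2\<^esub> ?res b \<otimes>\<^bsub>?G2\<^esub> inv\<^bsub>?G2\<^esub> (?res ?d)"
      unfolding w using A.hom_mult A.hom_inv dG bc A.G.m_closed A.G.inv_closed by metis
    also have "\<dots> \<in> ?O" using O(1) rd b(1) by (intro normal.inv_op_closed2) auto
    finally show "w \<in> ?H" using O(2) w dG bc by blast
  qed
  let ?GH = "?G1\<lparr>carrier := ?H\<rparr>"
  have gGH: "group ?GH" using A.G.subgroup_imp_group[OF sH] .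
  have fH: "finite (carrier ?GH)" using fG1 by simp
  have sylH: "sylow_subgroup p ?T1 ?GH"
    using sylow_subgroup_intermediate[OF A.G.is_group fG1 prime T1 sH T1H] .
  have UGH: "subgroup ?U ?GH" using A.G.subgroup_incl[OF U(1) sH UH] .
  obtain b where b: "b \<in> ?H" "\<forall>w\<in>?U. b \<otimes>\<^bsub>?G1\<^esub> w \<otimes>\<^bsub>?G1\<^esub> inv\<^bsub>?GH\<^esub> b \<in> ?T1"
    using sylow_conj[OF gGH fH prime sylH UGH U(2)] by auto
  have bG: "b \<in> carrier ?G1" using b by blast
  then have bC: "b \<in> C" using cG1 by simp
  \<comment> \<open>\<open>?d\<close> followed by \<open>b\<close>. The conjugate by
    \<open>\<epsilon>\<close> of the automorphism induced by \<open>x\<close> is induced by an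
    element \<open>t\<close> of \<open>S\<close>, which puts \<open>x\<close> into the extension
    domain of \<open>\<epsilon>\<close>.\<close>
  define \<epsilon> where "\<epsilon> = b \<otimes>\<^bsub>?G1\<^esub> ?d"
  have \<epsilon>G: "\<epsilon> \<in> carrier ?G1" using bG dG by (simp add: \<epsilon>_def)
  then have \<epsilon>C: "\<epsilon> \<in> C" using cG1 by simp
  have uG: "?u \<in> carrier ?G1" using uK subgroup.mem_carrier[OF sT1] by blast
  have "b \<otimes>\<^bsub>?G1\<^esub> conj_by ?G1 ?di ?u \<otimes>\<^bsub>?G1\<^esub> inv\<^bsub>?G1\<^esub> b \<in> ?T1"
    using b uK inv_subgroup_eq[OF A.G.is_group sH b(1)] by auto
  moreover have "b \<otimes>\<^bsub>?G1\<^esub> conj_by ?G1 ?di ?u \<otimes>\<^bsub>?G1\<^esub> inv\<^bsub>?G1\<^esub> b = \<epsilon> \<otimes>\<^bsub>?G1\<^esub> ?u \<otimes>\<^bsub>?G1\<^esub> inv\<^bsub>?G1\<^esub> \<epsilon>"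
    using bG dG uG by (simp add: \<epsilon>_def conj_by_def A.G.m_assoc A.G.inv_mult_group)
  ultimately obtain t where t: "t \<in> S" "\<epsilon> \<otimes>\<^bsub>?G1\<^esub> ?u \<otimes>\<^bsub>?G1\<^esub> inv\<^bsub>?G1\<^esub> \<epsilon> = restrict (cj t) ?W"
    by (auto simp: conj_auts_def)
  have e\<epsilon>: "emap ?W \<epsilon>" using Ce[OF \<epsilon>C] .
  have \<epsilon>W: "\<epsilon> ` ?W = ?W" using enormal_invariant[OF W e\<epsilon> subset_refl] .
  have conj: "\<epsilon> (cj x w) = cj t (\<epsilon> w)" if w: "w \<in> ?W" for w
  proof -
    have "(\<epsilon> \<otimes>\<^bsub>?G1\<^esub> ?u \<otimes>\<^bsub>?G1\<^esub> inv\<^bsub>?G1\<^esub> \<epsilon>) (\<epsilon> w) = \<epsilon> (?u w)"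
      unfolding G1 by (rule perm_conj_apply[OF sC \<epsilon>C _ w]) (use uG cG1 in simp)
    moreover have "\<epsilon> w \<in> ?W" using \<epsilon>W w by blast
    ultimately show ?thesis using t w by simp
  qed
  have "fully_centralised F (\<epsilon> ` ?W)" using enormal_fully_centralised[OF W sW(3)] \<epsilon>W by simp
  then obtain e where e: "fmap (ext_dom ?W \<epsilon>) e" "\<And>w. w \<in> ?W \<Longrightarrow> e w = \<epsilon> w"
    using extend_to_ext_dom[OF emap_fmap[OF e\<epsilon>]] by blast
  let ?D = "ext_dom ?W \<epsilon> \<inter> S"
  have WD: "?W \<subseteq> ?D" using subset_ext_dom[OF emap_fmap[OF e\<epsilon>]] sW(4) by blast
  have "sub ?D" using subgroups_Inter_pair[OF fmap_sub[OF e(1)] sub_S] .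
  then have "fmap ?D e" using fmap_subset[OF e(1)] by blast
  moreover have "e ` R = R"
  proof -
    have "e ` R = \<epsilon> ` R" using e(2) sW(3) by (intro image_cong) auto
    then show ?thesis using emap_R[OF e\<epsilon>] by simp
  qed
  ultimately have ee: "emap ?D e" using WD sW(3) unfolding emap_def by blast
  have xD: "x \<in> ?D"
    unfolding ext_dom_def normalizer_iff'[OF sW(1)]
    using x(1) conj t(1) S_carrier enormal_cj[OF W] by blast
  obtain s where s: "s \<in> S" "?res b = restrict (cj s) V" using b(1) by (auto simp: conj_auts_def)
  have "e v = cj s (d v)" if v: "v \<in> V" for v
  proof -
    have vW: "v \<in> ?W" using sW(2) v by blast
    have dv: "d v \<in> V" using enormal_invariant[OF V d sW(2)] v by blast
    have "e v = \<epsilon> v" using e(2)[OF vW] .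
    also have "\<dots> = b (d v)"
      using perm_carrier_Bij[OF sC] bC dC vW
      unfolding \<epsilon>_def G1 by (simp add: perm_mult compose_def)
    also have "\<dots> = ?res b (d v)" using dv by simp
    also have "\<dots> = cj s (d v)" using s(2) dv by simp
    finally show ?thesis .
  qed
  then show thesis using that[OF ee _ xD s(1)] WD sW(2) by blast
qed

theorem dstar_enormal:
  assumes E: "constrained E" "p_stable p E"
  shows "enormal (dstar S)"
proof -
  let ?A = "dstar S" and ?Q = "fusion_core E"
  have dA: "gs_subgroup S ?A" using gs_subgroup_dstar(1)[OF sub_S] .
  then have A: "sub ?A" "?A \<subseteq> S" "\<And>s a. s \<in> S \<Longrightarrow> a \<in> ?A \<Longrightarrow> cj s a \<in> ?A"
    "\<And>x a. x \<in> S \<Longrightarrow> quadratic_on x ?A \<Longrightarrow> a \<in> ?A \<Longrightarrow> x \<otimes> a = a \<otimes> x" by (auto simp: gs_subgroup_def)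
  have AQ: "?A \<subseteq> ?Q"
    using abelian_normal_subset_core[OF E A(2,3) gs_subgroup_abelian[OF dA sub_S]] by blast
  have Q: "enormal ?Q" "R \<subseteq> ?Q" using fusion_core_greatest(1) core_contains_R by auto
  have sQ: "sub ?Q" "?Q \<subseteq> S" using enormal_sub[OF Q(1)] enormal_S[OF Q(1)] by auto
  have eQ: "f ` ?Q = ?Q" if "emap ?Q f" for f using enormal_invariant[OF Q(1) that] by simp
  \<comment> \<open>\<open>V\<close> is taken as the smallest member of \<open>I\<close>, so that an
    element centralises \<open>V\<close> as soon as it centralises some member of
    \<open>I\<close>.\<close>
  define I where "I = {B. sub B \<and> B \<subseteq> ?Q \<and> ?A \<subseteq> B \<and> (\<forall>f. emap ?Q f \<longrightarrow> f ` B \<subseteq> B)}"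
  define V where "V = \<Inter>I"
  have QI: "?Q \<in> I" unfolding I_def using sQ AQ eQ by blast
  have sV: "sub V" unfolding V_def by (rule subgroups_Inter) (use QI in \<open>auto simp: I_def\<close>)
  have VQ: "V \<subseteq> ?Q" and AV: "?A \<subseteq> V" unfolding V_def using QI by (auto simp: I_def)
  have fV: "f ` V = V" if f: "emap ?Q f" for f
  proof (rule fmap_image_eq[OF emap_fmap[OF f] VQ _ sV])
    show "f ` V \<subseteq> V" unfolding V_def using f by (fastforce simp: I_def)
  qed
  have VS: "V \<subseteq> S" using VQ sQ by blast
  have nV: "cj s v \<in> V" if "s \<in> S" "v \<in> V" for s v
    using fV[OF emap_conj[OF that(1) sQ(1) Q(2) sQ(2)]] that(2) by blast
  have eV: "enormal V"
    unfolding enormal_def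
  proof (intro conjI allI impI sV VS)
    show "\<forall>s\<in>S. \<forall>v\<in>V. cj s v \<in> V" using nV by blast
    fix B f assume f: "emap B f"
    obtain f' where f': "emap (B <#> ?Q) f'" "\<And>x. x \<in> B \<Longrightarrow> f' x = f x" "f' ` ?Q = ?Q"
      using enormal_extend[OF Q(1) f] by blast
    have B: "sub B" "R \<subseteq> B" "B \<subseteq> S" using emap_sub emap_dom f by auto
    have nQ: "\<forall>s\<in>S. \<forall>q\<in>?Q. cj s q \<in> ?Q" using enormal_cj[OF Q(1)] by blast
    note m = mult_S[OF B(1,3) sQ nQ]
    have nV': "\<forall>s\<in>S. \<forall>v\<in>V. cj s v \<in> V" using nV by blast
    note mV = mult_S[OF B(1,3) sV VS nV']
    have "B <#> V \<subseteq> B <#> ?Q" by (rule set_mult_subset[OF emap_sub[OF f'(1)]]) (use m VQ in auto)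
    then have "emap (B <#> V) f'" using emap_subset[OF f'(1)] mV B(2) by blast
    moreover have "emap ?Q f'" using emap_subset[OF f'(1) sQ(1) Q(2)] m by blast
    ultimately show "\<exists>f'. emap (B <#> V) f' \<and> (\<forall>x\<in>B. f' x = f x) \<and> f' ` V = V"
      using f'(2) fV by blast
  qed
  have "gs_subgroup S V"
    unfolding gs_subgroup_def
  proof (intro conjI ballI impI sV VS nV)
    fix x v assume x: "x \<in> S" "quadratic_on x V" and v: "v \<in> V"
    let ?W = "V <#> R"
    have sW: "sub ?W" "V \<subseteq> ?W" "R \<subseteq> ?W" "?W \<subseteq> S" using mult_R[OF sV VS] by auto
    have WQ: "?W \<subseteq> ?Q" by (rule set_mult_subset[OF sQ(1) VQ Q(2)])
    have xP: "x \<in> carrier P" using S_carrier x by blast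
    \<comment> \<open>Applied to the inverse of \<open>f\<close>, the preceding lemma gives a map
      \<open>e\<close> that carries \<open>x\<close> into \<open>S\<close>, maps \<open>V\<close>
      onto itself and sends \<open>f a\<close> to an \<open>S\<close>-conjugate of \<open>a\<close>,
      which lies in \<open>?A\<close>. The image of \<open>x\<close> is quadratic on
      \<open>V\<close>, hence on \<open>?A\<close>, so it centralises \<open>?A\<close>; injectivity
      of \<open>e\<close> transfers this to \<open>x\<close> and \<open>f a\<close>.\<close>
    have main: "x \<otimes> f a = f a \<otimes> x" if f: "emap ?Q f" and a: "a \<in> ?A" for f a
    proof -
      have fW: "emap ?W f" using emap_subset[OF f sW(1,3) WQ] .
      have W: "enormal ?W" using enormal_mult[OF eV enormal_R] .
      have imW: "f ` ?W = ?W" using enormal_invariant[OF W fW] by simp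
      have d: "emap ?W (inv_into ?W f)" using emap_inv[OF fW] imW by simp
      obtain D e s where e: "emap D e" "V \<subseteq> D" "x \<in> D" "s \<in> S"
        "\<And>v. v \<in> V \<Longrightarrow> e v = cj s (inv_into ?W f v)"
        using conjugate_quadratic_element[OF E(2) eV x d] by blast
      have faV: "f a \<in> V" using fV[OF f] a AV by blast
      have iv: "inv_into ?W f (f a) = a" using fmap_inv_into_f[OF emap_fmap[OF fW]] a AV sW(2) by blast
      have efa: "e (f a) = cj s a" using e(5)[OF faV] iv by simp
      have inj: "inj_on e D" using fmap_inj[OF emap_fmap[OF e(1)]] .
      have eVV: "e ` V = V" using enormal_invariant[OF eV e(1,2)] .
      have "quadratic_on (e x) (e ` V)" using quadratic_on_image[OF emap_fmap[OF e(1)] e(2,3) x(2)] .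
      then have "quadratic_on (e x) ?A" using eVV AV by (auto simp: quadratic_on_def)
      moreover have "e x \<in> S" using emap_into[OF e(1)] e(3) by blast
      ultimately have "e x \<otimes> cj s a = cj s a \<otimes> e x" using A(4) A(3)[OF e(4) a] by blast
      then have "e (x \<otimes> f a) = e (f a \<otimes> x)"
        using efa fmap_mult[OF emap_fmap[OF e(1)]] e(2,3) faV by auto
      moreover have "x \<otimes> f a \<in> D" "f a \<otimes> x \<in> D"
        using emap_sub[OF e(1)] e(2,3) faV by (auto simp: subgroup.m_closed)
      ultimately show ?thesis using inj by (meson inj_onD)
    qed
    \<comment> \<open>Quantifying over all maps \<open>f\<close> makes this centraliser invariant
      under them, as membership in \<open>I\<close> demands.\<close>
    define B where "B = {v \<in> ?Q. \<forall>f. emap ?Q f \<longrightarrow> x \<otimes> f v = f v \<otimes> x}"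
    have BP: "f v \<in> carrier P" if "emap ?Q f" "v \<in> ?Q" for f v
      using fmap_closed[OF emap_fmap[OF that(1)] that(2)] .
    have commB: "x \<otimes> f v = f v \<otimes> x \<longleftrightarrow> cj x (f v) = f v" if "emap ?Q f" "v \<in> ?Q" for f v
      using cj_eq_self_iff[OF xP BP[OF that]] by auto
    have "sub B"
    proof (rule subgroupI)
      show "B \<subseteq> carrier P" using sub_carrier[OF sQ(1)] by (auto simp: B_def)
      have "?A \<subseteq> B" unfolding B_def using AQ main by blast
      then show "B \<noteq> {}" using subgroup.one_closed[OF A(1)] by blast
      fix a assume a: "a \<in> B"
      then have aQ: "a \<in> ?Q" by (simp add: B_def)
      have "x \<otimes> f (inv a) = f (inv a) \<otimes> x" if f: "emap ?Q f" for f
      proof -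
        have iQ: "inv a \<in> ?Q" using aQ sQ(1) by (simp add: subgroup.m_inv_closed)
        have "x \<otimes> f a = f a \<otimes> x" using a f by (simp add: B_def)
        then have "cj x (f a) = f a" using commB[OF f aQ] by simp
        then have "cj x (f (inv a)) = f (inv a)"
          using fmap_inv[OF emap_fmap[OF f] aQ] cj_inv[OF xP BP[OF f aQ]] by simp
        then show ?thesis using commB[OF f iQ] by simp
      qed
      then show "inv a \<in> B" using aQ sQ(1) by (simp add: B_def subgroup.m_inv_closed)
      fix b assume b: "b \<in> B"
      then have bQ: "b \<in> ?Q" by (simp add: B_def)
      have "x \<otimes> f (a \<otimes> b) = f (a \<otimes> b) \<otimes> x" if f: "emap ?Q f" for f
      proof -
        have iQ: "a \<otimes> b \<in> ?Q" using aQ bQ sQ(1) by (simp add: subgroup.m_closed)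
        have "x \<otimes> f a = f a \<otimes> x" "x \<otimes> f b = f b \<otimes> x" using a b f by (simp_all add: B_def)
        then have "cj x (f a) = f a" "cj x (f b) = f b" using commB[OF f aQ] commB[OF f bQ] by simp_all
        then have "cj x (f (a \<otimes> b)) = f (a \<otimes> b)"
          using fmap_mult[OF emap_fmap[OF f] aQ bQ] cj_mult[OF xP BP[OF f aQ] BP[OF f bQ]] by simp
        then show ?thesis using commB[OF f iQ] by simp
      qed
      then show "a \<otimes> b \<in> B" using aQ bQ sQ(1) by (simp add: B_def subgroup.m_closed)
    qed
    moreover have "f ` B \<subseteq> B" if f: "emap ?Q f" for f
    proof clarify
      fix b assume b: "b \<in> B"
      then have "f b \<in> ?Q" using eQ[OF f] by (auto simp: B_def)
      moreover have "x \<otimes> g (f b) = g (f b) \<otimes> x" if g: "emap ?Q g" for g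
      proof -
        have "emap ?Q (\<lambda>y. g (f y))" by (rule emap_comp[OF f g]) (simp add: eQ[OF f])
        then show ?thesis using b unfolding B_def by blast
      qed
      ultimately show "f b \<in> B" by (simp add: B_def)
    qed
    moreover have "?A \<subseteq> B" unfolding B_def using AQ main by blast
    ultimately have "B \<in> I" by (auto simp: I_def B_def)
    then have "v \<in> B" using v by (auto simp: V_def)
    then show "x \<otimes> v = v \<otimes> x" using emap_id[OF sQ(1) Q(2) sQ(2)] unfolding B_def by blast
  qed
  then have "V \<subseteq> ?A" using gs_subgroup_dstar(2)[OF sub_S] by blast
  then have "V = ?A" using AV by blast
  then show ?thesis using eV by simp
qed

end

section \<open>The normaliser of the Glauberman--Solomon subgroup\<close>

context saturated_fusion
begin

lemma normaliser_systemI: "fully_normalised F R \<Longrightarrow> normaliser_system p P F R"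
  by (simp add: normaliser_system_def normaliser_system_axioms_def saturated_fusion_axioms)

lemma normalizer_grows:
  assumes H: "sub H" "H \<noteq> carrier P"
  shows "card H < card (normalizer P H)"
proof -
  obtain m where m: "order P = p ^ m" using order_P by blast
  obtain g where g: "g \<in> carrier P" "g \<notin> H" "\<forall>h\<in>H. g \<otimes> h \<otimes> inv g \<in> H"
    using normaliser_grows[OF prime m H] by blast
  have "inv g \<in> normalizer P H"
    unfolding normalizer_iff'[OF H(1)] using g by (simp add: conj_by_def)
  moreover have "inv g \<notin> H" using g(1,2) subgroup.m_inv_closed[OF H(1), of "inv g"] by auto
  ultimately have "H \<subset> normalizer P H" using sub_normalizer[OF H(1)] by blast
  then show ?thesis using psubset_card_mono sub_finite[OF normalizer_sub[OF H(1)]] by blast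
qed

text \<open>For a fully normalised \<open>Z\<close> that is normal in \<open>P\<close>, this
  expresses membership in the normaliser system of \<open>Z\<close>, by
  \<open>stabilises_iff_mor\<close>, without a codomain and for functions that need not be
  extensional.\<close>

definition stabilises :: "'a set \<Rightarrow> 'a set \<Rightarrow> ('a \<Rightarrow> 'a) \<Rightarrow> bool" where
  "stabilises Z A f \<longleftrightarrow> (\<exists>g. fmap (A <#> Z) g \<and> (\<forall>x\<in>A. g x = f x) \<and> g ` Z = Z)"

context
  fixes Z
  assumes Z: "sub Z" "normalizer P Z = carrier P"
begin

lemma Z_mult: "sub A \<Longrightarrow> sub (A <#> Z) \<and> A \<subseteq> A <#> Z \<and> Z \<subseteq> A <#> Z"
proof -
  assume A: "sub A"
  have "cj r q \<in> Z" if "r \<in> A" "q \<in> Z" for r q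
    using that sub_carrier[OF A] Z normalizer_iff'[OF Z(1)] by blast
  then show ?thesis using subgroup_set_mult[OF A Z(1)] by blast
qed

lemma stabilises_subset:
  assumes "stabilises Z A f" "sub A" "sub B" "B \<subseteq> A"
  shows "stabilises Z B f"
proof -
  obtain g where g: "fmap (A <#> Z) g" "\<forall>x\<in>A. g x = f x" "g ` Z = Z"
    using assms(1) by (auto simp: stabilises_def)
  have "B <#> Z \<subseteq> A <#> Z" using assms(4) by (auto simp: set_mult_def)
  then have "fmap (B <#> Z) g" using fmap_subset[OF g(1)] Z_mult[OF assms(3)] by blast
  moreover have "\<forall>x\<in>B. g x = f x" using g(2) assms(4) by blast
  ultimately show ?thesis unfolding stabilises_def using g(3) by blast
qed

lemma stabilises_cong: "stabilises Z A f \<Longrightarrow> (\<And>x. x \<in> A \<Longrightarrow> f x = f' x) \<Longrightarrow> stabilises Z A f'"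
  by (auto simp: stabilises_def)

lemma mult_image:
  assumes g: "fmap (A <#> Z) g" "\<forall>x\<in>A. g x = f x" "g ` Z = Z" and A: "sub A"
  shows "g ` (A <#> Z) = f ` A <#> Z"
proof -
  have h: "g (a \<otimes> z) = f a \<otimes> g z" if "a \<in> A" "z \<in> Z" for a z
    using fmap_mult[OF g(1), of a z] g(2) Z_mult[OF A] that by auto
  show ?thesis
  proof (intro subset_antisym subsetI)
    fix y assume "y \<in> g ` (A <#> Z)"
    then obtain a z where "a \<in> A" "z \<in> Z" "y = g (a \<otimes> z)" by (auto simp: set_mult_def)
    then have az: "y = f a \<otimes> g z" "g z \<in> Z" using h g(3) by auto
    then show "y \<in> f ` A <#> Z" using \<open>a \<in> A\<close> unfolding set_mult_def by blast
  next
    fix y assume "y \<in> f ` A <#> Z"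
    then obtain a w where aw: "a \<in> A" "w \<in> Z" "y = f a \<otimes> w" by (auto simp: set_mult_def)
    then obtain z where "z \<in> Z" "w = g z" using image_onto[OF g(3)] by blast
    then have "y = g (a \<otimes> z)" "a \<otimes> z \<in> A <#> Z" using h aw by (auto simp: set_mult_def)
    then show "y \<in> g ` (A <#> Z)" by blast
  qed
qed

lemma stabilises_comp:
  assumes f: "stabilises Z A f" and f': "stabilises Z B f'" and A: "sub A" and AB: "f ` A \<subseteq> B"
  shows "stabilises Z A (\<lambda>x. f' (f x))"
proof -
  obtain g where g: "fmap (A <#> Z) g" "\<forall>x\<in>A. g x = f x" "g ` Z = Z"
    using f by (auto simp: stabilises_def)
  obtain g' where g': "fmap (B <#> Z) g'" "\<forall>x\<in>B. g' x = f' x" "g' ` Z = Z"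
    using f' by (auto simp: stabilises_def)
  have "g ` (A <#> Z) \<subseteq> B <#> Z" unfolding mult_image[OF g A] using AB by (auto simp: set_mult_def)
  then have "fmap (A <#> Z) (\<lambda>x. g' (g x))" using fmap_comp[OF g(1) g'(1)] by blast
  moreover have "(\<lambda>x. g' (g x)) ` Z = Z" using g(3) g'(3) by (simp flip: image_image)
  moreover have "\<forall>x\<in>A. g' (g x) = f' (f x)" using g(2) g'(2) AB by auto
  ultimately show ?thesis unfolding stabilises_def by blast
qed

lemma stabilises_inv:
  assumes f: "stabilises Z A f" and A: "sub A"
  shows "stabilises Z (f ` A) (inv_into A f)"
proof -
  obtain g where g: "fmap (A <#> Z) g" "\<forall>x\<in>A. g x = f x" "g ` Z = Z"
    using f by (auto simp: stabilises_def)
  have AZ: "A \<subseteq> A <#> Z" "Z \<subseteq> A <#> Z" using Z_mult[OF A] by auto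
  let ?g = "inv_into (A <#> Z) g"
  have "fmap (f ` A <#> Z) ?g" using fmap_inv_into[OF g(1)] unfolding mult_image[OF g A] .
  moreover have "?g y = inv_into A f y" if "y \<in> f ` A" for y
  proof -
    obtain x where x: "x \<in> A" "y = f x" using \<open>y \<in> f ` A\<close> by blast
    have "inj_on f A" using inj_on_subset[OF fmap_inj[OF g(1)] AZ(1)] g(2) by (simp add: inj_on_def)
    then have "inv_into A f y = x" using x by simp
    moreover have "?g (g x) = x" using fmap_inv_into_f[OF g(1)] AZ(1) x(1) by blast
    ultimately show ?thesis using g(2) x by simp
  qed
  moreover have "?g ` Z = Z"
  proof -
    have "?g ` g ` Z = Z" using fmap_inj[OF g(1)] AZ(2) by (rule inv_into_image_cancel)
    then show ?thesis using g(3) by simp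
  qed
  ultimately show ?thesis unfolding stabilises_def by blast
qed

lemma stabilises_iff_mor:
  assumes "fully_normalised F Z"
  shows "\<phi> \<in> mor (fusion_normaliser F Z) A B \<longleftrightarrow>
    sub A \<and> sub B \<and> \<phi> \<in> extensional A \<and> \<phi> ` A \<subseteq> B \<and> stabilises Z A \<phi>"
proof -
  interpret N: normaliser_system p P F Z using normaliser_systemI[OF assms] .
  show ?thesis
  proof
    assume \<phi>: "\<phi> \<in> mor (fusion_normaliser F Z) A B"
    obtain f where f: "N.emap (A <#> Z) f" "\<forall>x\<in>A. f x = \<phi> x" using N.mor_E_D(8)[OF \<phi>] by blast
    then have "stabilises Z A \<phi>" unfolding stabilises_def N.emap_def by blast
    then show "sub A \<and> sub B \<and> \<phi> \<in> extensional A \<and> \<phi> ` A \<subseteq> B \<and> stabilises Z A \<phi>"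
      using N.mor_E_D(1,3,5,6)[OF \<phi>] by blast
  next
    assume *: "sub A \<and> sub B \<and> \<phi> \<in> extensional A \<and> \<phi> ` A \<subseteq> B \<and> stabilises Z A \<phi>"
    then obtain g where g: "fmap (A <#> Z) g" "\<forall>x\<in>A. g x = \<phi> x" "g ` Z = Z"
      by (auto simp: stabilises_def)
    have A: "sub (A <#> Z)" "A \<subseteq> A <#> Z" "Z \<subseteq> A <#> Z" using Z_mult * by auto
    have e: "N.emap (A <#> Z) g"
      unfolding N.emap_def using g A subgroup.subset[OF A(1)] Z(2) by simp
    have "B \<subseteq> normalizer P Z" using * subgroup.subset Z(2) by auto
    moreover have "g ` A \<subseteq> B" using * g(2) by auto
    ultimately have "restrict g A \<in> mor (fusion_normaliser F Z) A B"
      using N.mor_E_I[OF e] A(2) * by blast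
    moreover have "restrict g A = \<phi>" using * g(2) by (auto simp: fun_eq_iff extensional_def)
    ultimately show "\<phi> \<in> mor (fusion_normaliser F Z) A B" by simp
  qed
qed

end

end

section \<open>Comparison of the normaliser systems and the unique maximal element\<close>

lemma fusion_subsystem_antisym:
  assumes "fusion_subsystem N M" "fusion_subsystem M N" shows "N = M"
proof -
  have "carrier (grp N) \<subseteq> carrier (grp M)" "carrier (grp M) \<subseteq> carrier (grp N)"
    using assms subgroup.subset unfolding fusion_subsystem_def by blast+
  then have "carrier (grp N) = carrier (grp M)" by blast
  moreover have "grp N = (grp M)\<lparr>carrier := carrier (grp N)\<rparr>" using assms(1) by (simp add: fusion_subsystem_def)
  ultimately have "grp N = grp M" by simp
  moreover have "mor N = mor M" using assms unfolding fusion_subsystem_def by blast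
  ultimately show ?thesis by simp
qed

text \<open>The induction on \<open>n\<close> is a downward induction on \<open>card (normalizer P R)\<close> and \<open>card Q\<close>. The second
  statement is proved as in Alperin's fusion theorem.\<close>

lemma (in saturated_fusion) normalisers_stabilise:
  assumes up: "\<And>Q T f. Q \<in> QQ \<Longrightarrow> fmap Q f \<Longrightarrow> sub T \<Longrightarrow> f ` Q \<subseteq> T \<Longrightarrow> T \<in> QQ"
    and QQ: "\<And>Q. Q \<in> QQ \<Longrightarrow> sub Q \<and> Q \<noteq> {\<one>}"
    and stable: "\<And>R. fully_normalised F R \<Longrightarrow> R \<noteq> {\<one>} \<Longrightarrow> normalizer P R \<in> QQ \<Longrightarrow>
      constrained (fusion_normaliser F R) \<and> p_stable p (fusion_normaliser F R)"
    and Z: "Z = dstar (carrier P)" "normalizer P Z = carrier P"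
  shows "(\<forall>R A f. fully_normalised F R \<longrightarrow> R \<noteq> {\<one>} \<longrightarrow> normalizer P R \<in> QQ \<longrightarrow>
      card (carrier P) \<le> card (normalizer P R) + n \<longrightarrow> R \<subseteq> A \<longrightarrow> A \<subseteq> normalizer P R \<longrightarrow> fmap A f \<longrightarrow>
      f ` R = R \<longrightarrow> stabilises Z A f) \<and>
    (\<forall>Q f. Q \<in> QQ \<longrightarrow> card (carrier P) \<le> card Q + n \<longrightarrow> fmap Q f \<longrightarrow> stabilises Z Q f)"
proof (induction n rule: less_induct)
  case (less n)
  have sZ: "sub Z" using gs_subgroup_dstar(1)[OF subgroup_self] by (simp add: Z(1) gs_subgroup_def)
  \<comment> \<open>For positive \<open>n\<close> the strict inequality is the induction hypothesis
    at \<open>n - 1\<close>. For \<open>n = 0\<close> it cannot hold, as no subgroup exceeds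
    \<open>P\<close> in order, so no separate base case arises.\<close>
  have IH1: "stabilises Z A f"
    if "fully_normalised F R" "R \<noteq> {\<one>}" "normalizer P R \<in> QQ" "card (carrier P) < card (normalizer P R) + n"
      "R \<subseteq> A" "A \<subseteq> normalizer P R" "fmap A f" "f ` R = R" for R A f
  proof -
    have *: "card (carrier P) \<le> card (normalizer P R) + (n - 1)" using that(4) by simp
    show ?thesis
    proof (cases "n = 0")
      case True
      have "card (normalizer P R) \<le> card (carrier P)"
        using QQ[OF that(3)] subgroup.subset card_mono[OF finite_P] by blast
      then show ?thesis using that(4) True by simp
    next
      case False
      then have "n - 1 < n" by simp
      from less[OF this, THEN conjunct1, rule_format, OF that(1-3) * that(5-8)] show ?thesis .
    qed
  qed
  have IH2: "stabilises Z Q f" if "Q \<in> QQ" "card (carrier P) < card Q + n" "fmap Q f" for Q f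
  proof -
    have *: "card (carrier P) \<le> card Q + (n - 1)" using that(2) by simp
    show ?thesis
    proof (cases "n = 0")
      case True
      have "card Q \<le> card (carrier P)"
        using QQ[OF that(1)] subgroup.subset card_mono[OF finite_P] by blast
      then show ?thesis using that(2) True by simp
    next
      case False
      then have "n - 1 < n" by simp
      from less[OF this, THEN conjunct2, rule_format, OF that(1) * that(3)] show ?thesis .
    qed
  qed
  \<comment> \<open>This half at level \<open>n\<close> is established on its own, since the proof
    of the other half uses it at the same level.\<close>
  have G: "stabilises Z A f"
    if R: "fully_normalised F R" "R \<noteq> {\<one>}" "normalizer P R \<in> QQ"
      and n: "card (carrier P) \<le> card (normalizer P R) + n"
      and A: "R \<subseteq> A" "A \<subseteq> normalizer P R" "fmap A f" "f ` R = R" for R A f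
  proof -
    interpret N: normaliser_system p P F R using normaliser_systemI[OF R(1)] .
    let ?X = "dstar N.S"
    have X: "N.enormal ?X" using N.dstar_enormal stable[OF R] by blast
    have "N.emap A f" using A by (simp add: N.emap_def)
    then obtain g where g: "N.emap (A <#> ?X) g" "\<And>x. x \<in> A \<Longrightarrow> g x = f x" "g ` ?X = ?X"
      using N.enormal_extend[OF X] by blast
    have sA: "sub A" using A(3) by (rule fmap_sub)
    show ?thesis
    proof (cases "N.S = carrier P")
      case True
      then have XZ: "?X = Z" using Z(1) by simp
      show ?thesis
        unfolding stabilises_def using N.emap_fmap[OF g(1)] g(2,3) unfolding XZ by blast
    next
      case False
      have sX: "sub ?X" "?X \<subseteq> N.S" using N.enormal_sub[OF X] N.enormal_S[OF X] by auto
      \<comment> \<open>What normalises \<open>N.S\<close> preserves \<open>?X\<close>. As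
        \<open>N.S\<close> is proper, its normaliser is larger, so the induction hypothesis becomes
        applicable to the normaliser of \<open>?X\<close> and to the conjugate
        \<open>?Y\<close>.\<close>
      have SX: "normalizer P N.S \<subseteq> normalizer P ?X"
      proof
        fix h assume h: "h \<in> normalizer P N.S"
        then have "h \<in> carrier P" using normalizer_iff'[OF N.sub_S] by blast
        then show "h \<in> normalizer P ?X"
          unfolding normalizer_iff'[OF sX(1)] using dstar_conj[OF N.sub_S h] by blast
      qed
      have NX: "sub (normalizer P ?X)" using normalizer_sub[OF sX(1)] .
      have big: "card N.S < card (normalizer P ?X)"
        using normalizer_grows[OF N.sub_S False] card_mono[OF sub_finite[OF NX] SX] by linarith
      have SNX: "N.S \<subseteq> normalizer P ?X" using SX sub_normalizer[OF N.sub_S] by blast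
      obtain f0 where f0: "fmap ?X f0" "fully_normalised F (f0 ` ?X)"
        using obtain_fully_normalised[OF sX(1)] by blast
      obtain c where c: "fmap (normalizer P ?X) c" "c ` ?X = f0 ` ?X"
        using extend_to_normalizer[OF f0] by blast
      let ?Y = "c ` ?X"
      have Y: "fully_normalised F ?Y" using f0(2) c(2) by simp
      have XN: "?X \<subseteq> normalizer P ?X" using sub_normalizer[OF sX(1)] .
      have sY: "sub ?Y" using fmap_image_sub[OF c(1) sX(1) XN] .
      have cN: "c ` normalizer P ?X \<subseteq> normalizer P ?Y"
      proof clarify
        fix h assume h: "h \<in> normalizer P ?X"
        show "c h \<in> normalizer P ?Y"
          unfolding normalizer_iff'[OF sY]
        proof (intro conjI ballI)
          show "c h \<in> carrier P" using fmap_closed[OF c(1) h] .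
          fix y assume "y \<in> ?Y"
          then obtain x where x: "x \<in> ?X" "y = c x" by blast
          then have "cj (c h) y = c (cj h x)" using fmap_cj[OF c(1) h, of x] XN by auto
          moreover have "cj h x \<in> ?X" using h x normalizer_iff'[OF sX(1)] by blast
          ultimately show "cj (c h) y \<in> ?Y" by blast
        qed
      qed
      have NXQ: "normalizer P ?X \<in> QQ"
        by (rule up[OF R(3) fmap_id[OF N.sub_S] NX]) (use SNX in simp)
      have NYQ: "normalizer P ?Y \<in> QQ"
        by (rule up[OF NXQ c(1) normalizer_sub[OF sY] cN])
      have "card (normalizer P ?X) \<le> card (normalizer P ?Y)"
        using fmap_card[OF c(1) subset_refl] card_mono[OF sub_finite[OF normalizer_sub[OF sY]] cN] by simp
      then have bigY: "card (carrier P) < card (normalizer P ?Y) + n" using big n by linarith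
      have "?X \<noteq> {\<one>}" using dstar_nontrivial[OF N.sub_S] QQ[OF R(3)] by blast
      moreover have "?Y = {\<one>} \<Longrightarrow> ?X = {\<one>}"
      proof -
        assume "?Y = {\<one>}"
        then have "card ?X = 1" using fmap_card[OF c(1) XN] by simp
        then obtain x where "?X = {x}" by (rule card_1_singletonE)
        then show "?X = {\<one>}" using subgroup.one_closed[OF sX(1)] by simp
      qed
      ultimately have Y1: "?Y \<noteq> {\<one>}" by blast
      \<comment> \<open>Nothing but the second half of the induction hypothesis relates
        \<open>c\<close>, a mere morphism of \<open>F\<close>, to the normaliser of
        \<open>Z\<close>.\<close>
      have cst: "stabilises Z (normalizer P ?X) c"
        by (rule IH2[OF NXQ _ c(1)]) (use big n in linarith)
      let ?B = "A <#> ?X"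
      have B: "sub ?B" "A \<subseteq> ?B" "?X \<subseteq> ?B" "?B \<subseteq> N.S"
        using N.emap_sub[OF g(1)] N.mult_S[OF sA A(2) sX] N.enormal_cj[OF X] by blast+
      have BN: "?B \<subseteq> normalizer P ?X" using B(4) SNX by blast
      have cB: "fmap ?B c" using fmap_subset[OF c(1) B(1) BN] .
      let ?N = "normalizer P ?X"
      have gN: "g ` ?B \<subseteq> ?N" using N.emap_into[OF g(1)] SNX by blast
      have iv: "inv_into ?B c (c b) = b" if "b \<in> ?B" for b using fmap_inv_into_f[OF cB that] .
      \<comment> \<open>The conjugate of \<open>g\<close> by \<open>c\<close> maps the fully
        normalised subgroup \<open>?Y\<close> onto itself, so the first half of the induction
        hypothesis applies to it. Undoing the conjugation is harmless, as \<open>c\<close>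
        stabilises \<open>Z\<close>.\<close>
      let ?t = "\<lambda>y. c (g (inv_into ?B c y))"
      have t: "?t (c b) = c (g b)" if "b \<in> ?B" for b using iv[OF that] by simp
      have t1: "fmap (c ` ?B) (\<lambda>y. g (inv_into ?B c y))"
        by (rule fmap_comp[OF fmap_inv_into[OF cB] N.emap_fmap[OF g(1)]]) (use iv in auto)
      have ft: "fmap (c ` ?B) ?t"
        by (rule fmap_comp[OF t1 c(1)]) (use iv gN in auto)
      have tY: "?t ` ?Y = ?Y"
      proof -
        have "?t ` ?Y = (\<lambda>x. c (g x)) ` ?X"
          unfolding image_image by (rule image_cong[OF refl]) (use t B(3) in blast)
        also have "\<dots> = c ` g ` ?X" by (simp add: image_image)
        finally show ?thesis using g(3) by simp
      qed
      have st: "stabilises Z (c ` ?B) ?t"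
        by (rule IH1[OF Y Y1 NYQ bigY _ _ ft tY]) (use B(3) BN cN in blast)+
      have scB: "stabilises Z ?B c" using stabilises_subset[OF sZ Z(2) cst NX B(1) BN] .
      have s1: "stabilises Z ?B (\<lambda>b. ?t (c b))"
        using stabilises_comp[OF sZ Z(2) scB st B(1) subset_refl] .
      have s2: "stabilises Z (c ` ?N) (inv_into ?N c)" using stabilises_inv[OF sZ Z(2) cst NX] .
      have "stabilises Z ?B (\<lambda>b. inv_into ?N c (?t (c b)))"
        by (rule stabilises_comp[OF sZ Z(2) s1 s2 B(1)]) (use t gN in auto)
      moreover have "inv_into ?N c (?t (c b)) = g b" if b: "b \<in> ?B" for b
        unfolding t[OF b] using fmap_inv_into_f[OF c(1)] gN b by blast
      ultimately have "stabilises Z ?B g" by (rule stabilises_cong[OF sZ Z(2)])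
      then have "stabilises Z A g" using stabilises_subset[OF sZ Z(2) _ B(1) sA B(2)] by blast
      then show ?thesis by (rule stabilises_cong[OF sZ Z(2)]) (rule g(2))
    qed
  qed
  have "stabilises Z Q f"
    if Q: "Q \<in> QQ" and n: "card (carrier P) \<le> card Q + n" and f: "fmap Q f" for Q f
  proof -
    have sQ: "sub Q" using QQ[OF Q] by blast
    show ?thesis
    proof (cases "Q = carrier P")
      \<comment> \<open>\<open>P\<close> is fully normalised and its own normaliser, so
        \<open>G\<close> applies with both \<open>R\<close> and \<open>A\<close> equal to
        \<open>P\<close>.\<close>
      case True
      have fP: "h ` carrier P = carrier P" if "fmap (carrier P) h" for h
        using fmap_image_eq[OF that subset_refl _ subgroup_self] fmap_closed[OF that] by blast
      have NP: "normalizer P Q = Q"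
        using sub_normalizer[OF sQ] subgroup.subset[OF normalizer_sub[OF sQ]] True by blast
      have "fully_normalised F Q"
        unfolding fully_normalised_iff using sQ fP True by simp
      then show ?thesis
        using G[of Q Q f] Q QQ[OF Q] n f fP[of f] True NP by simp
    next
      case False
      obtain f0 where f0: "fmap Q f0" "fully_normalised F (f0 ` Q)"
        using obtain_fully_normalised[OF sQ] by blast
      let ?X = "f0 ` Q" and ?Y = "f ` Q"
      have sX: "sub ?X" using fmap_image_sub[OF f0(1) sQ subset_refl] .
      have sY: "sub ?Y" using fmap_image_sub[OF f sQ subset_refl] .
      have XQ: "?X \<in> QQ" by (rule up[OF Q f0(1) sX subset_refl])
      have YQ: "?Y \<in> QQ" by (rule up[OF Q f sY subset_refl])
      have NQ: "normalizer P B \<in> QQ" if "B \<in> QQ" for B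
      proof -
        have sB: "sub B" using QQ[OF that] by blast
        show ?thesis by (rule up[OF that fmap_id[OF sB] normalizer_sub[OF sB]]) (simp add: sub_normalizer[OF sB])
      qed
      have cY: "card ?Y = card Q" using fmap_card[OF f subset_refl] .
      have YP: "?Y \<noteq> carrier P"
      proof
        assume "?Y = carrier P"
        then have "card Q = card (carrier P)" using cY by simp
        then show False using False card_subset_eq[OF finite_P subgroup.subset[OF sQ]] by blast
      qed
      \<comment> \<open>\<open>Q\<close> and its image \<open>?Y\<close> are both conjugate to the
        fully normalised \<open>?X\<close>, by maps that extend to their normalisers. These
        normalisers are larger than \<open>Q\<close>, so the induction hypothesis covers
        \<open>c1\<close> and \<open>c2\<close>; what remains of \<open>f\<close> is an automorphism
        \<open>?t\<close> of \<open>?X\<close>.\<close>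
      obtain c1 where c1: "fmap (normalizer P Q) c1" "c1 ` Q = ?X"
        using extend_to_normalizer[OF f0] by blast
      let ?h = "\<lambda>y. f0 (inv_into Q f y)"
      have iv: "inv_into Q f (f q) = q" if "q \<in> Q" for q using fmap_inv_into_f[OF f that] .
      have h: "fmap ?Y ?h"
        by (rule fmap_comp[OF fmap_inv_into[OF f] f0(1)]) (use iv in auto)
      have hY: "?h ` ?Y = ?X" unfolding image_image by (rule image_cong[OF refl]) (simp add: iv)
      obtain c2 where c2: "fmap (normalizer P ?Y) c2" "c2 ` ?Y = ?X"
        using extend_to_normalizer[OF h] f0(2) unfolding hY by blast
      have "stabilises Z (normalizer P Q) c1"
        by (rule IH2[OF NQ[OF Q] _ c1(1)]) (use normalizer_grows[OF sQ False] n in linarith)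
      then have s1: "stabilises Z Q c1"
        by (rule stabilises_subset[OF sZ Z(2) _ normalizer_sub[OF sQ] sQ sub_normalizer[OF sQ]])
      have "stabilises Z (normalizer P ?Y) c2"
        by (rule IH2[OF NQ[OF YQ] _ c2(1)]) (use normalizer_grows[OF sY YP] n cY in linarith)
      then have "stabilises Z ?Y c2"
        by (rule stabilises_subset[OF sZ Z(2) _ normalizer_sub[OF sY] sY sub_normalizer[OF sY]])
      then have s2: "stabilises Z ?X (inv_into ?Y c2)"
        using stabilises_inv[OF sZ Z(2) _ sY, of c2] c2(2) by simp
      have fc1: "fmap Q c1" using fmap_subset[OF c1(1) sQ sub_normalizer[OF sQ]] .
      have fc2: "fmap ?Y c2" using fmap_subset[OF c2(1) sY sub_normalizer[OF sY]] .
      have iv1: "inv_into Q c1 (c1 q) = q" if "q \<in> Q" for q using fmap_inv_into_f[OF fc1 that] .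
      let ?t = "\<lambda>y. c2 (f (inv_into Q c1 y))"
      have t: "?t (c1 q) = c2 (f q)" if "q \<in> Q" for q using iv1[OF that] by simp
      have t1: "fmap (c1 ` Q) (\<lambda>y. f (inv_into Q c1 y))"
        by (rule fmap_comp[OF fmap_inv_into[OF fc1] f]) (use iv1 in auto)
      have "fmap (c1 ` Q) ?t" by (rule fmap_comp[OF t1 fc2]) (use iv1 in auto)
      then have ft: "fmap ?X ?t" using c1(2) by simp
      have "?t ` c1 ` Q = c2 ` f ` Q"
        unfolding image_image by (rule image_cong[OF refl]) (simp add: iv1)
      then have tX: "?t ` ?X = ?X" using c1(2) c2(2) by simp
      have "card Q \<le> card (normalizer P ?X)"
        using fmap_card[OF f0(1) subset_refl] card_mono[OF sub_finite[OF normalizer_sub[OF sX]] sub_normalizer[OF sX]] by simp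
      then have bigX: "card (carrier P) \<le> card (normalizer P ?X) + n" using n by linarith
      have st: "stabilises Z ?X ?t"
        by (rule G[OF f0(2) _ NQ[OF XQ] bigX subset_refl sub_normalizer[OF sX] ft tX])
          (use QQ[OF XQ] in blast)
      have s3: "stabilises Z Q (\<lambda>q. ?t (c1 q))"
        by (rule stabilises_comp[OF sZ Z(2) s1 st sQ]) (simp add: c1(2))
      have "(\<lambda>q. ?t (c1 q)) ` Q \<subseteq> ?X" using c1(2) tX by blast
      then have "stabilises Z Q (\<lambda>q. inv_into ?Y c2 (?t (c1 q)))"
        by (rule stabilises_comp[OF sZ Z(2) s3 s2 sQ])
      then show ?thesis
      proof (rule stabilises_cong[OF sZ Z(2)])
        fix q assume q: "q \<in> Q"
        show "inv_into ?Y c2 (?t (c1 q)) = f q"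
          unfolding t[OF q] using fmap_inv_into_f[OF fc2] q by blast
      qed
    qed
  qed
  then show ?case using G by blast
qed

theorem theorem2:
  fixes p :: nat and P :: "'a monoid" and F :: "'a fusion"
    and QQ :: "'a set set" and NN :: "'a fusion set"
  assumes "Factorial_Ring.prime p" and "odd p"
    and "saturated_fusion_system p P F"
    and "QQ \<noteq> {}"
    and "\<And>Q. Q \<in> QQ \<Longrightarrow> subgroup Q P \<and> Q \<noteq> {\<one>\<^bsub>P\<^esub>}"
    and "\<And>Q R \<phi>. Q \<in> QQ \<Longrightarrow> \<phi> \<in> mor F Q R \<Longrightarrow> R \<in> QQ"
    and "NN = {fusion_normaliser F R | R. subgroup R P \<and> R \<noteq> {\<one>\<^bsub>P\<^esub>} \<and>
                 fully_normalised F R \<and> normalizer P R \<in> QQ}"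
    and "\<And>N. N \<in> NN \<Longrightarrow> constrained N \<and> p_stable p N"
  shows "\<exists>!M. M \<in> NN \<and> (\<forall>N\<in>NN. fusion_subsystem M N \<longrightarrow> N = M)"
proof -
  interpret saturated_fusion p P F using assms(1,3) by (rule saturated_fusion.intro)
  have up: "T \<in> QQ" if "Q \<in> QQ" "fmap Q f" "sub T" "f ` Q \<subseteq> T" for Q T f
  proof -
    have "restrict f Q \<in> mor F Q T" using that by (simp add: restrict_mor_iff)
    then show ?thesis by (rule assms(6)[OF that(1)])
  qed
  have NN_I: "fusion_normaliser F R \<in> NN"
    if "fully_normalised F R" "R \<noteq> {\<one>\<^bsub>P\<^esub>}" "normalizer P R \<in> QQ" for R
    using that unfolding assms(7) fully_normalised_iff by blast
  obtain Q where Q: "Q \<in> QQ" using assms(4) by blast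
  \<comment> \<open>The closure property concerns codomains, and the inclusion of any member into
    \<open>P\<close> is a morphism.\<close>
  have PQ: "carrier P \<in> QQ"
    using up[OF Q fmap_id subgroup_self] assms(5)[OF Q] subgroup.subset by auto
  define Z where "Z = dstar (carrier P)"
  have sZ: "sub Z" using gs_subgroup_dstar(1)[OF subgroup_self] by (simp add: Z_def gs_subgroup_def)
  have NP: "normalizer P (carrier P) = carrier P" using normalizer_iff'[OF subgroup_self] by auto
  have NZ: "normalizer P Z = carrier P"
    unfolding Z_def using normalizer_iff'[OF sZ] dstar_conj[OF subgroup_self] NP by (auto simp: Z_def)
  have Z1: "Z \<noteq> {\<one>\<^bsub>P\<^esub>}"
    unfolding Z_def using dstar_nontrivial[OF subgroup_self] assms(5)[OF PQ] by blast
  \<comment> \<open>A subgroup normal in \<open>P\<close> already has the largest possible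
    normaliser.\<close>
  have fZ: "fully_normalised F Z"
    unfolding fully_normalised_iff NZ
  proof (intro conjI allI impI sZ)
    fix f assume "fmap Z f"
    then have "sub (f ` Z)" by (rule fmap_image_sub[OF _ sZ subset_refl])
    then show "card (normalizer P (f ` Z)) \<le> card (carrier P)"
      by (intro card_mono[OF finite_P] subgroup.subset normalizer_sub)
  qed
  let ?M = "fusion_normaliser F Z"
  have M: "?M \<in> NN" using NN_I[OF fZ Z1] NZ PQ by simp
  have stab: "stabilises Z A f"
    if "fully_normalised F R" "R \<noteq> {\<one>\<^bsub>P\<^esub>}" "normalizer P R \<in> QQ" "R \<subseteq> A" "A \<subseteq> normalizer P R"
      "fmap A f" "f ` R = R" for R A f
  proof -
    have le: "card (carrier P) \<le> card (normalizer P R) + card (carrier P)" by simp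
    show ?thesis
    proof (rule normalisers_stabilise[where QQ = QQ and Z = Z, THEN conjunct1, rule_format,
          OF _ _ _ Z_def NZ that(1-3) le that(4-7)])
      show "T \<in> QQ" if "Q \<in> QQ" "fmap Q f" "sub T" "f ` Q \<subseteq> T" for Q T f
        using up that by blast
      show "sub Q \<and> Q \<noteq> {\<one>\<^bsub>P\<^esub>}" if "Q \<in> QQ" for Q using assms(5) that by blast
      show "constrained (fusion_normaliser F R) \<and> p_stable p (fusion_normaliser F R)"
        if "fully_normalised F R" "R \<noteq> {\<one>\<^bsub>P\<^esub>}" "normalizer P R \<in> QQ" for R
        using assms(8) NN_I that by blast
    qed
  qed
  have sub_M: "fusion_subsystem N ?M" if "N \<in> NN" for N
  proof -
    obtain R where R: "N = fusion_normaliser F R" "R \<noteq> {\<one>\<^bsub>P\<^esub>}" "fully_normalised F R" "normalizer P R \<in> QQ"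
      using \<open>N \<in> NN\<close> unfolding assms(7) by blast
    interpret N: normaliser_system p P F R using normaliser_systemI[OF R(3)] .
    interpret Z: normaliser_system p P F Z using normaliser_systemI[OF fZ] .
    have "\<phi> \<in> mor ?M A B" if \<phi>: "\<phi> \<in> mor N A B" for \<phi> A B
    proof -
      note D = N.mor_E_D[OF \<phi>[unfolded R(1)]]
      \<comment> \<open>\<open>stab\<close> needs a domain containing \<open>R\<close>, so it is
        applied to the extension of \<open>\<phi>\<close> to \<open>A <#> R\<close> that the
        definition of the normaliser provides.\<close>
      obtain f where f: "N.emap (A <#>\<^bsub>P\<^esub> R) f" "\<forall>x\<in>A. f x = \<phi> x" using D(8) by blast
      have st: "stabilises Z (A <#>\<^bsub>P\<^esub> R) f"
        using stab[OF R(3,2,4) N.emap_dom[OF f(1)] N.emap_fmap[OF f(1)] N.emap_R[OF f(1)]] .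
      have "stabilises Z A f"
        using stabilises_subset[OF sZ NZ st] N.mult_R[OF D(1,2)] D(1) by blast
      then have "stabilises Z A \<phi>" by (rule stabilises_cong[OF sZ NZ]) (use f(2) in blast)
      then show ?thesis using stabilises_iff_mor[OF sZ NZ fZ] D(1,3,5,6) by blast
    qed
    then show ?thesis
      unfolding fusion_subsystem_def Z.grp_E R(1) N.grp_E NZ using N.sub_S by auto
  qed
  \<comment> \<open>By \<open>sub_M\<close>, \<open>?M\<close> is even a greatest member, and a
    greatest member is the only maximal one.\<close>
  show ?thesis
  proof (rule ex1I[of _ ?M])
    show "?M \<in> NN \<and> (\<forall>N\<in>NN. fusion_subsystem ?M N \<longrightarrow> N = ?M)"
      using M sub_M fusion_subsystem_antisym by blast
    fix M' assume "M' \<in> NN \<and> (\<forall>N\<in>NN. fusion_subsystem M' N \<longrightarrow> N = M')"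
    then show "M' = ?M" using M sub_M by blast
  qed
qed

end
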